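(* Let $\theta>0$, and for $n\in\mathbb{N}$ let $M_n$ and $M_n^{\mathrm{sq}}$ be random integers sampled according to the probability measures $\mathbb{P}_n$ on $\Omega_n$ and $\mathbb{P}_n^{\mathrm{sq}}$ on $\Omega_n^{\mathrm{sq}}$ respectively, where $$\mathbb{P}_n(\{N\})=\frac1{Z_n}\frac{\tau_\theta(N)}{N},\ N\in\Omega_n,\qquad \mathbb{P}_n^{\mathrm{sq}}(\{N\})=\frac{1}{Z_n^{\mathrm{sq}}}\frac{\tau_\theta(N)}{N},\ N\in\Omega_n^{\mathrm{sq}}.$$ Then there exist constants $0<K_1\le K_2<\infty$ depending only on $\theta$ such that for all $n\ge2$, $$\frac{K_1}{(\log n)^{\min\{1,\theta\}}}\le d_K\Big(\frac{\log M_n}{\log p_n},D_\theta\Big),\ d_K\Big(\frac{\log M_n^{\mathrm{sq}}}{\log p_n},D_\theta\Big)\le\frac{K_2}{(\log n)^{\min\{1,\theta\}}}.$$ Moreover, there exist constants $0<K_3\le K_4<\infty$ depending only on $\theta$ such that for all $n\ge2$, $$\frac{K_3}{\log n}\le d_{1,1}\Big(\frac{\log M_n}{\log p_n},D_\theta\Big),\ d_{1,1}\Big(\frac{\log M_n^{\mathrm{sq}}}{\log p_n},D_\theta\Big)\le\frac{K_4}{\log n}.$$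
   Context: $(p_k)_{k\ge1}$ are the primes in increasing order. $\Omega_n$ is the set of positive integers all of whose prime factors are $\le p_n$; $\Omega_n^{\mathrm{sq}}$ is the set of square-free elements of $\Omega_n$. $\tau_\theta:\mathbb{N}\to\mathbb{R}$ is the multiplicative function ($\tau_\theta(ab)=\tau_\theta(a)\tau_\theta(b)$ if $\gcd(a,b)=1$) with $\tau_\theta(p^j)=\frac{\theta(\theta+1)\cdots(\theta+j-1)}{j!}$ for primes $p$ and $j\ge0$. $Z_n=\sum_{N\in\Omega_n}\tau_\theta(N)/N$ and $Z_n^{\mathrm{sq}}=\sum_{N\in\Omega_n^{\mathrm{sq}}}\tau_\theta(N)/N$ are the (finite) normalizing constants. $D_\theta$ has the generalized Dickman distribution with mean $\theta$: the unique non-negative solution (in law) of $D\stackrel{d}{=}U^{1/\theta}(D+1)$ with $U$ uniform on $[0,1]$ independent of $D$. $d_K(X,Y)=\sup_{t\ge0}|\mathbb{P}(X\le t)-\mathbb{P}(Y\le t)|$. $d_{1,1}(X,Y)=\sup_h|\mathbb{E}h(X)-\mathbb{E}h(Y)|$ over differentiable $h:\mathbb{R}\to\mathbb{R}$ with $h$ and $h'$ both Lipschitz with constant at most $1$. *)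

theory Defs
  imports "HOL-Probability.Probability" "HOL-Computational_Algebra.Computational_Algebra"
begin

text \<open>
  Primes are indexed from 1, so that \<open>nth_prime 1 = 2\<close>; the value at 0 carries no meaning.
\<close>

definition nth_prime :: "nat \<Rightarrow> nat" where
  "nth_prime k = enumerate {p. prime p} (k - 1)"

definition smooth :: "nat \<Rightarrow> nat set" where
  "smooth n = {N. 0 < N \<and> (\<forall>p. prime p \<longrightarrow> p dvd N \<longrightarrow> p \<le> nth_prime n)}"

definition smooth_sq :: "nat \<Rightarrow> nat set" where
  "smooth_sq n = {N \<in> smooth n. squarefree N}"

definition tau :: "real \<Rightarrow> nat \<Rightarrow> real" where
  "tau \<theta> N = (\<Prod>p\<in>prime_factors N.
     pochhammer \<theta> (multiplicity p N) / fact (multiplicity p N))"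

text \<open>
  The following three facts determine \<open>tau \<theta>\<close> on the positive integers.
\<close>

lemma tau_1: "tau \<theta> 1 = 1"
  by (simp add: tau_def)

lemma tau_prime_power:
  assumes "prime p"
  shows "tau \<theta> (p ^ j) = pochhammer \<theta> j / fact j"
proof (cases "j = 0")
  case False
  then have "prime_factors (p ^ j) = {p}"
    using assms by (simp add: prime_factorization_prime_power)
  then show ?thesis
    using assms by (simp add: tau_def)
qed (simp add: tau_def)

lemma tau_mult_coprime:
  assumes "coprime a b" "0 < a" "0 < b"
  shows "tau \<theta> (a * b) = tau \<theta> a * tau \<theta> b"
proof -
  define f where "f N p = pochhammer \<theta> (multiplicity p N) / fact (multiplicity p N)" for N p :: nat
  have disj: "prime_factors a \<inter> prime_factors b = {}"
    using coprime_common_divisor[OF assms(1)] not_prime_unit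
    by (auto simp only: in_prime_factors_iff disjoint_iff)
  have mult: "multiplicity p (a * b) = multiplicity p a + multiplicity p b" if "prime p" for p
    using that assms by (simp add: prime_elem_multiplicity_mult_distrib)
  have A: "f (a * b) p = f a p" if "p \<in> prime_factors a" for p
  proof -
    have "prime p" "\<not> p dvd b"
      using that disj assms by (auto simp: prime_factors_dvd)
    then show ?thesis
      by (simp add: f_def mult not_dvd_imp_multiplicity_0)
  qed
  have B: "f (a * b) p = f b p" if "p \<in> prime_factors b" for p
  proof -
    have "prime p" "\<not> p dvd a"
      using that disj assms by (auto simp: prime_factors_dvd)
    then show ?thesis
      by (simp add: f_def mult not_dvd_imp_multiplicity_0)
  qed
  have "prime_factors (a * b) = prime_factors a \<union> prime_factors b"
    using assms by (simp add: prime_factors_product)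
  then have "tau \<theta> (a * b) = (\<Prod>p\<in>prime_factors a. f (a * b) p) * (\<Prod>p\<in>prime_factors b. f (a * b) p)"
    using disj by (simp add: tau_def f_def prod.union_disjoint)
  also have "\<dots> = (\<Prod>p\<in>prime_factors a. f a p) * (\<Prod>p\<in>prime_factors b. f b p)"
    using A B by (simp cong: prod.cong)
  finally show ?thesis
    by (simp add: tau_def f_def)
qed

text \<open>
  \<open>weighted_law \<theta> (smooth n)\<close> and \<open>weighted_law \<theta> (smooth_sq n)\<close> are the distributions of the
  random integers $M_n$ and $M_n^{sq}$.
\<close>

definition Zconst :: "real \<Rightarrow> nat set \<Rightarrow> real" where
  "Zconst \<theta> A = (\<Sum>\<^sub>\<infinity>N\<in>A. tau \<theta> N / real N)"

definition weighted_law :: "real \<Rightarrow> nat set \<Rightarrow> nat measure" where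
  "weighted_law \<theta> A = point_measure A (\<lambda>N. ennreal (1 / Zconst \<theta> A * (tau \<theta> N / real N)))"

definition scaled_log_law :: "real \<Rightarrow> nat \<Rightarrow> real measure" where
  "scaled_log_law \<theta> n =
     distr (weighted_law \<theta> (smooth n)) borel (\<lambda>N. ln (real N) / ln (real (nth_prime n)))"

definition scaled_log_law_sq :: "real \<Rightarrow> nat \<Rightarrow> real measure" where
  "scaled_log_law_sq \<theta> n =
     distr (weighted_law \<theta> (smooth_sq n)) borel (\<lambda>N. ln (real N) / ln (real (nth_prime n)))"

text \<open>
  The generalized Dickman distribution is characterised by the distributional fixed-point equation
  for $D = U^{1/\theta}(D+1)$; the independence of $U$ and $D$ is the product measure.
\<close>

definition gen_dickman :: "real \<Rightarrow> real measure \<Rightarrow> bool" where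
  "gen_dickman \<theta> D \<longleftrightarrow>
     prob_space D \<and> sets D = sets borel \<and> (AE x in D. 0 \<le> x) \<and>
     D = distr (uniform_measure lborel {0..1} \<Otimes>\<^sub>M D) borel
           (\<lambda>(u, x). u powr (1 / \<theta>) * (x + 1))"

text \<open>
  Both distances depend only on the laws of the random variables and are defined on laws.
\<close>

definition dist_K :: "real measure \<Rightarrow> real measure \<Rightarrow> real" where
  "dist_K \<mu> \<nu> = (SUP t\<in>{0..}. \<bar>measure \<mu> {..t} - measure \<nu> {..t}\<bar>)"

text \<open>
  The supremum is taken in the extended reals, so no boundedness has to be presupposed.
\<close>

definition dist_11 :: "real measure \<Rightarrow> real measure \<Rightarrow> ereal" where
  "dist_11 \<mu> \<nu> =
     (SUP h\<in>{h :: real \<Rightarrow> real. (\<forall>x. h differentiable at x) \<and>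
                1-lipschitz_on UNIV h \<and> 1-lipschitz_on UNIV (deriv h)}.
        ereal \<bar>(\<integral>x. h x \<partial>\<mu>) - (\<integral>x. h x \<partial>\<nu>)\<bar>)"

end

theory Submission
  imports Defs "HOL-Number_Theory.Number_Theory" "HOL-Real_Asymp.Real_Asymp"
begin

text \<open>
  Write \<open>X\<close> for \<open>ln M / L\<close> with \<open>L = ln p\<^sub>n\<close>, \<open>F\<close> for its distribution function, \<open>I t = E (t - X)\<^sup>+\<close>, and
  \<open>G\<close> for the distribution function of the Dickman law. The multiplicativity of \<open>\<tau>\<close> expresses the
  \<open>p\<close>-adic valuation of \<open>M\<close> in the mean by the law of \<open>p M\<close>; summing over \<open>p\<close> with weight \<open>ln p\<close> and
  using Mertens' first theorem one finds that \<open>F\<close> solves the delay equation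
  \<open>t F t = (1 + \<theta>) I t - \<theta> I (t - 1)\<close> of the Dickman law up to an error \<open>O(F t / L)\<close>. It has the
  integrating factor \<open>t powr (- 1 - \<theta>)\<close>. For the stop-loss transform \<open>E (X - t)\<^sup>+\<close> it is a
  contraction with factor \<open>\<theta> / (1 + \<theta>)\<close> in the supremum norm, which makes the stop-loss difference
  \<open>O(1 / (L (1 + t)))\<close>; feeding this back gives \<open>\<bar>F t - G t\<bar> = O(1 / (L t (1 + t)))\<close>, and near \<open>0\<close> the
  sharper \<open>O(t powr (\<theta> - 1) / L)\<close>. Both upper bounds follow.

  For \<open>\<theta> \<le> 1\<close> the Kolmogorov lower bound comes from the atom of \<open>X\<close> at \<open>0\<close>. The lower bound for the
  smooth distance rests on \<open>\<Sum>d\<le>z. \<Lambda> d / d * ln (z / d)\<close> being at most \<open>ln\<^sup>2 z / 2 - c ln z + O(1)\<close>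
  with \<open>c > 0\<close> (the best \<open>c\<close> is Euler's constant); unlike the corresponding bound on
  \<open>\<Sum>d\<le>z. \<Lambda> d / d\<close> this average needs nothing close to the prime number theorem. It is detected by
  the test function \<open>x u\<^sup>2 - \<theta> u\<^sup>3 / 3\<close> with \<open>u = (1 - x)\<^sup>+\<close>, whose expectation vanishes under the
  Dickman law. For \<open>\<theta> > 1\<close> the Kolmogorov lower bound follows from the one for the smooth distance
  and the decay of \<open>F - G\<close>.
\<close>

section \<open>Right derivatives and the perturbed Dickman delay equation\<close>

text \<open>The law of \<open>X\<close> has atoms, so \<open>I\<close> has only a right derivative,
  and all differential inequalities are stated for right derivatives. Moreover one form of the delay
  equation is not enough. Computing the mean of \<open>X\<close> over \<open>X \<le> t\<close>
  leaves an error proportional to \<open>F t\<close>, which is sharp near 0 but does not decay;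
  computing it over \<open>t < X\<close> leaves, by Markov's inequality, an error
  \<open>O(1 / (L (1 + t)))\<close>. The first form, together with
  \<open>F t = O(t powr \<theta>)\<close>, replaces the non-integrable factor \<open>1 / t\<close>
  near 0; the second can be integrated down from infinity, since
  \<open>t powr (- 1 - \<theta>)\<close> kills bounded boundary terms. The means of the two laws are
  not matched in advance: their difference is the stop-loss difference at 0 and is covered by the
  same contraction. The atom at 0 is large enough because \<open>X = O(1 / L)\<close> restricts the
  integer to a fixed finite set, whose total weight is at most a constant times that of the integer
  1. All facts about the Dickman law come from one identity, \<open>E h(D) = E f(D + 1)\<close> for
  \<open>h x = f x + x * f' x / \<theta>\<close>.\<close>

lemma right_deriv_nonneg_imp_le:
  fixes f f' :: "real \<Rightarrow> real"
  assumes ab: "a \<le> b" and cont: "continuous_on {a..b} f"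
    and deriv: "\<And>x. \<lbrakk>a \<le> x; x < b\<rbrakk> \<Longrightarrow> (f has_real_derivative f' x) (at x within {x..b})"
    and nonneg: "\<And>x. \<lbrakk>a \<le> x; x < b\<rbrakk> \<Longrightarrow> 0 \<le> f' x"
  shows "f a \<le> f b"
proof (rule field_le_epsilon)
  fix e :: real assume "e > 0"
  \<comment> \<open>Tilting \<open>f\<close> by the slope \<open>d\<close> makes the right
    derivative strictly positive, so the last point where the tilted function is at least its value
    at \<open>a\<close> cannot lie before \<open>b\<close>. The \<open>+ 1\<close> keeps the
    denominator positive when \<open>a = b\<close>.\<close>
  define d where "d = e / (b - a + 1)"
  have d: "d > 0" "d * (b - a) \<le> e" using \<open>e > 0\<close> ab by (auto simp: d_def field_simps)
  define g where "g x = f x + d * x" for x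
  have contg: "continuous_on {a..b} g"
    unfolding g_def by (intro continuous_intros cont)
  define A where "A = {a..b} \<inter> g -` {g a..}"
  have "closed A"
    unfolding A_def by (intro continuous_closed_preimage contg closed_atLeastAtMost closed_atLeast)
  moreover have "bounded A" by (rule bounded_subset[of "{a..b}"]) (auto simp: A_def)
  ultimately have "compact A" by (simp add: compact_eq_bounded_closed)
  moreover have "a \<in> A" using ab by (auto simp: A_def)
  ultimately obtain c where c: "c \<in> A" "\<And>x. x \<in> A \<Longrightarrow> x \<le> c"
    using compact_attains_sup[of A] by blast
  have "c = b"
  proof (rule ccontr)
    assume "c \<noteq> b"
    then have cb: "a \<le> c" "c < b" using c(1) by (auto simp: A_def)
    have "(g has_real_derivative (f' c + d)) (at c within {c..b})"
      unfolding g_def by (auto intro!: derivative_eq_intros deriv cb)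
    moreover have "f' c + d > 0" using nonneg[OF cb] d by simp
    ultimately obtain h where h: "h > 0" "\<And>k. \<lbrakk>0 < k; c + k \<in> {c..b}; k < h\<rbrakk> \<Longrightarrow> g c < g (c + k)"
      using has_real_derivative_pos_inc_right by metis
    define k where "k = min (h/2) (b - c)"
    have k: "0 < k" "c + k \<in> {c..b}" "k < h" using h(1) cb by (auto simp: k_def)
    have "g c < g (c + k)" by (rule h(2)[OF k])
    then have "c + k \<in> A" using c(1) k cb by (auto simp: A_def)
    then show False using c(2) k by fastforce
  qed
  then have "g a \<le> g b" using c(1) by (auto simp: A_def)
  then show "f a \<le> f b + e" using d by (simp add: g_def algebra_simps)
qed


text \<open>The function \<open>y s * (s + c) powr (-a) - K / (a - r) * (s + c) powr (r - a)\<close>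
  is nondecreasing: its right derivative is \<open>(s + c) powr (-a - 1)\<close> times the slack in
  \<open>ineq\<close>. The shift \<open>c\<close> absorbs an error \<open>\<epsilon> * F t\<close>
  into the coefficient of \<open>F t\<close>, and \<open>r\<close> is the growth exponent of the
  inhomogeneity.\<close>

lemma euler_ode_comparison:
  fixes y d :: "real \<Rightarrow> real"
  assumes tT: "t \<le> T" "0 < t + c" and cont: "continuous_on {t..T} y"
    and deriv: "\<And>s. \<lbrakk>t \<le> s; s < T\<rbrakk> \<Longrightarrow> (y has_real_derivative d s) (at s within {s..T})"
    and ineq: "\<And>s. \<lbrakk>t \<le> s; s < T\<rbrakk> \<Longrightarrow> a * y s - (s + c) * d s \<le> K * (s + c) powr r"
    and ar: "r \<noteq> a"
  shows "y t * (t + c) powr (-a) - y T * (T + c) powr (-a)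
           \<le> K / (a - r) * ((t + c) powr (r - a) - (T + c) powr (r - a))"
proof -
  define f where "f s = y s * (s + c) powr (-a) - K / (a - r) * (s + c) powr (r - a)" for s
  define f' where "f' s = (s + c) powr (-a - 1) * ((s + c) * d s - a * y s + K * (s + c) powr r)" for s
  have "f t \<le> f T"
  proof (rule right_deriv_nonneg_imp_le[where f = f and f' = f'])
    show "continuous_on {t..T} f"
      unfolding f_def using tT by (intro continuous_intros cont) auto
  next
    fix s assume s: "t \<le> s" "s < T"
    then have pos: "s + c > 0" using tT by simp
    have e1: "(s + c) powr (-a) = (s + c) * (s + c) powr (-a - 1)"
      using pos by (simp add: powr_diff)
    have e2: "(s + c) powr (r - a - 1) = (s + c) powr (-a - 1) * (s + c) powr r"
      using powr_add[of "s + c" "-a - 1" r] by (simp add: algebra_simps)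
    have D1: "((\<lambda>s. (s + c) powr q) has_real_derivative q * (s + c) powr (q - 1)) (at s within {s..T})" for q
      using pos by (auto intro!: derivative_eq_intros simp: powr_diff)
    have "(f has_real_derivative
        (y s * (- a * (s + c) powr (- a - 1)) + d s * (s + c) powr (-a)
          - K / (a - r) * ((r - a) * (s + c) powr (r - a - 1)))) (at s within {s..T})"
      unfolding f_def by (intro DERIV_diff DERIV_mult' DERIV_cmult deriv s D1)
    also have "y s * (- a * (s + c) powr (- a - 1)) + d s * (s + c) powr (-a)
          - K / (a - r) * ((r - a) * (s + c) powr (r - a - 1)) = f' s"
    proof -
      have "K / (a - r) * ((r - a) * (s + c) powr (r - a - 1)) = - K * (s + c) powr (r - a - 1)"
        using ar by (simp add: field_simps)
      then show ?thesis unfolding f'_def by (simp only: e1 e2) (simp add: algebra_simps)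
    qed
    finally show "(f has_real_derivative f' s) (at s within {s..T})" .
    show "0 \<le> f' s" unfolding f'_def using ineq[OF s] by simp
  qed (fact tT)
  then show ?thesis unfolding f_def by (simp add: algebra_simps)
qed

lemma mult_powr_minus_le_iff:
  fixes x :: real assumes "0 < x"
  shows "y * x powr (-a) \<le> z \<longleftrightarrow> y \<le> z * x powr a"
    and "z \<le> y * x powr (-a) \<longleftrightarrow> z * x powr a \<le> y"
  using assms by (simp_all add: powr_minus field_simps)

text \<open>Abstracts a law on the half-line: \<open>F\<close> is its distribution function,
  \<open>I t\<close> the mean of the positive part of \<open>t - X\<close>, \<open>m\<close> the
  mean. \<open>mean_bound\<close> expresses that the mean of the positive part of
  \<open>X - t\<close> is nonnegative.\<close>

locale cdf_data =
  fixes F I :: "real \<Rightarrow> real" and m :: real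
  assumes F_mono: "mono F" and F_nonneg: "0 \<le> F t" and F_le_1: "F t \<le> 1"
    and I_cont: "continuous_on A I"
    and I_deriv: "(I has_real_derivative F t) (at t within {t..})"
    and I_nonpos: "t \<le> 0 \<Longrightarrow> I t = 0"
    and mean_bound: "t \<le> m + I t"
begin

lemma I_deriv_within: "(I has_real_derivative F t) (at t within {t..b})"
  using I_deriv by (rule DERIV_subset) auto

lemma I_mono: assumes "s \<le> t" shows "I s \<le> I t"
  using assms I_cont I_deriv_within F_nonneg by (rule right_deriv_nonneg_imp_le)

lemma I_nonneg: "0 \<le> I t"
  using I_mono[of "min t 0" t] I_nonpos[of "min t 0"] by simp

lemma I_diff_le: assumes "s \<le> t" shows "I t - I s \<le> F t * (t - s)"
proof -
  have "F t * s - I s \<le> F t * t - I t"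
  proof (rule right_deriv_nonneg_imp_le[OF assms, where f' = "\<lambda>x. F t - F x"])
    show "continuous_on {s..t} (\<lambda>x. F t * x - I x)" by (intro continuous_intros I_cont)
    show "((\<lambda>x. F t * x - I x) has_real_derivative F t - F x) (at x within {x..t})" for x
      by (auto intro!: derivative_eq_intros I_deriv_within)
    show "0 \<le> F t - F x" if "x < t" for x using F_mono that by (simp add: mono_def)
  qed
  then show ?thesis by (simp add: algebra_simps)
qed

lemma I_le: "0 \<le> t \<Longrightarrow> I t \<le> F t * t"
  using I_diff_le[of 0 t] I_nonpos[of 0] by simp

lemma I_le_self: "0 \<le> t \<Longrightarrow> I t \<le> t"
  using I_le[of t] F_le_1[of t] mult_right_mono[of "F t" 1 t] by simp

text \<open>The stop-loss transform, that is, the mean of the positive part of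
  \<open>X - t\<close>.\<close>

definition P :: "real \<Rightarrow> real" where "P t = m - t + I t"

lemma P_nonneg: "0 \<le> P t" using mean_bound[of t] by (simp add: P_def)

lemma P_le: "0 \<le> t \<Longrightarrow> P t \<le> m" using I_le_self[of t] by (simp add: P_def)

lemma m_nonneg: "0 \<le> m" using mean_bound[of 0] I_nonpos[of 0] by simp

end

text \<open>Two versions of one delay equation, from the mean of \<open>X\<close> over
  \<open>X \<le> t\<close> and over \<open>t < X\<close>. They agree when the mean is
  \<open>\<theta>\<close> and the errors vanish, but the error of \<open>lower_eq\<close> is small
  near 0 and that of \<open>upper_eq\<close> decays at infinity. The exact Dickman case is
  \<open>\<epsilon> = 0\<close>.\<close>

locale near_dickman = cdf_data +
  fixes \<theta> \<epsilon> :: real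
  assumes theta: "0 < \<theta>" and eps: "0 \<le> \<epsilon>"
    and lower_eq: "0 \<le> t \<Longrightarrow> \<bar>t * F t - (1 + \<theta>) * I t + \<theta> * I (t - 1)\<bar> \<le> \<epsilon> * F t"
    and upper_eq: "0 \<le> t \<Longrightarrow> \<bar>t * (1 - F t) + (1 + \<theta>) * P t - \<theta> * P (t - 1)\<bar> \<le> \<epsilon> / (1 + t)"
begin

text \<open>On \<open>(0, 1]\<close> the delay term is 0, so the equation gives
  \<open>(1 + \<theta>) * I s \<le> (s + \<epsilon>) * F s\<close>. Integrating back from 1, where
  \<open>I 1 \<le> 1\<close>, bounds \<open>I t\<close> by a multiple of
  \<open>t powr (1 + \<theta>)\<close>, and the reverse inequality passes this on to
  \<open>F t\<close>. The condition \<open>2 * \<epsilon> \<le> t\<close> provides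
  \<open>t + \<epsilon> \<le> 3/2 * t\<close> and \<open>t / 2 \<le> t - \<epsilon>\<close>.\<close>

lemma F_upper:
  assumes t: "0 < t" "2 * \<epsilon> \<le> t"
  shows "F t \<le> 2 * (1 + \<theta>) * (3/2) powr (1 + \<theta>) * t powr \<theta>"
proof (cases "t \<le> 1")
  case True
  let ?a = "1 + \<theta>"
  have "I t * (t + \<epsilon>) powr (-?a) - I 1 * (1 + \<epsilon>) powr (-?a)
      \<le> 0 / (?a - 0) * ((t + \<epsilon>) powr (0 - ?a) - (1 + \<epsilon>) powr (0 - ?a))"
  proof (rule euler_ode_comparison[where d = F])
    fix s assume s: "t \<le> s" "s < 1"
    show "(1 + \<theta>) * I s - (s + \<epsilon>) * F s \<le> 0 * (s + \<epsilon>) powr 0"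
      using lower_eq[of s] I_nonpos[of "s - 1"] s t by (simp add: algebra_simps abs_le_iff)
  qed (use True t eps theta in \<open>auto intro: I_cont I_deriv_within\<close>)
  moreover have "I 1 * (1 + \<epsilon>) powr (-?a) \<le> 1 * 1"
  proof (rule mult_mono)
    show "(1 + \<epsilon>) powr (-?a) \<le> 1" using eps theta
      by (metis (no_types, opaque_lifting) powr_mono add_increasing2 le_add_same_cancel1 neg_le_0_iff_le
          less_eq_real_def powr_zero_eq_one zero_le_one zero_less_one add_pos_pos less_numeral_extra(4) not_less)
  qed (use I_le_self[of 1] I_nonneg in auto)
  ultimately have "I t * (t + \<epsilon>) powr (-?a) \<le> 1" by simp
  then have "I t \<le> (t + \<epsilon>) powr ?a"
    using mult_powr_minus_le_iff(1)[of "t + \<epsilon>" "I t" ?a 1] t eps by simp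
  also have "\<dots> \<le> (3/2 * t) powr ?a"
    using t eps theta by (intro powr_mono2) auto
  also have "\<dots> = (3/2) powr ?a * (t * t powr \<theta>)"
    using t powr_mult[of "3/2" t ?a] by (simp add: powr_add)
  finally have "I t \<le> t * ((3/2) powr ?a * t powr \<theta>)" by (simp add: ac_simps)
  moreover have "t / 2 * F t \<le> (t - \<epsilon>) * F t"
    using t F_nonneg by (intro mult_right_mono) auto
  moreover have "(t - \<epsilon>) * F t \<le> ?a * I t"
    using lower_eq[of t] I_nonpos[of "t - 1"] True t by (simp add: algebra_simps abs_le_iff)
  ultimately have "t / 2 * F t \<le> ?a * (t * ((3/2) powr ?a * t powr \<theta>))"
    using theta by (smt (verit, best) mult_left_mono)
  then have "t * F t \<le> t * (2 * ?a * (3/2) powr ?a * t powr \<theta>)" by (simp add: algebra_simps)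
  then show ?thesis using t by (simp only: mult_le_cancel_left_pos)
next
  case False
  have "1 * 1 * 1 \<le> 2 * (1 + \<theta>) * (3/2) powr (1 + \<theta>) * t powr \<theta>"
    using False theta by (intro mult_mono ge_one_powr_ge_zero) auto
  then show ?thesis using F_le_1[of t] by linarith
qed

text \<open>Dropping the nonnegative delay term makes
  \<open>I s * (s - \<epsilon>) powr (- 1 - \<theta>)\<close> nonincreasing. The comparison point
  \<open>m + 1\<close> is where \<open>mean_bound\<close> forces \<open>I\<close> to be at least
  1.\<close>

lemma I_lower:
  assumes t: "\<epsilon> < t" "t \<le> m + 1"
  shows "((t - \<epsilon>) / (m + 1)) powr (1 + \<theta>) \<le> I t"
proof -
  let ?a = "1 + \<theta>" and ?T = "m + 1"
  have "(- I t) * (t + - \<epsilon>) powr (-?a) - (- I ?T) * (?T + - \<epsilon>) powr (-?a)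
      \<le> 0 / (?a - 0) * ((t + - \<epsilon>) powr (0 - ?a) - (?T + - \<epsilon>) powr (0 - ?a))"
  proof (rule euler_ode_comparison[where d = "\<lambda>s. - F s"])
    fix s assume s: "t \<le> s" "s < ?T"
    have "0 \<le> \<theta> * I (s - 1)" using theta I_nonneg by simp
    then show "(1 + \<theta>) * - I s - (s + - \<epsilon>) * - F s \<le> 0 * (s + - \<epsilon>) powr 0"
      using lower_eq[of s] s t eps by (simp add: algebra_simps abs_le_iff)
  qed (use t eps theta in \<open>auto intro!: continuous_intros I_cont derivative_eq_intros I_deriv_within\<close>)
  then have "I ?T * (?T - \<epsilon>) powr (-?a) \<le> I t * (t - \<epsilon>) powr (-?a)" by simp
  moreover have "1 * ?T powr (-?a) \<le> I ?T * (?T - \<epsilon>) powr (-?a)"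
    using mean_bound[of ?T] t eps theta m_nonneg by (intro mult_mono powr_mono2') (auto simp: I_nonneg)
  ultimately have "1 * ?T powr (-?a) \<le> I t * (t - \<epsilon>) powr (-?a)" by linarith
  then have "?T powr (-?a) * (t - \<epsilon>) powr ?a \<le> I t"
    using mult_powr_minus_le_iff(2)[of "t - \<epsilon>" "?T powr (-?a)" "I t" ?a] t by simp
  then show ?thesis
    using t eps m_nonneg powr_divide[of "t - \<epsilon>" "m + 1" ?a] powr_minus_divide[of ?T ?a]
    by (simp add: mult.commute)
qed

end


section \<open>Comparison of a near-solution with the exact Dickman solution\<close>

lemma le_if_le_add_vanishing:
  fixes x y :: real
  assumes "\<And>T. T > t \<Longrightarrow> x \<le> y + M * T powr (-a)" "a > 0"
  shows "x \<le> y"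
proof -
  have "((\<lambda>T. y + M * T powr (-a)) \<longlongrightarrow> y + M * 0) at_top"
    using assms(2) by (intro tendsto_intros tendsto_neg_powr filterlim_ident) auto
  then have "((\<lambda>T. y + M * T powr (-a)) \<longlongrightarrow> y) at_top" by simp
  then show ?thesis
    by (rule tendsto_lowerbound)
       (use assms(1) in \<open>auto intro: eventually_mono[OF eventually_gt_at_top[of t]]\<close>)
qed

locale dickman_pair = X: near_dickman F I m \<theta> \<epsilon> + D: near_dickman G J k \<theta> 0
  for F I m \<theta> \<epsilon> G J k
begin

text \<open>Taking stop-loss transforms instead of \<open>I - J\<close> brings in the means: on the
  negative half-line the value is \<open>m - k\<close>, so a bound on this function also bounds the
  difference of the means. The right derivative is still \<open>F - G\<close>.\<close>

definition Y :: "real \<Rightarrow> real" where "Y t = X.P t - D.P t"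

lemma Y_alt: "Y t = (m - k) + (I t - J t)"
  by (simp add: Y_def X.P_def D.P_def)

lemma Y_nonpos: "t \<le> 0 \<Longrightarrow> Y t = Y 0"
  by (simp add: Y_alt X.I_nonpos D.I_nonpos)

lemma Y_bounded: "\<bar>Y t\<bar> \<le> m + k"
proof -
  have "\<bar>Y s\<bar> \<le> m + k" if "0 \<le> s" for s
    using X.P_nonneg[of s] X.P_le[of s] D.P_nonneg[of s] D.P_le[of s] X.m_nonneg D.m_nonneg that
    by (simp add: Y_def)
  then show ?thesis using Y_nonpos[of t] by (cases "t \<le> 0") auto
qed

lemma Y_cont: "continuous_on A Y"
  unfolding Y_alt[abs_def] by (intro continuous_intros X.I_cont D.I_cont)

lemma Y_deriv: "(Y has_real_derivative (F t - G t)) (at t within {t..b})"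
  unfolding Y_alt[abs_def] by (auto intro!: derivative_eq_intros X.I_deriv_within D.I_deriv_within)

lemma Y_eq:
  assumes "0 \<le> t"
  shows "\<bar>(1 + \<theta>) * Y t - t * (F t - G t) - \<theta> * Y (t - 1)\<bar> \<le> \<epsilon> / (1 + t)"
proof -
  have "(1 + \<theta>) * Y t - t * (F t - G t) - \<theta> * Y (t - 1)
      = (t * (1 - F t) + (1 + \<theta>) * X.P t - \<theta> * X.P (t - 1))
        - (t * (1 - G t) + (1 + \<theta>) * D.P t - \<theta> * D.P (t - 1))"
    by (simp add: Y_def algebra_simps)
  then show ?thesis using X.upper_eq[OF assms] D.upper_eq[OF assms] by simp
qed

text \<open>With the integrating factor \<open>s powr (- 1 - \<theta>)\<close> the equation is
  integrated from \<open>t\<close> to infinity; the boundary term at \<open>T\<close> disappears as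
  \<open>T\<close> grows because \<open>Y\<close> is bounded. The weight \<open>1 + \<theta>\<close>
  of \<open>Y t\<close> against the weight \<open>\<theta>\<close> of the delayed value is the
  contraction.\<close>

lemma Y_step:
  assumes t: "0 \<le> t" and B: "\<And>s. t \<le> s \<Longrightarrow> \<bar>Y (s - 1)\<bar> \<le> B"
  shows "\<bar>Y t\<bar> \<le> (\<theta> * B + \<epsilon> / (1 + t)) / (1 + \<theta>)"
proof -
  let ?a = "1 + \<theta>" and ?K = "\<theta> * B + \<epsilon> / (1 + t)"
  have a: "?a > 0" "\<theta> > 0" "\<epsilon> \<ge> 0" using X.theta X.eps by auto
  have K: "\<bar>?a * Y s - s * (F s - G s)\<bar> \<le> ?K" if "t \<le> s" for s
  proof -
    have "\<epsilon> / (1 + s) \<le> \<epsilon> / (1 + t)"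
      using t that a by (intro divide_left_mono mult_pos_pos) auto
    moreover have "\<bar>\<theta> * Y (s - 1)\<bar> \<le> \<theta> * B"
      using a B[OF that] by (simp add: abs_mult)
    ultimately show ?thesis using Y_eq[of s] t that by linarith
  qed
  have "Y t \<le> ?K / ?a \<and> - Y t \<le> ?K / ?a"
  proof (cases "t = 0")
    \<comment> \<open>At 0 the derivative term of the equation disappears and the bound can be read
      off.\<close>
    case True
    then show ?thesis using K[of 0] a by (simp add: field_simps abs_le_iff)
  next
    case False
    then have t: "t > 0" using t by simp
    have gen: "z t \<le> ?K / ?a"
      if cont: "continuous_on {t..} z"
        and d: "\<And>s b. (z has_real_derivative z' s) (at s within {s..b})"
        and zK: "\<And>s. t \<le> s \<Longrightarrow> ?a * z s - s * z' s \<le> ?K"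
        and zM: "\<And>s. z s \<le> m + k" for z z'
    proof -
      have K0: "?K / ?a \<ge> 0" using K[of t] a by simp
      have "z t * t powr (-?a) \<le> ?K / ?a * t powr (-?a)"
      proof (rule le_if_le_add_vanishing[where t = t and M = "m + k" and a = ?a])
        fix T assume T: "t < T"
        have "z t * (t + 0) powr (-?a) - z T * (T + 0) powr (-?a)
           \<le> ?K / (?a - 0) * ((t + 0) powr (0 - ?a) - (T + 0) powr (0 - ?a))"
          by (rule euler_ode_comparison[where d = z'])
             (use T t a zK d in \<open>auto intro: continuous_on_subset[OF cont]\<close>)
        moreover have "z T * T powr (-?a) \<le> (m + k) * T powr (-?a)"
          using zM by (intro mult_right_mono) auto
        moreover have "?K / ?a * (t powr (-?a) - T powr (-?a)) \<le> ?K / ?a * t powr (-?a)"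
          using K0 by (intro mult_left_mono) auto
        ultimately show "z t * t powr (-?a) \<le> ?K / ?a * t powr (-?a) + (m + k) * T powr (-?a)"
          by simp
      qed (use a in simp)
      moreover have "t powr (-?a) > 0" using t by simp
      ultimately show ?thesis by (simp only: mult_le_cancel_right_pos)
    qed
    have "Y t \<le> ?K / ?a"
    proof (rule gen[where z' = "\<lambda>s. F s - G s"])
      show "?a * Y s - s * (F s - G s) \<le> ?K" if "t \<le> s" for s
        using K[OF that] by linarith
      show "Y s \<le> m + k" for s using Y_bounded[of s] by simp
    qed (auto intro: Y_cont Y_deriv)
    moreover have "- Y t \<le> ?K / ?a"
    proof (rule gen[where z' = "\<lambda>s. - (F s - G s)" and z = "\<lambda>s. - Y s"])
      show "?a * - Y s - s * - (F s - G s) \<le> ?K" if "t \<le> s" for s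
        using K[OF that] by (simp add: algebra_simps abs_le_iff)
      show "- Y s \<le> m + k" for s using Y_bounded[of s] by simp
      show "((\<lambda>s. - Y s) has_real_derivative - (F s - G s)) (at s within {s..b})" for s b
        by (intro DERIV_minus Y_deriv)
    qed (intro continuous_intros Y_cont)
    ultimately show ?thesis ..
  qed
  then show ?thesis by (simp add: abs_le_iff)
qed

text \<open>Feeding the supremum \<open>B\<close> into \<open>Y_step\<close> gives
  \<open>B \<le> (\<theta> * B + \<epsilon>) / (1 + \<theta>)\<close>, which can be solved for
  \<open>B\<close> because \<open>Y_bounded\<close> makes it finite. At negative arguments
  \<open>Y\<close> has its value at 0.\<close>

lemma Y_le_eps: "\<bar>Y t\<bar> \<le> \<epsilon>"
proof -
  define B where "B = (SUP s. \<bar>Y s\<bar>)"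
  have bdd: "bdd_above (range (\<lambda>s. \<bar>Y s\<bar>))"
    using Y_bounded by (intro bdd_aboveI[of _ "m + k"]) auto
  have Y: "\<bar>Y s\<bar> \<le> B" for s unfolding B_def by (rule cSUP_upper[OF _ bdd]) auto
  have step: "\<bar>Y s\<bar> \<le> (\<theta> * B + \<epsilon>) / (1 + \<theta>)" if "0 \<le> s" for s
  proof -
    have "\<epsilon> / (1 + s) \<le> \<epsilon> / 1" using that X.eps by (intro divide_left_mono) auto
    then show ?thesis
      using Y_step[OF that, of B] Y X.theta by (smt (verit) divide_right_mono div_by_1)
  qed
  have "B \<le> (\<theta> * B + \<epsilon>) / (1 + \<theta>)"
    unfolding B_def[of ] 
  proof (rule cSUP_least, simp, fold B_def)
    fix s show "\<bar>Y s\<bar> \<le> (\<theta> * B + \<epsilon>) / (1 + \<theta>)"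
      using step[of s] step[of 0] Y_nonpos[of s] by (cases "0 \<le> s") auto
  qed
  then have "B \<le> \<epsilon>" using X.theta by (simp add: field_simps)
  then show ?thesis using Y[of t] by simp
qed

text \<open>\<open>Y_step\<close> looks back one unit, so decay is gained integer by integer. The
  offset \<open>2 * \<theta> + 1\<close> ensures \<open>x + b \<ge> 2 * \<theta>\<close>, which
  leaves room \<open>N / (2 * (x + 1 + b))\<close> in the induction step to pay for the error term;
  the factor \<open>4 * (1 + \<theta>)\<close> in \<open>N\<close> makes this room
  sufficient.\<close>

lemma Y_decay_nat: "real n \<le> s \<Longrightarrow> \<bar>Y s\<bar> \<le> 4 * \<epsilon> * (1 + \<theta>) / (real n + (2 * \<theta> + 1))"
proof (induction n arbitrary: s)
  case 0
  have "\<epsilon> * (2 * \<theta> + 1) \<le> 4 * \<epsilon> * (1 + \<theta>)"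
    using X.eps X.theta by (simp add: algebra_simps)
  then have "\<epsilon> \<le> 4 * \<epsilon> * (1 + \<theta>) / (2 * \<theta> + 1)"
    using X.theta by (simp add: field_simps)
  then show ?case using Y_le_eps[of s] by simp
next
  case (Suc n)
  define N b x where "N = 4 * \<epsilon> * (1 + \<theta>)" and "b = 2 * \<theta> + 1" and "x = real n"
  have pos: "x \<ge> 0" "b > 0" "x + b > 0" "N \<ge> 0" "\<theta> > 0" "\<epsilon> \<ge> 0"
    using X.theta X.eps by (auto simp: x_def b_def N_def)
  have s: "x + 1 \<le> s" using Suc.prems by (simp add: x_def)
  have "\<bar>Y s\<bar> \<le> (\<theta> * (N / (x + b)) + \<epsilon> / (1 + s)) / (1 + \<theta>)"
    using s pos Suc.IH by (intro Y_step) (auto simp: x_def N_def b_def)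
  also have "\<dots> \<le> (\<theta> * (N / (x + b)) + \<epsilon> / (x + 2)) / (1 + \<theta>)"
    using s pos by (intro divide_right_mono add_left_mono divide_left_mono) auto
  also have "\<dots> \<le> N / (x + 1 + b)"
  proof -
    have "N * ((1 + \<theta>) / (x + 1 + b) - \<theta> / (x + b)) = N * ((x + b - \<theta>) / ((x + b) * (x + 1 + b)))"
      using pos by (simp add: field_simps)
    also have "\<dots> \<ge> N * (1 / (2 * (x + 1 + b)))"
    proof (intro mult_left_mono)
      have "(x + b) * (2 * (x + 1 + b)) \<ge> 0" using pos by simp
      moreover have "1 * ((x + b) * (x + 1 + b)) \<le> (x + b - \<theta>) * (2 * (x + 1 + b))"
        using pos by (simp add: b_def algebra_simps)
      ultimately show "1 / (2 * (x + 1 + b)) \<le> (x + b - \<theta>) / ((x + b) * (x + 1 + b))"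
        using pos by (subst frac_le_eq) (auto intro!: divide_nonpos_pos)
    qed (use pos in simp)
    finally have "N * (1 / (2 * (x + 1 + b))) \<le> N * ((1 + \<theta>) / (x + 1 + b)) - \<theta> * (N / (x + b))"
      by (simp add: algebra_simps)
    moreover have "\<epsilon> / (x + 2) \<le> N * (1 / (2 * (x + 1 + b)))"
    proof -
      have "2 * (x + 1 + b) \<le> 4 * (1 + \<theta>) * (x + 2)" using pos by (simp add: b_def algebra_simps)
      then have "\<epsilon> * (2 * (x + 1 + b)) \<le> \<epsilon> * (4 * (1 + \<theta>) * (x + 2))"
        using pos by (intro mult_left_mono) auto
      then show ?thesis using pos by (simp add: N_def field_simps)
    qed
    ultimately have "\<theta> * (N / (x + b)) + \<epsilon> / (x + 2) \<le> N / (x + 1 + b) * (1 + \<theta>)"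
      by simp
    then show ?thesis using pos by (simp add: divide_le_eq)
  qed
  finally show ?case by (simp add: N_def b_def x_def add_ac)
qed

lemma Y_decay: assumes "0 \<le> t" shows "\<bar>Y t\<bar> \<le> 8 * (1 + \<theta>) * \<epsilon> / (1 + t)"
proof -
  define n where "n = nat \<lfloor>t\<rfloor>"
  have n: "real n \<le> t" "t < real n + 1" using assms by (auto simp: n_def)
  have "\<bar>Y t\<bar> \<le> 4 * \<epsilon> * (1 + \<theta>) / (real n + (2 * \<theta> + 1))" by (rule Y_decay_nat[OF n(1)])
  also have "\<dots> \<le> 4 * \<epsilon> * (1 + \<theta>) / ((1 + t) / 2)"
    using n assms X.theta X.eps by (intro divide_left_mono) auto
  finally show ?thesis by (simp add: ac_simps)
qed

text \<open>The equation for \<open>Y\<close> is solved for \<open>t * (F t - G t)\<close>. The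
  constant collects 1 from the error, 8 from \<open>Y t\<close> and 16 from
  \<open>Y (t - 1)\<close>, where passing from \<open>1 / t\<close> to \<open>2 / (1 + t)\<close>
  costs the factor 2.\<close>

lemma diff_decay:
  assumes t: "0 < t"
  shows "\<bar>F t - G t\<bar> \<le> (1 + 24 * (1 + \<theta>) ^ 2) * \<epsilon> / (t * (1 + t))"
proof -
  let ?c = "8 * (1 + \<theta>) * \<epsilon>"
  have pos: "\<theta> > 0" "\<epsilon> \<ge> 0" using X.theta X.eps by auto
  have "\<bar>Y (t - 1)\<bar> \<le> 2 * ?c / (1 + t)"
  proof (cases "t \<le> 1")
    case True
    have "\<bar>Y (t - 1)\<bar> \<le> \<epsilon>" by (rule Y_le_eps)
    also have "\<epsilon> * (1 + t) \<le> 2 * ?c" using True pos t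
      by (smt (verit) mult_left_mono mult_nonneg_nonneg distrib_right mult.commute mult_less_cancel_right2)
    then have "\<epsilon> \<le> 2 * ?c / (1 + t)" using t by (simp add: pos_le_divide_eq)
    finally show ?thesis .
  next
    case False
    have "\<bar>Y (t - 1)\<bar> \<le> ?c / (1 + (t - 1))" using False by (intro Y_decay) auto
    also have "\<dots> \<le> ?c / ((1 + t) / 2)"
      using False pos by (intro divide_left_mono) auto
    finally show ?thesis by simp
  qed
  then have "\<theta> * \<bar>Y (t - 1)\<bar> \<le> \<theta> * (2 * ?c / (1 + t))"
    using pos by (intro mult_left_mono) auto
  then have 1: "\<bar>\<theta> * Y (t - 1)\<bar> \<le> \<theta> * (2 * ?c / (1 + t))"
    using pos by (simp only: abs_mult abs_of_pos)
  have "(1 + \<theta>) * \<bar>Y t\<bar> \<le> (1 + \<theta>) * (?c / (1 + t))"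
    using pos Y_decay[of t] t by (intro mult_left_mono) auto
  then have 2: "\<bar>(1 + \<theta>) * Y t\<bar> \<le> (1 + \<theta>) * (?c / (1 + t))"
    using pos by (simp add: abs_mult del: times_divide_eq_right)
  have "\<bar>t * (F t - G t)\<bar> \<le> \<epsilon> / (1 + t) + (1 + \<theta>) * (?c / (1 + t)) + \<theta> * (2 * ?c / (1 + t))"
    using Y_eq[of t] 1 2 t by linarith
  also have "\<dots> = (\<epsilon> + (1 + \<theta>) * ?c + \<theta> * (2 * ?c)) / (1 + t)" by (simp add: add_divide_distrib)
  also have "\<dots> \<le> (1 + 24 * (1 + \<theta>) ^ 2) * \<epsilon> / (1 + t)"
    using t pos by (intro divide_right_mono) (auto simp: algebra_simps power2_eq_square)
  finally have "t * \<bar>F t - G t\<bar> \<le> (1 + 24 * (1 + \<theta>) ^ 2) * \<epsilon> / (1 + t)"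
    using t by (simp only: abs_mult abs_of_pos)
  then show ?thesis
    using t by (simp add: pos_le_divide_eq mult_ac flip: divide_divide_eq_left)
qed

text \<open>Replaces the factor \<open>1 / t\<close> of \<open>diff_decay\<close>, which is not
  integrable at 0. On \<open>(0, 1]\<close> there is no delay term, and the error
  \<open>\<epsilon> * F s\<close> is \<open>O(\<epsilon> * s powr \<theta>)\<close> by
  \<open>F_upper\<close>. Integrating down from 1 loses one power of \<open>t\<close> against
  \<open>t powr (1 + \<theta>)\<close>, so \<open>I t - J t\<close> is
  \<open>O(\<epsilon> * t powr \<theta>)\<close>.\<close>

lemma diff_near_zero:
  assumes t: "0 < t" "2 * \<epsilon> \<le> t" "t \<le> 1"
  shows "\<bar>F t - G t\<bar> \<le> (1 + \<theta>) * (2 + 4 * (1 + \<theta>) * (3/2) powr (1 + \<theta>)) * \<epsilon> * t powr (\<theta> - 1)"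
proof -
  define a c where "a = 1 + \<theta>" and "c = 2 * (1 + \<theta>) * (3/2) powr (1 + \<theta>)"
  have pos: "\<theta> > 0" "\<epsilon> \<ge> 0" "a > 0" "c > 0" using X.theta X.eps by (auto simp: a_def c_def)
  define W where "W s = I s - J s" for s
  have W_cont: "continuous_on A W" for A
    unfolding W_def by (intro continuous_intros X.I_cont D.I_cont)
  have W_deriv: "(W has_real_derivative (F s - G s)) (at s within {s..b})" for s b
    unfolding W_def by (auto intro!: derivative_eq_intros X.I_deriv_within D.I_deriv_within)
  have E: "\<bar>s * (F s - G s) - a * W s\<bar> \<le> c * \<epsilon> * s powr \<theta>" if s: "t \<le> s" "s \<le> 1" for s
  proof -
    have "\<bar>s * (F s - G s) - a * W s\<bar> \<le> \<epsilon> * F s"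
      using X.lower_eq[of s] D.lower_eq[of s] X.I_nonpos[of "s - 1"] D.I_nonpos[of "s - 1"] s t
      by (simp add: W_def a_def algebra_simps abs_le_iff)
    also have "\<dots> \<le> \<epsilon> * (c * s powr \<theta>)"
      using X.F_upper[of s] s t pos by (intro mult_left_mono) (auto simp: c_def)
    finally show ?thesis by (simp add: ac_simps)
  qed
  \<comment> \<open>\<open>W 1\<close> equals \<open>Y 1 - Y 0\<close>, since \<open>I\<close> and
    \<open>J\<close> vanish at 0.\<close>
  have W1: "\<bar>W 1\<bar> \<le> 2 * \<epsilon>"
    using Y_le_eps[of 1] Y_le_eps[of 0] by (simp add: Y_alt W_def X.I_nonpos D.I_nonpos)
  have gen: "z t * t powr (-a) \<le> 2 * \<epsilon> + c * \<epsilon> * (t powr (-1) - 1)"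
    if cont: "continuous_on {t..1} z"
      and d: "\<And>s b. (z has_real_derivative z' s) (at s within {s..b})"
      and z: "\<And>s. t \<le> s \<Longrightarrow> s \<le> 1 \<Longrightarrow> a * z s - s * z' s \<le> c * \<epsilon> * s powr \<theta>"
      and z1: "z 1 \<le> 2 * \<epsilon>" for z z'
  proof -
    have "z t * (t + 0) powr (-a) - z 1 * (1 + 0) powr (-a)
        \<le> c * \<epsilon> / (a - \<theta>) * ((t + 0) powr (\<theta> - a) - (1 + 0) powr (\<theta> - a))"
      by (rule euler_ode_comparison[where d = z']) (use t cont z d in \<open>auto simp: a_def\<close>)
    then show ?thesis using z1 by (simp add: a_def)
  qed
  have "W t * t powr (-a) \<le> 2 * \<epsilon> + c * \<epsilon> * (t powr (-1) - 1)"
    by (rule gen[OF W_cont W_deriv]) (use E W1 in \<open>fastforce simp: abs_le_iff algebra_simps\<close>)+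
  moreover have "- W t * t powr (-a) \<le> 2 * \<epsilon> + c * \<epsilon> * (t powr (-1) - 1)"
    by (rule gen[where z = "\<lambda>s. - W s" and z' = "\<lambda>s. - (F s - G s)"])
       (use E W1 in \<open>fastforce simp: abs_le_iff algebra_simps intro!: continuous_intros W_cont DERIV_minus W_deriv\<close>)+
  ultimately have "\<bar>W t\<bar> * t powr (-a) \<le> 2 * \<epsilon> + c * \<epsilon> * (t powr (-1) - 1)"
    by (simp add: abs_real_def)
  also have "\<dots> \<le> (2 + c) * \<epsilon> * t powr (-1)"
  proof -
    have "1 \<le> t powr (-1)" using t by (simp add: powr_minus field_simps)
    then have "2 * \<epsilon> * 1 \<le> 2 * \<epsilon> * t powr (-1)" using pos by (intro mult_left_mono) auto
    moreover have "c * \<epsilon> \<ge> 0" using pos by simp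
    ultimately show ?thesis by (simp add: algebra_simps)
  qed
  finally have "\<bar>W t\<bar> \<le> (2 + c) * \<epsilon> * t powr (-1) * t powr a"
    using mult_powr_minus_le_iff(1)[of t "\<bar>W t\<bar>" a] t by simp
  also have "\<dots> = (2 + c) * \<epsilon> * t powr \<theta>"
    using powr_add[of t "-1" a] by (simp add: a_def)
  finally have "a * \<bar>W t\<bar> \<le> a * ((2 + c) * \<epsilon> * t powr \<theta>)" using pos by (intro mult_left_mono) auto
  moreover have "\<bar>t * (F t - G t)\<bar> \<le> a * \<bar>W t\<bar> + c * \<epsilon> * t powr \<theta>"
    using E[of t] t pos abs_mult[of a "W t"] by simp
  moreover have "1 * (c * \<epsilon> * t powr \<theta>) \<le> a * (c * \<epsilon> * t powr \<theta>)"
    using pos by (intro mult_right_mono) (auto simp: a_def)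
  ultimately have "\<bar>t * (F t - G t)\<bar> \<le> a * (2 + 2 * c) * \<epsilon> * t powr \<theta>"
    by (simp add: algebra_simps)
  then have "t * \<bar>F t - G t\<bar> \<le> t * (a * (2 + 2 * c) * \<epsilon> * t powr (\<theta> - 1))"
    using t by (simp add: abs_mult powr_diff)
  then have "\<bar>F t - G t\<bar> \<le> a * (2 + 2 * c) * \<epsilon> * t powr (\<theta> - 1)"
    using t by (simp only: mult_le_cancel_left_pos)
  moreover have "a * (2 + 2 * c) = (1 + \<theta>) * (2 + 4 * (1 + \<theta>) * (3/2) powr (1 + \<theta>))"
    by (simp add: a_def c_def)
  ultimately show ?thesis by simp
qed

end

section \<open>Mertens-type estimates\<close>

lemma sum_multiples_eq:
  fixes g :: "nat \<Rightarrow> 'a :: comm_monoid_add"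
  assumes "d \<ge> 1"
  shows "(\<Sum>N | N \<in> {1..n} \<and> d dvd N. g N) = (\<Sum>m\<in>{1..n div d}. g (d * m))"
  by (rule sum.reindex_bij_witness[where i = "\<lambda>m. d * m" and j = "\<lambda>N. N div d"])
     (use assms in \<open>auto simp: less_eq_div_iff_mult_less_eq mult.commute div_le_mono dvd_imp_le
        intro: Nat.gr0I elim!: dvdE\<close>)

text \<open>The divisor sum of \<open>mangoldt\<close> is \<open>ln\<close>; the order of summation
  is then exchanged. The weight \<open>g N = 1\<close> yields \<open>ln (fact n)\<close>, and
  \<open>g N = 1 / N\<close> the averaged sum with a logarithmic factor.\<close>

lemma sum_ln_eq_sum_mangoldt:
  fixes g :: "nat \<Rightarrow> real"
  shows "(\<Sum>N\<in>{1..n}. ln (real N) * g N) = (\<Sum>d\<in>{1..n}. mangoldt d * (\<Sum>m\<in>{1..n div d}. g (d * m)))"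
proof -
  have "(\<Sum>N\<in>{1..n}. ln (real N) * g N) = (\<Sum>N\<in>{1..n}. \<Sum>d | d \<in> {1..n} \<and> d dvd N. mangoldt d * g N)"
  proof (rule sum.cong[OF refl])
    fix N assume N: "N \<in> {1..n}"
    have "{d. d \<in> {1..n} \<and> d dvd N} = {d. d dvd N}"
      using N dvd_imp_le[of _ N] by (force intro: Nat.gr0I)
    then show "ln (real N) * g N = (\<Sum>d | d \<in> {1..n} \<and> d dvd N. mangoldt d * g N)"
      using mangoldt_sum[of N, where 'a = real] N by (simp add: sum_distrib_right[symmetric])
  qed
  also have "\<dots> = (\<Sum>d\<in>{1..n}. \<Sum>N | N \<in> {1..n} \<and> d dvd N. mangoldt d * g N)"
    by (rule sum.swap_restrict) auto
  also have "\<dots> = (\<Sum>d\<in>{1..n}. mangoldt d * (\<Sum>m\<in>{1..n div d}. g (d * m)))"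
  proof (rule sum.cong[OF refl])
    fix d assume d: "d \<in> {1..n}"
    have "(\<Sum>N | N \<in> {1..n} \<and> d dvd N. mangoldt d * g N) = (\<Sum>m\<in>{1..n div d}. mangoldt d * g (d * m))"
      using d by (intro sum_multiples_eq) simp
    then show "(\<Sum>N | N \<in> {1..n} \<and> d dvd N. mangoldt d * g N) = mangoldt d * (\<Sum>m\<in>{1..n div d}. g (d * m))"
      by (simp add: sum_distrib_left)
  qed
  finally show ?thesis .
qed

lemma ln_fact_eq_sum_ln: "ln (fact n :: real) = (\<Sum>N\<in>{1..n}. ln (real N))"
  by (induction n) (auto simp: ln_mult sum.nat_ivl_Suc')

lemma ln_fact_eq_sum_mangoldt: "ln (fact n :: real) = (\<Sum>d\<in>{1..n}. mangoldt d * real (n div d))"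
  using sum_ln_eq_sum_mangoldt[of "\<lambda>_. 1" n] by (simp add: ln_fact_eq_sum_ln)

lemma ln_fact_upper: "ln (fact n :: real) \<le> real n * ln (real n)"
proof -
  have "ln (fact n :: real) \<le> (\<Sum>N\<in>{1..n}. ln (real n))"
    unfolding ln_fact_eq_sum_ln by (intro sum_mono) auto
  then show ?thesis by simp
qed

lemma ln_fact_lower: "real n * ln (real n) - real n \<le> ln (fact n :: real)"
proof (induction n)
  case (Suc n)
  show ?case
  proof (cases "n = 0")
    case False
    then have n: "real n > 0" by simp
    have "real n * ln ((real n + 1) / real n) \<le> real n * ((real n + 1) / real n - 1)"
      using n by (intro mult_left_mono ln_le_minus_one) auto
    then have "real n * ln (real n + 1) - real n * ln (real n) \<le> 1"
      using n by (simp add: ln_div field_simps)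
    moreover have "ln (fact (Suc n) :: real) = ln (real n + 1) + ln (fact n)"
      by (simp add: ln_mult add.commute)
    ultimately show ?thesis using Suc.IH by (simp add: algebra_simps)
  qed simp
qed simp

text \<open>Chebyshev's argument: the central binomial coefficient is at most
  \<open>2 ^ (2 * m)\<close>, and in the expansion of its logarithm every \<open>d\<close> in
  \<open>{m<..2*m}\<close> has coefficient at least 1 and all others have coefficient at least 0.
  The slope 4 leaves room for odd \<open>n\<close>, where \<open>mangoldt n\<close> is bounded by
  \<open>n - 1\<close>.\<close>

lemma sum_mangoldt_le: "(\<Sum>d\<in>{1..n}. mangoldt d :: real) \<le> 4 * real n"
proof (induction n rule: less_induct)
  case (less n)
  have half: "(\<Sum>d\<in>{1..2*m}. mangoldt d :: real) \<le> (\<Sum>d\<in>{1..m}. mangoldt d) + 2 * real m" for m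
  proof -
    have eq: "ln (fact m :: real) = (\<Sum>d\<in>{1..2*m}. mangoldt d * real (m div d))"
      unfolding ln_fact_eq_sum_mangoldt by (rule sum.mono_neutral_left) auto
    have split: "(\<Sum>d\<in>{1..2*m}. mangoldt d :: real) = (\<Sum>d\<in>{1..m}. mangoldt d) + (\<Sum>d\<in>{m<..2*m}. mangoldt d)"
      by (subst sum.union_disjoint[symmetric]) (auto intro!: sum.cong)
    have "(\<Sum>d\<in>{m<..2*m}. mangoldt d :: real)
        \<le> (\<Sum>d\<in>{m<..2*m}. mangoldt d * (real (2*m div d) - 2 * real (m div d)))"
    proof (rule sum_mono)
      fix d assume d: "d \<in> {m<..2*m}"
      then have "2 * m div d \<ge> 1" by (simp add: Suc_le_eq div_greater_zero_iff)
      then show "(mangoldt d :: real) \<le> mangoldt d * (real (2*m div d) - 2 * real (m div d))"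
        using d mangoldt_nonneg[of d] mult_left_mono[of 1 "real (2 * m div d)" "mangoldt d"] by simp
    qed
    also have "\<dots> \<le> (\<Sum>d\<in>{1..2*m}. mangoldt d * (real (2*m div d) - 2 * real (m div d)))"
    proof (rule sum_mono2)
      fix d assume "d \<in> {1..2*m} - {m<..2*m}"
      then have "2 * (m div d) \<le> 2 * m div d"
        by (simp add: less_eq_div_iff_mult_less_eq)
      then have "2 * real (m div d) \<le> real (2 * m div d)"
        by (metis of_nat_le_iff of_nat_mult of_nat_numeral)
      then show "(0::real) \<le> mangoldt d * (real (2*m div d) - 2 * real (m div d))"
        using mangoldt_nonneg[of d] by simp
    qed auto
    also have "\<dots> = ln (fact (2*m) :: real) - 2 * ln (fact m)"
      unfolding eq ln_fact_eq_sum_mangoldt[of "2*m"]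
      by (simp add: sum_subtractf algebra_simps sum_distrib_left)
    also have "\<dots> = ln (real ((2*m) choose m))"
    proof -
      have "real ((2*m) choose m) = fact (2*m) / (fact m * fact m)"
        by (subst binomial_fact) (auto simp: mult_2)
      then show ?thesis by (simp add: ln_div ln_mult)
    qed
    also have "\<dots> \<le> ln (2 ^ (2*m))"
    proof -
      have "real ((2*m) choose m) \<le> 2 ^ (2*m)"
        using binomial_le_pow2[of "2*m" m] by (metis of_nat_le_iff of_nat_numeral of_nat_power)
      then show ?thesis by (subst ln_le_cancel_iff) (auto simp: binomial_eq_0_iff)
    qed
    also have "\<dots> = 2 * real m * ln 2" by (simp add: ln_realpow)
    also have "\<dots> \<le> 2 * real m * 1" using ln_2_less_1 by (intro mult_left_mono) auto
    finally show ?thesis unfolding split by simp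
  qed
  show ?case
  proof (cases "n \<le> 1")
    case True
    then have "n = 0 \<or> n = 1" by auto
    then show ?thesis by auto
  next
    case False
    define m where "m = n div 2"
    have IH: "(\<Sum>d\<in>{1..m}. mangoldt d :: real) \<le> 4 * real m"
      using False by (intro less) (auto simp: m_def)
    consider "n = 2 * m" | "n = Suc (2 * m)" unfolding m_def by linarith
    then show ?thesis
    proof cases
      case 1
      then show ?thesis using IH half[of m] by simp
    next
      case 2
      have "mangoldt n \<le> ln (real n)" using False by (intro mangoldt_le) auto
      also have "\<dots> \<le> real n - 1" using False by (intro ln_le_minus_one) auto
      finally show ?thesis using IH half[of m] 2 by simp
    qed
  qed
qed

text \<open>\<open>ln (fact n)\<close> has the weights \<open>n div d\<close>, the sum in question
  has \<open>n / d\<close> after multiplication by \<open>n\<close>; the rounding errors add up to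
  at most the Chebyshev sum, hence to at most \<open>4 * n\<close>.\<close>

lemma mertens_mangoldt:
  assumes "n \<ge> 1"
  shows "ln (real n) - 1 \<le> (\<Sum>d\<in>{1..n}. mangoldt d / real d)"
    and "(\<Sum>d\<in>{1..n}. mangoldt d / real d) \<le> ln (real n) + 4"
proof -
  have n: "real n > 0" using assms by simp
  define S where "S = (\<Sum>d\<in>{1..n}. mangoldt d / real d)"
  have d1: "real (n div d) \<le> real n / real d" "real n / real d \<le> real (n div d) + 1" for d
  proof -
    show "real (n div d) \<le> real n / real d" by (rule of_nat_div_le_of_nat)
    show "real n / real d \<le> real (n div d) + 1"
      using floor_divide_of_nat_eq[of n d, where ?'a = real] by linarith
  qed
  have "ln (fact n) \<le> (\<Sum>d\<in>{1..n}. mangoldt d * (real n / real d))"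
    unfolding ln_fact_eq_sum_mangoldt by (intro sum_mono mult_left_mono d1 mangoldt_nonneg)
  also have "\<dots> = real n * S" by (simp add: S_def sum_distrib_left mult_ac)
  finally have "real n * (ln (real n) - 1) \<le> real n * S"
    using ln_fact_lower[of n] by (simp add: algebra_simps)
  then show "ln (real n) - 1 \<le> S" using n by (simp only: mult_le_cancel_left_pos)
  have "real n * S = (\<Sum>d\<in>{1..n}. mangoldt d * (real n / real d))"
    by (simp add: S_def sum_distrib_left mult_ac)
  also have "\<dots> \<le> (\<Sum>d\<in>{1..n}. mangoldt d * (real (n div d) + 1))"
    by (intro sum_mono mult_left_mono d1 mangoldt_nonneg)
  also have "\<dots> = ln (fact n) + (\<Sum>d\<in>{1..n}. mangoldt d)"
    unfolding ln_fact_eq_sum_mangoldt by (simp add: algebra_simps sum.distrib)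
  finally have "real n * S \<le> real n * (ln (real n) + 4)"
    using ln_fact_upper[of n] sum_mangoldt_le[of n] by (simp add: algebra_simps)
  then show "S \<le> ln (real n) + 4" using n by (simp only: mult_le_cancel_left_pos)
qed

text \<open>Unique factorization: a prime power determines its base and its exponent, and
  \<open>mangoldt\<close> lives on prime powers.\<close>

lemma sum_mangoldt_eq_sum_primes:
  fixes f :: "nat \<Rightarrow> real"
  shows "(\<Sum>d\<in>{1..n}. mangoldt d * f d)
    = (\<Sum>p | prime p \<and> p \<le> n. ln (real p) * (\<Sum>j | 1 \<le> j \<and> p ^ j \<le> n. f (p ^ j)))"
proof -
  have fin: "finite {j. 1 \<le> j \<and> p ^ j \<le> n}" if "prime p" for p :: nat
  proof (rule finite_subset)
    have "j < p ^ j" for j using prime_gt_1_nat[OF that] by (intro power_gt_expt) auto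
    then show "{j. 1 \<le> j \<and> p ^ j \<le> n} \<subseteq> {..n}" using less_imp_le order_trans by blast
  qed simp
  let ?S = "SIGMA p:{p. prime p \<and> p \<le> n}. {j. 1 \<le> j \<and> p ^ j \<le> n}"
  have bij: "bij_betw (\<lambda>(p, j). p ^ j) ?S {d \<in> {1..n}. primepow d}"
    unfolding bij_betw_def
  proof
    show "inj_on (\<lambda>(p, j). p ^ j) ?S"
    proof (rule inj_onI, clarsimp)
      fix p q :: nat and i j
      assume "prime p" "prime q" "Suc 0 \<le> i" "Suc 0 \<le> j" "p ^ i = q ^ j"
      then show "p = q \<and> i = j" using prime_power_inj''[of p q i j] by simp
    qed
    show "(\<lambda>(p, j). p ^ j) ` ?S = {d \<in> {1..n}. primepow d}"
    proof (intro equalityI subsetI)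
      fix d assume d: "d \<in> {d \<in> {1..n}. primepow d}"
      then obtain p k where pk: "prime p" "k > 0" "d = p ^ k" by (auto simp: primepow_def)
      have "p \<le> p ^ k" using pk prime_gt_0_nat[of p] by (intro self_le_power) (auto simp: Suc_leI)
      then show "d \<in> (\<lambda>(p, j). p ^ j) ` ?S"
        using pk d by (intro image_eqI[of _ _ "(p, k)"]) auto
    qed (auto simp: Suc_le_eq prime_gt_0_nat)
  qed
  have "(\<Sum>d\<in>{1..n}. mangoldt d * f d) = (\<Sum>d | d \<in> {1..n} \<and> primepow d. mangoldt d * f d)"
    by (rule sum.mono_neutral_right) (auto simp: mangoldt_def)
  also have "\<dots> = (\<Sum>(p, j)\<in>?S. mangoldt (p ^ j) * f (p ^ j))"
    by (subst sum.reindex_bij_betw[OF bij, symmetric]) (auto intro!: sum.cong)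
  also have "\<dots> = (\<Sum>(p, j)\<in>?S. ln (real p) * f (p ^ j))"
    by (rule sum.cong) auto
  also have "\<dots> = (\<Sum>p | prime p \<and> p \<le> n. \<Sum>j | 1 \<le> j \<and> p ^ j \<le> n. ln (real p) * f (p ^ j))"
    by (rule sum.Sigma[symmetric]) (use fin in auto)
  finally show ?thesis by (simp add: sum_distrib_left)
qed

text \<open>The sum over all integers already converges, its terms being
  \<open>O(m powr (- 3/2))\<close>. The bound serves for proper prime powers and for the
  second-order terms of the valuation recursion.\<close>

lemma prime_log_sums_bounded:
  "\<exists>B. \<forall>n. (\<Sum>p | prime p \<and> p \<le> n. ln (real p) / (real p * (real p - 1))) \<le> B"
proof -
  let ?f = "\<lambda>m. ln (real m) / (real m * (real m - 1))"
  have "summable ?f"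
  proof (rule summable_comparison_test_bigo)
    show "summable (\<lambda>n. norm (real n powr (- (3/2))))"
      by (simp add: summable_real_powr_iff)
    show "?f \<in> O(\<lambda>n. real n powr (- (3/2)))" by real_asymp
  qed
  have nonneg: "?f m \<ge> 0" for m
    by (cases m) (auto intro!: divide_nonneg_nonneg mult_nonneg_nonneg)
  have "(\<Sum>p | prime p \<and> p \<le> n. ?f p) \<le> suminf ?f" for n
    by (rule sum_le_suminf[OF \<open>summable ?f\<close>]) (auto simp: nonneg)
  then show ?thesis by blast
qed

lemma sum_geometric_prime_le:
  assumes "p \<ge> 2" "finite J" "\<And>j. j \<in> J \<Longrightarrow> 1 \<le> j"
  shows "(\<Sum>j\<in>J. 1 / real (p ^ j)) \<le> 1 / (real p - 1)"
proof -
  have p: "real p \<ge> 2" using assms(1) by simp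
  have "(\<lambda>j. (1 / real p) ^ j) sums (1 / (1 - 1 / real p))"
    using p by (intro geometric_sums) auto
  then have s: "(\<lambda>j. (1 / real p) ^ Suc j) sums (1 / (1 - 1 / real p) - 1)"
    by (subst sums_Suc_iff) simp
  have "(\<Sum>j\<in>J. 1 / real (p ^ j)) = (\<Sum>j\<in>(\<lambda>j. j - 1) ` J. (1 / real p) ^ Suc j)"
  proof (subst sum.reindex)
    show "inj_on (\<lambda>j. j - 1) J"
      using assms(3) by (intro inj_onI) (metis One_nat_def Suc_diff_1 less_eq_Suc_le)
    show "(\<Sum>j\<in>J. 1 / real (p ^ j)) = sum ((\<lambda>j. (1 / real p) ^ Suc j) \<circ> (\<lambda>j. j - 1)) J"
    proof (rule sum.cong[OF refl])
      fix j assume "j \<in> J"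
      then have "Suc (j - 1) = j" using assms(3)[of j] by simp
      then show "1 / real (p ^ j) = ((\<lambda>j. (1 / real p) ^ Suc j) \<circ> (\<lambda>j. j - 1)) j"
        by (simp add: power_one_over del: power_Suc)
    qed
  qed
  also have "\<dots> \<le> (\<Sum>j. (1 / real p) ^ Suc j)"
    using s assms(2) by (intro sum_le_suminf) (auto simp: sums_iff)
  also have "\<dots> = 1 / (real p - 1)"
    using s p by (simp add: sums_iff field_simps)
  finally show ?thesis .
qed

text \<open>Proper prime powers contribute at most \<open>ln p / (p * (p - 1))\<close> for each
  prime, because \<open>1 / (p - 1) = 1 / p + 1 / (p * (p - 1))\<close>. Rounding \<open>x\<close>
  down to an integer costs at most \<open>ln 2\<close>.\<close>

lemma mertens_primes:
  "\<exists>C\<ge>0. \<forall>x\<ge>1. \<bar>(\<Sum>p | prime p \<and> real p \<le> x. ln (real p) / real p) - ln x\<bar> \<le> C"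
proof -
  obtain B where B: "\<And>n. (\<Sum>p | prime p \<and> p \<le> n. ln (real p) / (real p * (real p - 1))) \<le> B"
    using prime_log_sums_bounded by blast
  have B0: "B \<ge> 0" using B[of 0] by simp
  have "\<bar>(\<Sum>p | prime p \<and> real p \<le> x. ln (real p) / real p) - ln x\<bar> \<le> B + 5" if x: "x \<ge> 1" for x
  proof -
    define n where "n = nat \<lfloor>x\<rfloor>"
    have n: "n \<ge> 1" "real n \<le> x" "x < real n + 1" using x by (auto simp: n_def) linarith+
    have set_eq: "{p. prime p \<and> real p \<le> x} = {p. prime p \<and> p \<le> n}"
      using n by (auto simp: n_def le_nat_floor)
    define A where "A = (\<Sum>p | prime p \<and> p \<le> n. ln (real p) / real p)"
    define J where "J p = {j. 1 \<le> j \<and> p ^ j \<le> n}" for p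
    have finJ: "finite (J p)" if "prime p" for p
    proof (rule finite_subset)
      have "j < p ^ j" for j using prime_gt_1_nat[OF that] by (intro power_gt_expt) auto
      then show "J p \<subseteq> {..n}" unfolding J_def using less_imp_le order_trans by blast
    qed simp
    have eq: "(\<Sum>d\<in>{1..n}. mangoldt d / real d)
        = (\<Sum>p | prime p \<and> p \<le> n. ln (real p) * (\<Sum>j\<in>J p. 1 / real (p ^ j)))"
      using sum_mangoldt_eq_sum_primes[where f = "\<lambda>d. 1 / real d" and n = n] by (simp add: J_def)
    have "A \<le> (\<Sum>d\<in>{1..n}. mangoldt d / real d)"
      unfolding eq A_def
    proof (rule sum_mono)
      fix p assume p: "p \<in> {p. prime p \<and> p \<le> n}"
      have "(\<Sum>j\<in>{1}. 1 / real (p ^ j)) \<le> (\<Sum>j\<in>J p. 1 / real (p ^ j))"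
        using p finJ[of p] by (intro sum_mono2) (auto simp: J_def)
      then have "ln (real p) * (1 / real p) \<le> ln (real p) * (\<Sum>j\<in>J p. 1 / real (p ^ j))"
        using p prime_gt_0_nat[of p] by (intro mult_left_mono) (auto simp: Suc_le_eq)
      then show "ln (real p) / real p \<le> ln (real p) * (\<Sum>j\<in>J p. 1 / real (p ^ j))" by simp
    qed
    also have "\<dots> \<le> ln (real n) + 4" by (rule mertens_mangoldt[OF n(1)])
    also have "\<dots> \<le> ln x + 4" using n by simp
    finally have upper: "A \<le> ln x + 4" .
    have "real n \<ge> 1" using n by simp
    then have "ln x \<le> ln (real n * 2)" using n x by (subst ln_le_cancel_iff) linarith+
    also have "\<dots> \<le> ln (real n) + 1" using n ln_2_less_1 by (simp add: ln_mult)
    finally have "ln x - 2 \<le> ln (real n) - 1" by simp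
    also have "\<dots> \<le> (\<Sum>d\<in>{1..n}. mangoldt d / real d)" by (rule mertens_mangoldt[OF n(1)])
    also have "\<dots> \<le> (\<Sum>p | prime p \<and> p \<le> n. ln (real p) / real p + ln (real p) / (real p * (real p - 1)))"
      unfolding eq
    proof (rule sum_mono)
      fix p assume p: "p \<in> {p. prime p \<and> p \<le> n}"
      then have p2: "p \<ge> 2" by (simp add: prime_ge_2_nat)
      have "ln (real p) * (\<Sum>j\<in>J p. 1 / real (p ^ j)) \<le> ln (real p) * (1 / (real p - 1))"
        using p p2 finJ[of p] by (intro mult_left_mono sum_geometric_prime_le) (auto simp: J_def)
      also have "1 / (real p - 1) = 1 / real p + 1 / (real p * (real p - 1))"
        using p2 by (simp add: field_simps)
      finally show "ln (real p) * (\<Sum>j\<in>J p. 1 / real (p ^ j))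
          \<le> ln (real p) / real p + ln (real p) / (real p * (real p - 1))"
        by (simp add: distrib_left)
    qed
    also have "\<dots> \<le> A + B" using B[of n] by (simp add: A_def sum.distrib)
    finally have "ln x - 2 - B \<le> A" by simp
    then show ?thesis using upper B0 unfolding set_eq A_def by simp
  qed
  then show ?thesis using B0 by (intro exI[of _ "B + 5"]) auto
qed

text \<open>Equality at \<open>n = 1\<close> fixes \<open>1 - ln 2\<close>, an explicit positive
  stand-in for Euler's constant. The argument \<open>n + 1\<close> instead of \<open>n\<close> is
  what dominates \<open>u / d\<close> once \<open>n\<close> is the floor of a quotient.\<close>

lemma harmonic_sum_ge:
  assumes "n \<ge> 1" shows "ln (real n + 1) + (1 - ln 2) \<le> (\<Sum>m\<in>{1..n}. 1 / real m)"
  using assms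
proof (induction n rule: dec_induct)
  case (step n)
  have "ln ((real n + 2) / (real n + 1)) \<le> (real n + 2) / (real n + 1) - 1"
    by (intro ln_le_minus_one) auto
  also have "\<dots> = 1 / (real n + 1)" by (simp add: field_simps)
  finally have "ln (real n + 2) - ln (real n + 1) \<le> 1 / (real n + 1)"
    by (simp add: ln_div)
  then show ?case using step by (simp add: add.commute)
qed simp

text \<open>\<open>ln x / x\<close> decreases only beyond e, so the comparison with its
  antiderivative starts at 3 and the first terms go into the additive constant 2.\<close>

lemma sum_ln_over_le:
  assumes "n \<ge> 1" shows "(\<Sum>N\<in>{1..n}. ln (real N) / real N) \<le> ln (real n) ^ 2 / 2 + 2"
proof (cases "n \<le> 3")
  case True
  have "(\<Sum>N\<in>{1..n}. ln (real N) / real N) \<le> (\<Sum>N\<in>{1..3}. ln (real N) / real N)"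
    using True by (intro sum_mono2) auto
  also have "\<dots> = ln 2 / 2 + ln 3 / 3" by (simp add: numeral_eq_Suc)
  also have "ln (3::real) \<le> 2 * ln 2"
  proof -
    have "ln (3::real) \<le> ln (2 ^ 2)" by (subst ln_le_cancel_iff) auto
    also have "\<dots> = 2 * ln 2" by (subst ln_realpow) auto
    finally show ?thesis .
  qed
  finally have "(\<Sum>N\<in>{1..n}. ln (real N) / real N) \<le> 2" using ln_2_less_1 by simp
  then show ?thesis by (smt (verit) divide_nonneg_nonneg zero_le_power2)
next
  case False
  then have "3 \<le> n" by simp
  then show ?thesis
  proof (induction n rule: dec_induct)
    case base
    have "(\<Sum>N\<in>{1..3}. ln (real N) / real N) = ln 2 / 2 + ln 3 / 3" by (simp add: numeral_eq_Suc)
    also have "ln (3::real) \<le> 2 * ln 2"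
    proof -
      have "ln (3::real) \<le> ln (2 ^ 2)" by (subst ln_le_cancel_iff) auto
      also have "\<dots> = 2 * ln 2" by (subst ln_realpow) auto
      finally show ?thesis .
    qed
    finally have "(\<Sum>N\<in>{1..3}. ln (real N) / real N) \<le> 2" using ln_2_less_1 by simp
    then show ?case by (smt (verit) divide_nonneg_nonneg zero_le_power2)
  next
    case (step n)
    define f :: "real \<Rightarrow> real" where "f x = ln x ^ 2 / 2" for x
    have "\<exists>z>real n. z < real n + 1 \<and> f (real n + 1) - f (real n) = (real n + 1 - real n) * (ln z / z)"
      by (rule MVT2) (use step.hyps in \<open>auto simp: f_def intro!: derivative_eq_intros\<close>)
    then obtain z where z: "real n < z" "z < real n + 1" "f (real n + 1) - f (real n) = ln z / z"
      by auto
    have "exp 1 \<le> (3::real)" by (rule exp_le)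
    then have "ln (real n + 1) / (real n + 1) \<le> ln z / z"
      using z step.hyps by (intro ln_x_over_x_mono) auto
    then show ?case using step.IH z(3) by (simp add: f_def add.commute)
  qed
qed

text \<open>Each \<open>ln (u / d)\<close> is at most a harmonic sum minus \<open>1 - ln 2\<close>.
  The harmonic sums, weighted by \<open>mangoldt\<close>, recombine into the sum of
  \<open>ln N / N\<close>, which is at most \<open>ln u ^ 2 / 2\<close> plus a constant; the
  subtracted \<open>1 - ln 2\<close> is multiplied by about \<open>ln u\<close> through Mertens.
  This is the source of the negative second-order term.\<close>

lemma sum_mangoldt_ln_le:
  "\<exists>C\<ge>0. \<forall>n. \<forall>u\<ge>1. (\<Sum>d\<in>{1..n}. mangoldt d / real d * max 0 (ln (u / real d)))
     \<le> ln u ^ 2 / 2 - (1 - ln 2) * ln u + C"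
proof (intro exI[of _ 5] conjI allI impI)
  fix n and u :: real assume u: "u \<ge> 1"
  define k where "k = nat \<lfloor>u\<rfloor>"
  have k: "k \<ge> 1" "real k \<le> u" "u < real k + 1" using u by (auto simp: k_def) linarith+
  have c0: "0 \<le> 1 - ln (2::real)" "1 - ln (2::real) \<le> 1" using ln_2_less_1 by auto
  have "(\<Sum>d\<in>{1..n}. mangoldt d / real d * max 0 (ln (u / real d)))
     = (\<Sum>d\<in>{1..n} \<inter> {1..k}. mangoldt d / real d * max 0 (ln (u / real d)))"
  proof (rule sum.mono_neutral_right)
    show "\<forall>d\<in>{1..n} - {1..n} \<inter> {1..k}. mangoldt d / real d * max 0 (ln (u / real d)) = 0"
    proof
      fix d assume "d \<in> {1..n} - {1..n} \<inter> {1..k}"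
      then have "u / real d \<le> 1" "u / real d > 0" using k u by auto
      then show "mangoldt d / real d * max 0 (ln (u / real d)) = 0" by simp
    qed
  qed auto
  also have "\<dots> \<le> (\<Sum>d\<in>{1..k}. mangoldt d / real d * max 0 (ln (u / real d)))"
    by (intro sum_mono2) (auto intro!: mult_nonneg_nonneg divide_nonneg_nonneg mangoldt_nonneg)
  also have "\<dots> \<le> (\<Sum>d\<in>{1..k}. mangoldt d / real d * ((\<Sum>m\<in>{1..k div d}. 1 / real m) - (1 - ln 2)))"
  proof (intro sum_mono mult_left_mono divide_nonneg_nonneg mangoldt_nonneg)
    fix d assume d: "d \<in> {1..k}"
    then have kd: "k div d \<ge> 1" by (simp add: Suc_le_eq div_greater_zero_iff)
    have "u / real d \<le> (real k + 1) / real d" using k d by (intro divide_right_mono) auto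
    also have "\<dots> \<le> real (k div d) + 1"
    proof -
      have "k < d * (k div d + 1)"
        using d by (metis Suc_eq_plus1 atLeastAtMost_iff dividend_less_times_div less_le_trans mult_Suc_right add.commute zero_less_one)
      then have "k + 1 \<le> d * (k div d + 1)" by simp
      then have "real (k + 1) \<le> real (d * (k div d + 1))" by (simp only: of_nat_le_iff)
      then show ?thesis using d by (simp add: pos_divide_le_eq algebra_simps)
    qed
    finally have "ln (u / real d) \<le> ln (real (k div d) + 1)"
      using u d by (subst ln_le_cancel_iff) auto
    moreover have "0 \<le> ln (u / real d)" using d k by simp
    ultimately show "max 0 (ln (u / real d)) \<le> (\<Sum>m\<in>{1..k div d}. 1 / real m) - (1 - ln 2)"
      using harmonic_sum_ge[OF kd] by linarith
  qed simp
  also have "\<dots> = (\<Sum>d\<in>{1..k}. mangoldt d * (\<Sum>m\<in>{1..k div d}. 1 / real (d * m)))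
      - (1 - ln 2) * (\<Sum>d\<in>{1..k}. mangoldt d / real d)"
    by (simp add: right_diff_distrib sum_subtractf sum_distrib_left mult_ac)
  also have "\<dots> = (\<Sum>N\<in>{1..k}. ln (real N) / real N) - (1 - ln 2) * (\<Sum>d\<in>{1..k}. mangoldt d / real d)"
    using sum_ln_eq_sum_mangoldt[of "\<lambda>N. 1 / real N" k] by simp
  also have "\<dots> \<le> (ln (real k) ^ 2 / 2 + 2) - (1 - ln 2) * (ln (real k) - 1)"
    using k c0 by (intro diff_mono sum_ln_over_le mult_left_mono mertens_mangoldt) auto
  also have "\<dots> \<le> ln u ^ 2 / 2 - (1 - ln 2) * ln u + 5"
  proof -
    have "real k \<ge> 1" using k by simp
    then have "ln u \<le> ln (real k * 2)" using k u by (subst ln_le_cancel_iff) linarith+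
    also have "\<dots> \<le> ln (real k) + 1" using k ln_2_less_1 by (simp add: ln_mult)
    finally have "(1 - ln 2) * ln u \<le> (1 - ln 2) * (ln (real k) + 1)" using c0 by (intro mult_left_mono) auto
    moreover have "ln (real k) ^ 2 \<le> ln u ^ 2" using k by (intro power_mono) auto
    moreover have "a / 2 + 2 - c * (l - 1) \<le> b / 2 - c * l' + 5"
      if "c * l' \<le> c * (l + 1)" "a \<le> b" "0 \<le> c" "c \<le> 1" for a b c l l' :: real
      using that by (simp add: algebra_simps)
    ultimately show ?thesis using c0 by blast
  qed
  finally show "(\<Sum>d\<in>{1..n}. mangoldt d / real d * max 0 (ln (u / real d)))
     \<le> ln u ^ 2 / 2 - (1 - ln 2) * ln u + 5" .
qed simp

lemma DERIV_max0_square: "((\<lambda>x. (max 0 x)\<^sup>2) has_real_derivative 2 * max 0 x) (at (x::real))"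
proof (cases "x = 0")
  case True
  have "((\<lambda>x. (max 0 x)\<^sup>2) has_real_derivative 0) (at (0::real))"
    unfolding has_field_derivative_iff
  proof (rule tendsto_sandwich[of "\<lambda>x. - \<bar>x\<bar>" _ _ "\<lambda>x. \<bar>x\<bar>"])
    show "\<forall>\<^sub>F x in at 0. - \<bar>x\<bar> \<le> ((max 0 x)\<^sup>2 - (max 0 0)\<^sup>2) / (x - 0 :: real)"
      by (intro always_eventually) (auto simp: max_def power2_eq_square)
    show "\<forall>\<^sub>F x in at 0. ((max 0 x)\<^sup>2 - (max 0 0)\<^sup>2) / (x - 0 :: real) \<le> \<bar>x\<bar>"
      by (intro always_eventually) (auto simp: max_def power2_eq_square)
  qed (auto intro!: tendsto_eq_intros)
  then show ?thesis using True by simp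
next
  case False
  then consider "x > 0" | "x < 0" by linarith
  then show ?thesis
  proof cases
    case 1
    have "((\<lambda>x. x\<^sup>2) has_real_derivative 2 * max 0 x) (at x)"
      using 1 by (auto intro!: derivative_eq_intros)
    then show ?thesis
      by (rule has_field_derivative_transform_within_open[of _ _ _ "{0<..}"]) (use 1 in auto)
  next
    case 2
    have "((\<lambda>x. 0) has_real_derivative 2 * max 0 x) (at x)"
      using 2 by (auto intro!: derivative_eq_intros)
    then show ?thesis
      by (rule has_field_derivative_transform_within_open[of _ _ _ "{..<0}"]) (use 2 in auto)
  qed
qed

text \<open>This is \<open>sum_mangoldt_ln_le\<close> integrated against \<open>2 / u\<close> from 1
  to \<open>z\<close>: both sides vanish at 1, and the derivative of the squared positive part is
  twice the linear one over \<open>u\<close>. The square is needed because test functions must have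
  a Lipschitz derivative.\<close>

lemma sum_mangoldt_ln_square_le:
  "\<exists>C\<ge>0. \<forall>n. \<forall>z\<ge>1. (\<Sum>d\<in>{1..n}. mangoldt d / real d * (max 0 (ln (z / real d)))\<^sup>2)
     \<le> ln z ^ 3 / 3 - (1 - ln 2) * ln z ^ 2 + C * ln z"
proof -
  obtain C where C: "C \<ge> 0" "\<And>n u. u \<ge> 1 \<Longrightarrow> (\<Sum>d\<in>{1..n}. mangoldt d / real d * max 0 (ln (u / real d)))
     \<le> ln u ^ 2 / 2 - (1 - ln 2) * ln u + C"
    using sum_mangoldt_ln_le by blast
  show ?thesis
  proof (intro exI[of _ "2 * C"] conjI allI impI)
    fix n and z :: real assume z: "z \<ge> 1"
    define f where "f u = ln u ^ 3 / 3 - (1 - ln 2) * ln u ^ 2 + 2 * C * ln u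
        - (\<Sum>d\<in>{1..n}. mangoldt d / real d * (max 0 (ln (u / real d)))\<^sup>2)" for u
    have "f 1 \<le> f z"
    proof (rule DERIV_nonneg_imp_nondecreasing[OF z])
      fix u :: real assume u: "1 \<le> u" "u \<le> z"
      let ?S = "\<Sum>d\<in>{1..n}. mangoldt d / real d * max 0 (ln (u / real d))"
      have "((\<lambda>u. (max 0 (ln (u / real d)))\<^sup>2) has_real_derivative 2 * max 0 (ln (u / real d)) * (1 / u)) (at u)"
        if "d \<in> {1..n}" for d
        using u that by (intro DERIV_chain2[OF DERIV_max0_square]) (auto intro!: derivative_eq_intros)
      then have "(f has_real_derivative (ln u ^ 2 / u - (1 - ln 2) * (2 * ln u / u) + 2 * C / u
          - (\<Sum>d\<in>{1..n}. mangoldt d / real d * (2 * max 0 (ln (u / real d)) * (1 / u))))) (at u)"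
        unfolding f_def using u
        by (intro DERIV_diff DERIV_add DERIV_sum DERIV_cmult) (auto intro!: derivative_eq_intros)
      also have "(\<Sum>d\<in>{1..n}. mangoldt d / real d * (2 * max 0 (ln (u / real d)) * (1 / u))) = 2 * ?S / u"
        by (simp add: sum_distrib_left sum_divide_distrib mult_ac)
      also have "ln u ^ 2 / u - (1 - ln 2) * (2 * ln u / u) + 2 * C / u - 2 * ?S / u
          = 2 * (ln u ^ 2 / 2 - (1 - ln 2) * ln u + C - ?S) / u"
        using u by (simp add: field_simps)
      finally have "(f has_real_derivative 2 * (ln u ^ 2 / 2 - (1 - ln 2) * ln u + C - ?S) / u) (at u)" .
      moreover have "2 * (ln u ^ 2 / 2 - (1 - ln 2) * ln u + C - ?S) / u \<ge> 0"
        using C(2)[OF u(1), of n] u by (intro divide_nonneg_nonneg) auto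
      ultimately show "\<exists>y. (f has_real_derivative y) (at u) \<and> 0 \<le> y" by blast
    qed
    moreover have "f 1 = 0"
      unfolding f_def by (auto intro!: sum.neutral simp: ln_div max_def)
    ultimately show "(\<Sum>d\<in>{1..n}. mangoldt d / real d * (max 0 (ln (z / real d)))\<^sup>2)
     \<le> ln z ^ 3 / 3 - (1 - ln 2) * ln z ^ 2 + 2 * C * ln z"
      by (simp add: f_def)
  qed (use C in simp)
qed


section \<open>Size of the n-th prime\<close>

lemma strict_mono_enumerate_primes: "strict_mono (enumerate {p::nat. prime p})"
  using primes_infinite strict_mono_enumerate by blast

lemma prime_nth_prime: "prime (nth_prime n)"
  using enumerate_in_set[OF primes_infinite, of "n - 1"] by (simp add: nth_prime_def)

lemma nth_prime_gt: assumes "n \<ge> 1" shows "n + 1 \<le> nth_prime n"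
proof -
  have "k + 2 \<le> enumerate {p::nat. prime p} k" for k
  proof (induction k)
    case 0
    show ?case
      using prime_ge_2_nat[of "enumerate {p::nat. prime p} 0"] enumerate_in_set[OF primes_infinite, of 0]
      by simp
  next
    case (Suc k)
    then show ?case
      using strict_monoD[OF strict_mono_enumerate_primes, of k "Suc k"] by simp
  qed
  from this[of "n - 1"] show ?thesis using assms by (simp add: nth_prime_def)
qed

lemma card_primes_le_nth_prime:
  assumes "n \<ge> 1" shows "card {p. prime p \<and> p \<le> nth_prime n} = n"
proof -
  let ?e = "enumerate {p::nat. prime p}"
  have "{p. prime p \<and> p \<le> nth_prime n} = ?e ` {..<n}"
  proof (intro equalityI subsetI)
    fix p assume p: "p \<in> {p. prime p \<and> p \<le> nth_prime n}"
    then obtain k where k: "?e k = p" using enumerate_Ex[OF primes_infinite, of p] by auto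
    then have "k \<le> n - 1"
      using p strict_mono_less_eq[OF strict_mono_enumerate_primes] by (auto simp: nth_prime_def)
    then show "p \<in> ?e ` {..<n}" using k assms by (intro image_eqI[of _ _ k]) auto
  next
    fix p assume "p \<in> ?e ` {..<n}"
    then obtain k where "k < n" "p = ?e k" by auto
    then show "p \<in> {p. prime p \<and> p \<le> nth_prime n}"
      using strict_mono_less_eq[OF strict_mono_enumerate_primes, of k "n - 1"]
        enumerate_in_set[OF primes_infinite, of k] by (auto simp: nth_prime_def)
  qed
  moreover have "inj ?e" using strict_mono_enumerate_primes by (rule strict_mono_imp_inj_on)
  ultimately show ?thesis by (simp add: card_image inj_on_subset)
qed

text \<open>For the upper bound, Mertens gives \<open>ln (nth_prime n) - ln (n + 1)\<close>, up to a
  constant, as the sum of \<open>ln p / p\<close> over the primes in between. There are at most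
  \<open>n\<close> of them and each term is at most \<open>ln (n + 1) / (n + 1)\<close>, so this sum
  is at most \<open>ln (n + 1)\<close>.\<close>

lemma ln_nth_prime_bounds:
  "\<exists>C>0. \<forall>n\<ge>2. ln (real n) \<le> ln (real (nth_prime n)) \<and> ln (real (nth_prime n)) \<le> C * ln (real n)"
proof -
  obtain M where M: "M \<ge> 0" "\<And>x. x \<ge> 1 \<Longrightarrow> \<bar>(\<Sum>p | prime p \<and> real p \<le> x. ln (real p) / real p) - ln x\<bar> \<le> M"
    using mertens_primes by blast
  \<comment> \<open>The 4 comes from \<open>ln (n + 1) \<le> 2 * ln n\<close>; dividing by
    \<open>ln 2\<close> turns the constant \<open>2 * M\<close> into a multiple of
    \<open>ln n\<close> for \<open>n \<ge> 2\<close>.\<close>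
  define C where "C = 4 + 2 * M / ln 2"
  have "ln (real n) \<le> ln (real (nth_prime n)) \<and> ln (real (nth_prime n)) \<le> C * ln (real n)"
    if n: "n \<ge> 2" for n
  proof
    have np: "nth_prime n \<ge> n + 1" using n by (intro nth_prime_gt) auto
    then show "ln (real n) \<le> ln (real (nth_prime n))" using n by simp
    let ?A = "{p. prime p \<and> p \<le> nth_prime n}" and ?B = "{p. prime p \<and> p \<le> n + 1}"
    have "ln (real (nth_prime n)) \<le> (\<Sum>p\<in>?A. ln (real p) / real p) + M"
      using M(2)[of "real (nth_prime n)"] np by simp
    also have "(\<Sum>p\<in>?A. ln (real p) / real p) = (\<Sum>p\<in>?B. ln (real p) / real p) + (\<Sum>p\<in>?A - ?B. ln (real p) / real p)"
      using np by (subst sum.union_disjoint[symmetric]) (auto intro!: sum.cong)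
    also have "(\<Sum>p\<in>?B. ln (real p) / real p) \<le> ln (real (n + 1)) + M"
      using M(2)[of "real (n + 1)"] by (simp del: of_nat_add of_nat_Suc)
    also have "(\<Sum>p\<in>?A - ?B. ln (real p) / real p) \<le> (\<Sum>p\<in>?A - ?B. ln (real (n + 1)) / real (n + 1))"
    proof (rule sum_mono)
      fix p assume p: "p \<in> ?A - ?B"
      have "exp 1 \<le> (3::real)" by (rule exp_le)
      then show "ln (real p) / real p \<le> ln (real (n + 1)) / real (n + 1)"
        using p n by (intro ln_x_over_x_mono) auto
    qed
    also have "\<dots> = real (card (?A - ?B)) * (ln (real (n + 1)) / real (n + 1))" by simp
    also have "\<dots> \<le> real (n + 1) * (ln (real (n + 1)) / real (n + 1))"
    proof (intro mult_right_mono divide_nonneg_nonneg)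
      have "card (?A - ?B) \<le> card ?A" by (intro card_mono) auto
      then show "real (card (?A - ?B)) \<le> real (n + 1)" using card_primes_le_nth_prime[of n] n by simp
    qed auto
    also have "\<dots> = ln (real (n + 1))" by simp
    finally have "ln (real (nth_prime n)) \<le> 2 * ln (real (n + 1)) + 2 * M" by simp
    also have "ln (real (n + 1)) \<le> 2 * ln (real n)"
    proof -
      have "n + 1 \<le> n * n" using n mult_le_mono1[of 2 n n] by linarith
      then have "real (n + 1) \<le> real n * real n" by (simp only: of_nat_le_iff of_nat_mult[symmetric])
      then have "ln (real (n + 1)) \<le> ln (real n * real n)" using n by (subst ln_le_cancel_iff) auto
      then show ?thesis using n by (simp add: ln_mult)
    qed
    also have "2 * M \<le> 2 * M / ln 2 * ln (real n)"
      using M(1) n mult_left_mono[of "ln 2" "ln (real n)" "2 * M"] by (simp add: field_simps)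
    finally show "ln (real (nth_prime n)) \<le> C * ln (real n)"
      by (simp add: C_def algebra_simps)
  qed
  moreover have "C > 0" using M(1) by (simp add: C_def add_pos_nonneg)
  ultimately show ?thesis by blast
qed

section \<open>Weights on smooth numbers satisfying a multiplicative recursion\<close>

abbreviation val :: "nat \<Rightarrow> nat \<Rightarrow> real" where
  "val p N \<equiv> real (multiplicity p N)"

lemma ln_of_nat_nonneg [simp]: "0 \<le> ln (real n)"
  by (cases n) auto

lemma val_mult_self: "prime p \<Longrightarrow> m > 0 \<Longrightarrow> val p (p * m) = val p m + 1"
  by (subst multiplicity_times_same) auto

text \<open>
  The recursion of a negative binomial (\<open>\<kappa> = 1\<close>) or Bernoulli (\<open>\<kappa> = - \<theta>\<close>) valuation covers the
  smooth and the square-free smooth integers at once.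
\<close>

locale panjer_weight =
  fixes w :: "nat \<Rightarrow> real" and y :: nat and \<theta> \<kappa> :: real
  assumes y: "y \<ge> 2" and theta: "\<theta> > 0" and kappa: "\<kappa> \<le> 1" "- \<theta> \<le> \<kappa>"
    and w_nonneg: "w N \<ge> 0" and w_0: "w 0 = 0" and w_1: "w 1 = 1"
    and w_smooth: "\<lbrakk>w N \<noteq> 0; prime p; p dvd N\<rbrakk> \<Longrightarrow> p \<le> y"
    and w_rec: "\<lbrakk>prime p; p \<le> y; m > 0\<rbrakk> \<Longrightarrow> w (p * m) * (val p m + 1) = w m * (\<theta> + \<kappa> * val p m) / real p"
begin

definition "PP = {p. prime p \<and> p \<le> y}"

lemma PP: "p \<in> PP \<Longrightarrow> prime p" "p \<in> PP \<Longrightarrow> p \<le> y" "p \<in> PP \<Longrightarrow> 2 \<le> real p" "finite PP"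
  using prime_ge_2_nat by (auto simp: PP_def)

lemma w_pos_imp: "w N \<noteq> 0 \<Longrightarrow> N > 0"
  using w_0 by (cases N) auto

text \<open>Reduces moments of \<open>ln N\<close> to moments of valuations, on which
  \<open>w_rec\<close> acts.\<close>

lemma ln_eq_sum_val:
  assumes "w N \<noteq> 0"
  shows "ln (real N) = (\<Sum>p\<in>PP. ln (real p) * val p N)"
proof -
  have N: "N > 0" by (rule w_pos_imp[OF assms])
  have "ln (real N) = ln (\<Prod>p\<in>prime_factors N. real p ^ multiplicity p N)"
    using prime_factorization_nat[OF N] by (metis (no_types, lifting) of_nat_power of_nat_prod prod.cong)
  also have "\<dots> = (\<Sum>p\<in>prime_factors N. ln (real p ^ multiplicity p N))"
    by (rule ln_prod) (auto simp: in_prime_factors_iff prime_gt_0_nat)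
  also have "\<dots> = (\<Sum>p\<in>prime_factors N. ln (real p) * val p N)"
    by (intro sum.cong refl) (auto simp: ln_realpow in_prime_factors_iff prime_gt_0_nat)
  also have "\<dots> = (\<Sum>p\<in>PP. ln (real p) * val p N)"
  proof (rule sum.mono_neutral_left)
    show "prime_factors N \<subseteq> PP"
      using w_smooth[OF assms] by (auto simp: PP_def in_prime_factors_iff)
    show "\<forall>p\<in>PP - prime_factors N. ln (real p) * val p N = 0"
      using N by (auto simp: PP_def in_prime_factors_iff not_dvd_imp_multiplicity_0)
  qed (simp add: PP)
  finally show ?thesis .
qed

section \<open>Truncated moments and summability of the weights\<close>

definition T :: "nat \<Rightarrow> (nat \<Rightarrow> real) \<Rightarrow> real" where
  "T x \<phi> = (\<Sum>N\<in>{1..x}. w N * \<phi> N)"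

lemma T_add: "T x (\<lambda>N. f N + g N) = T x f + T x g"
  by (simp add: T_def distrib_left sum.distrib)

lemma T_cmult: "T x (\<lambda>N. c * f N) = c * T x f"
  by (simp add: T_def sum_distrib_left mult_ac)

lemma T_sum: "finite A \<Longrightarrow> T x (\<lambda>N. \<Sum>a\<in>A. f a N) = (\<Sum>a\<in>A. T x (f a))"
  unfolding T_def by (simp add: sum_distrib_left) (rule sum.swap)

lemma T_mono: "(\<And>N. N \<in> {1..x} \<Longrightarrow> w N \<noteq> 0 \<Longrightarrow> f N \<le> g N) \<Longrightarrow> T x f \<le> T x g"
  unfolding T_def
proof (rule sum_mono)
  fix N assume "N \<in> {1..x}" and le: "\<And>N. N \<in> {1..x} \<Longrightarrow> w N \<noteq> 0 \<Longrightarrow> f N \<le> g N"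
  then show "w N * f N \<le> w N * g N"
    by (cases "w N = 0") (auto intro!: mult_left_mono w_nonneg)
qed

lemma T_cong: "(\<And>N. N \<in> {1..x} \<Longrightarrow> w N \<noteq> 0 \<Longrightarrow> f N = g N) \<Longrightarrow> T x f = T x g"
  by (intro antisym T_mono) auto

lemma T_nonneg: "(\<And>N. N \<in> {1..x} \<Longrightarrow> f N \<ge> 0) \<Longrightarrow> T x f \<ge> 0"
  unfolding T_def by (auto intro!: sum_nonneg mult_nonneg_nonneg w_nonneg)

text \<open>Substitute \<open>N = p * m\<close> and apply \<open>w_rec\<close>. Replacing
  \<open>\<kappa>\<close> by 1 and enlarging the range \<open>x div p\<close> to \<open>x\<close>
  leaves the same truncation on both sides, so that the valuation term on the right can be
  absorbed.\<close>

lemma T_val_le: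
  assumes p: "p \<in> PP" and k: "\<And>N. k N \<ge> 0"
  shows "T x (\<lambda>N. val p N * k N) \<le> T x (\<lambda>N. (\<theta> + val p N) * k (p * N)) / real p"
proof -
  have p': "prime p" "p \<le> y" "p \<ge> 1" using PP(1,2)[OF p] prime_ge_1_nat by auto
  have "T x (\<lambda>N. val p N * k N) = (\<Sum>N | N \<in> {1..x} \<and> p dvd N. w N * (val p N * k N))"
    unfolding T_def by (rule sum.mono_neutral_right) (auto simp: not_dvd_imp_multiplicity_0)
  also have "\<dots> = (\<Sum>m\<in>{1..x div p}. w (p * m) * (val p (p * m) * k (p * m)))"
    by (rule sum_multiples_eq[OF p'(3)])
  also have "\<dots> = (\<Sum>m\<in>{1..x div p}. w m * (\<theta> + \<kappa> * val p m) / real p * k (p * m))"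
    using p' by (intro sum.cong refl) (simp add: val_mult_self w_rec[symmetric])
  also have "\<dots> \<le> (\<Sum>m\<in>{1..x div p}. w m * (\<theta> + val p m) / real p * k (p * m))"
  proof (intro sum_mono mult_right_mono divide_right_mono mult_left_mono add_left_mono w_nonneg k)
    show "\<kappa> * val p m \<le> val p m" for m using kappa(1) mult_right_mono[of \<kappa> 1 "val p m"] by simp
  qed simp
  also have "\<dots> \<le> (\<Sum>m\<in>{1..x}. w m * (\<theta> + val p m) / real p * k (p * m))"
    using theta p' div_le_dividend[of x p]
    by (intro sum_mono2) (auto intro!: mult_nonneg_nonneg divide_nonneg_nonneg w_nonneg k)
  also have "\<dots> = T x (\<lambda>N. (\<theta> + val p N) * k (p * N)) / real p"
    by (simp add: T_def sum_divide_distrib mult.assoc)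
  finally show ?thesis .
qed

text \<open>With \<open>k = 1\<close> the term \<open>T x (val p) / p\<close> appears on the right
  and, as \<open>p \<ge> 2\<close>, can be moved to the left.\<close>

lemma T_val_le': assumes p: "p \<in> PP" shows "T x (val p) \<le> \<theta> / (real p - 1) * T x (\<lambda>_. 1)"
proof -
  have "T x (val p) \<le> T x (\<lambda>N. \<theta> * 1 + val p N) / real p"
    using T_val_le[OF p, where k = "\<lambda>_. 1"] by simp
  also have "\<dots> = (\<theta> * T x (\<lambda>_. 1) + T x (val p)) / real p" by (simp only: T_add T_cmult)
  finally show ?thesis using PP(3)[OF p] by (simp add: field_simps)
qed

definition "B0 = (\<Sum>p\<in>PP. ln (real p) * (\<theta> / (real p - 1)))"

lemma T_ln_le: "T x (\<lambda>N. ln (real N)) \<le> B0 * T x (\<lambda>_. 1)"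
proof -
  have "T x (\<lambda>N. ln (real N)) = T x (\<lambda>N. \<Sum>p\<in>PP. ln (real p) * val p N)"
    by (rule T_cong) (rule ln_eq_sum_val)
  also have "\<dots> = (\<Sum>p\<in>PP. ln (real p) * T x (val p))"
    by (simp add: T_sum[OF PP(4)] T_cmult)
  also have "\<dots> \<le> (\<Sum>p\<in>PP. ln (real p) * (\<theta> / (real p - 1) * T x (\<lambda>_. 1)))"
    using PP(3) by (intro sum_mono mult_left_mono T_val_le') force+
  also have "\<dots> = B0 * T x (\<lambda>_. 1)" by (simp add: B0_def sum_distrib_right mult.assoc)
  finally show ?thesis .
qed

lemma B0_nonneg: "B0 \<ge> 0"
  unfolding B0_def using PP(3) theta by (intro sum_nonneg mult_nonneg_nonneg divide_nonneg_nonneg) force+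

text \<open>
  Under the truncated weights the mean of \<open>ln N\<close> is at most \<open>B0\<close>, so by Markov's inequality a fixed
  initial segment carries half of the mass.
\<close>

lemma T_1_bounded: "\<exists>W. \<forall>x. T x (\<lambda>_. 1) \<le> W"
proof (intro exI allI)
  fix x
  define x0 where "x0 = nat \<lceil>exp (2 * B0 + 1)\<rceil>"
  have x0: "exp (2 * B0 + 1) \<le> real x0" unfolding x0_def by linarith
  have "T x (\<lambda>_. 1) \<le> T x (\<lambda>N. ln (real N) / (2 * B0 + 1) + (if N \<le> x0 then 1 else 0))"
  proof (rule T_mono)
    fix N assume N: "N \<in> {1..x}"
    show "1 \<le> ln (real N) / (2 * B0 + 1) + (if N \<le> x0 then 1 else 0)"
    proof (cases "N \<le> x0")
      case False
      then have "exp (2 * B0 + 1) \<le> real N" using x0 by linarith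
      then have "2 * B0 + 1 \<le> ln (real N)" using N by (subst ln_ge_iff) auto
      then show ?thesis using B0_nonneg by (simp add: field_simps)
    qed (use N B0_nonneg in auto)
  qed
  also have "\<dots> = 1 / (2 * B0 + 1) * T x (\<lambda>N. ln (real N)) + T x (\<lambda>N. if N \<le> x0 then 1 else 0)"
    using T_cmult[of x "1 / (2 * B0 + 1)" "\<lambda>N. ln (real N)"] by (simp add: T_add)
  also have "T x (\<lambda>N. if N \<le> x0 then 1 else 0) \<le> T x0 (\<lambda>_. 1)"
  proof -
    have "T x (\<lambda>N. if N \<le> x0 then 1 else 0) = (\<Sum>N\<in>{1..x} \<inter> {1..x0}. w N)"
      unfolding T_def by (rule sum.mono_neutral_cong_right) auto
    also have "\<dots> \<le> T x0 (\<lambda>_. 1)" unfolding T_def by (simp, intro sum_mono2) (auto simp: w_nonneg)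
    finally show ?thesis .
  qed
  also have "1 / (2 * B0 + 1) * T x (\<lambda>N. ln (real N)) \<le> 1 / (2 * B0 + 1) * (B0 * T x (\<lambda>_. 1))"
    using B0_nonneg by (intro mult_left_mono T_ln_le) auto
  also have "\<dots> \<le> 1 / 2 * T x (\<lambda>_. 1)"
  proof -
    have "T x (\<lambda>_. 1) \<ge> 0" by (rule T_nonneg) simp
    then have "B0 / (2 * B0 + 1) * T x (\<lambda>_. 1) \<le> 1 / 2 * T x (\<lambda>_. 1)"
      using B0_nonneg by (intro mult_right_mono) (auto simp: field_simps)
    then show ?thesis by simp
  qed
  finally show "T x (\<lambda>_. 1) \<le> 2 * T x0 (\<lambda>_. 1)" by simp
qed

lemma T_ln_bounded: "\<exists>W. \<forall>x. T x (\<lambda>N. ln (real N)) \<le> W"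
proof -
  obtain W where W: "\<And>x. T x (\<lambda>_. 1) \<le> W" using T_1_bounded by blast
  have "T x (\<lambda>N. ln (real N)) \<le> B0 * W" for x
    using T_ln_le[of x] mult_left_mono[OF W[of x] B0_nonneg] by simp
  then show ?thesis by blast
qed

text \<open>The absorption of \<open>T_val_le'\<close> one order higher, with \<open>k = ln\<close>
  and \<open>ln (p * N) = ln p + ln N\<close>. The second moment makes \<open>val p N * ln N\<close>
  integrable, as the tail estimate requires.\<close>

lemma T_ln_square_bounded: "\<exists>W. \<forall>x. T x (\<lambda>N. ln (real N) ^ 2) \<le> W"
proof -
  obtain W where W: "\<And>x. T x (\<lambda>_. 1) \<le> W" using T_1_bounded by blast
  obtain V where V: "\<And>x. T x (\<lambda>N. ln (real N)) \<le> V" using T_ln_bounded by blast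
  define D where "D p = (\<theta> * V + ln (real p) * (\<theta> * W + \<theta> / (real p - 1) * W)) / (real p - 1)" for p
  have val_ln: "T x (\<lambda>N. val p N * ln (real N)) \<le> D p" if p: "p \<in> PP" for p x
  proof -
    have p2: "real p \<ge> 2" using PP(3)[OF p] .
    have lnp: "ln (real p) \<ge> 0" using p2 by simp
    have "T x (\<lambda>N. val p N * ln (real N)) \<le> T x (\<lambda>N. (\<theta> + val p N) * ln (real (p * N))) / real p"
      by (rule T_val_le[OF p]) simp
    also have "T x (\<lambda>N. (\<theta> + val p N) * ln (real (p * N)))
        = T x (\<lambda>N. (\<theta> * ln (real N) + ln (real p) * (\<theta> * 1 + val p N)) + val p N * ln (real N))"
      using p2 by (intro T_cong) (simp add: ln_mult algebra_simps)
    also have "\<dots> = (\<theta> * T x (\<lambda>N. ln (real N)) + ln (real p) * (\<theta> * T x (\<lambda>_. 1) + T x (val p)))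
         + T x (\<lambda>N. val p N * ln (real N))"
      by (simp only: T_add T_cmult)
    finally have "T x (\<lambda>N. val p N * ln (real N))
      \<le> (\<theta> * T x (\<lambda>N. ln (real N)) + ln (real p) * (\<theta> * T x (\<lambda>_. 1) + T x (val p))) / (real p - 1)"
      using p2 by (simp add: field_simps)
    also have "\<dots> \<le> D p"
      unfolding D_def
    proof (intro divide_right_mono add_mono mult_left_mono V W lnp)
      have "T x (val p) \<le> \<theta> / (real p - 1) * T x (\<lambda>_. 1)" by (rule T_val_le'[OF p])
      also have "\<dots> \<le> \<theta> / (real p - 1) * W" using theta p2 by (intro mult_left_mono W) auto
      finally show "T x (val p) \<le> \<theta> / (real p - 1) * W" .
    qed (use theta p2 in auto)
    finally show ?thesis .
  qed
  have "T x (\<lambda>N. ln (real N) ^ 2) \<le> (\<Sum>p\<in>PP. ln (real p) * D p)" for x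
  proof -
    have "T x (\<lambda>N. ln (real N) ^ 2) = T x (\<lambda>N. \<Sum>p\<in>PP. ln (real p) * (val p N * ln (real N)))"
    proof (rule T_cong)
      fix N assume "w N \<noteq> 0"
      from ln_eq_sum_val[OF this]
      show "ln (real N) ^ 2 = (\<Sum>p\<in>PP. ln (real p) * (val p N * ln (real N)))"
        by (simp add: power2_eq_square sum_distrib_right mult.assoc)
    qed
    also have "\<dots> = (\<Sum>p\<in>PP. ln (real p) * T x (\<lambda>N. val p N * ln (real N)))"
      by (simp add: T_sum[OF PP(4)] T_cmult)
    also have "\<dots> \<le> (\<Sum>p\<in>PP. ln (real p) * D p)"
      using PP(3) by (intro sum_mono mult_left_mono val_ln) force+
    finally show ?thesis .
  qed
  then show ?thesis by blast
qed

lemma summable_if_T_bounded: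
  assumes "\<And>N. f N \<ge> 0" "\<exists>W. \<forall>x. T x f \<le> W"
  shows "summable (\<lambda>N. w N * f N)"
proof -
  obtain W where W: "\<And>x. T x f \<le> W" using assms(2) by blast
  show ?thesis
  proof (rule summableI_nonneg_bounded)
    fix n
    have "(\<Sum>i<n. w i * f i) = (\<Sum>i\<in>{..<n} - {0}. w i * f i)"
      using w_0 by (intro sum.mono_neutral_right) auto
    also have "\<dots> \<le> T n f"
      unfolding T_def by (intro sum_mono2) (auto simp: assms w_nonneg)
    finally show "(\<Sum>i<n. w i * f i) \<le> W" using W[of n] by simp
  qed (simp add: assms w_nonneg)
qed

lemma summable_w: "summable w"
  using summable_if_T_bounded[OF _ T_1_bounded] by simp

lemma summable_w_ln: "summable (\<lambda>N. w N * ln (real N))"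
proof (rule summable_if_T_bounded[OF _ T_ln_bounded])
  show "0 \<le> ln (real N)" for N by (cases N) auto
qed

lemma summable_w_ln_square: "summable (\<lambda>N. w N * ln (real N) ^ 2)"
  by (rule summable_if_T_bounded[OF _ T_ln_square_bounded]) simp

end

section \<open>The normalized law and the valuation recursion in expectation\<close>

context panjer_weight
begin

definition "Z = suminf w"

lemma Z_ge_1: "Z \<ge> 1"
proof -
  have "sum w {1} \<le> suminf w" by (rule sum_le_suminf) (auto simp: summable_w w_nonneg)
  then show ?thesis by (simp add: Z_def w_1[simplified])
qed

definition q :: "nat pmf" where "q = embed_pmf (\<lambda>N. w N / Z)"

lemma pmf_q: "pmf q N = w N / Z"
  unfolding q_def
proof (rule pmf_embed_pmf)
  show "w N / Z \<ge> 0" for N using Z_ge_1 w_nonneg by simp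
  have "(\<integral>\<^sup>+N. ennreal (w N / Z) \<partial>count_space UNIV) = (\<Sum>N. ennreal (w N / Z))"
    by (rule nn_integral_count_space_nat)
  also have "\<dots> = ennreal (\<Sum>N. w N / Z)"
    using Z_ge_1 by (intro suminf_ennreal2 summable_divide summable_w) (auto simp: w_nonneg)
  also have "(\<Sum>N. w N / Z) = 1"
    using Z_ge_1 by (simp add: suminf_divide[OF summable_w] Z_def[symmetric])
  finally show "(\<integral>\<^sup>+N. ennreal (w N / Z) \<partial>count_space UNIV) = 1" by simp
qed

abbreviation E :: "(nat \<Rightarrow> real) \<Rightarrow> real" where "E f \<equiv> measure_pmf.expectation q f"

lemma AE_q: "(\<And>N. w N \<noteq> 0 \<Longrightarrow> P N) \<Longrightarrow> AE N in measure_pmf q. P N"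
  using Z_ge_1 by (auto simp: AE_measure_pmf_iff set_pmf_iff pmf_q)

lemma E_cong: "(\<And>N. w N \<noteq> 0 \<Longrightarrow> f N = g N) \<Longrightarrow> E f = E g"
  by (intro integral_cong_AE AE_q) auto

text \<open>The single integrability criterion for unbounded functions: the three moment bounds for
  the truncated weights allow domination by a quadratic polynomial in \<open>ln N\<close>.\<close>

lemma integrable_q:
  assumes "\<And>N. w N \<noteq> 0 \<Longrightarrow> \<bar>f N\<bar> \<le> a + b * ln (real N) + c * ln (real N) ^ 2"
  shows "integrable (measure_pmf q) f"
proof -
  have "integrable (count_space UNIV) (\<lambda>N. pmf q N * f N)"
    unfolding integrable_count_space_nat_iff
  proof (rule summable_comparison_test')
    show "summable (\<lambda>N. (w N * a + (w N * ln (real N)) * b + (w N * ln (real N) ^ 2) * c) / Z)"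
      by (intro summable_divide summable_add summable_mult2 summable_w summable_w_ln summable_w_ln_square)
    show "norm (norm (pmf q N * f N)) \<le> (w N * a + w N * ln (real N) * b + w N * ln (real N) ^ 2 * c) / Z" if "N \<ge> 0" for N
    proof (cases "w N = 0")
      case False
      then have "w N * \<bar>f N\<bar> \<le> w N * (a + b * ln (real N) + c * ln (real N) ^ 2)"
        by (intro mult_left_mono assms w_nonneg)
      then show ?thesis using Z_ge_1 w_nonneg[of N]
        by (simp add: pmf_q abs_mult divide_right_mono algebra_simps)
    qed (simp add: pmf_q)
  qed
  then show ?thesis
    unfolding measure_pmf_eq_density by (subst integrable_density) auto
qed

lemma E_eq_suminf:
  assumes "integrable (measure_pmf q) f"
  shows "E f = (\<Sum>N. w N / Z * f N)" "summable (\<lambda>N. w N / Z * f N)"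
proof -
  have i: "integrable (count_space UNIV) (\<lambda>N. pmf q N * f N)"
    using assms unfolding measure_pmf_eq_density by (subst (asm) integrable_density) auto
  have "E f = (\<integral>N. pmf q N * f N \<partial>count_space UNIV)"
    unfolding measure_pmf_eq_density by (subst integral_density) auto
  also have "\<dots> = (\<Sum>N. pmf q N * f N)" by (rule integral_count_space_nat[OF i])
  finally show "E f = (\<Sum>N. w N / Z * f N)" by (simp add: pmf_q)
  show "summable (\<lambda>N. w N / Z * f N)"
    using i[unfolded integrable_count_space_nat_iff, THEN summable_norm_cancel] by (simp add: pmf_q)
qed

lemma val_le_ln:
  assumes "p \<in> PP" "w N \<noteq> 0" shows "val p N \<le> 2 * ln (real N)"
proof -
  have p2: "real p \<ge> 2" using PP(3) assms by blast
  have "1/2 \<le> ln (2::real)" using ln_le_minus_one[of "1/2::real"] by (simp add: ln_div)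
  also have "ln 2 \<le> ln (real p)" using p2 by (subst ln_le_cancel_iff) auto
  finally have "1/2 * val p N \<le> ln (real p) * val p N" by (intro mult_right_mono) auto
  also have "\<dots> \<le> ln (real N)"
    unfolding ln_eq_sum_val[OF assms(2)]
    by (rule member_le_sum[OF assms(1)]) (auto intro!: mult_nonneg_nonneg simp: PP)
  finally show ?thesis by simp
qed

lemma integrable_bounded: fixes f :: "nat \<Rightarrow> real" shows "(\<And>N. \<bar>f N\<bar> \<le> 1) \<Longrightarrow> integrable (measure_pmf q) f"
  by (rule integrable_q[of _ 1 0 0]) auto

lemma integrable_val:
  fixes f :: "nat \<Rightarrow> real"
  assumes "p \<in> PP" "\<And>N. \<bar>f N\<bar> \<le> 1"
  shows "integrable (measure_pmf q) (\<lambda>N. val p N * f N)"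
proof (rule integrable_q[of _ 0 2 0])
  fix N assume "w N \<noteq> 0"
  have "\<bar>val p N * f N\<bar> \<le> val p N * 1"
    unfolding abs_mult using assms(2) by (intro mult_mono) auto
  then show "\<bar>val p N * f N\<bar> \<le> 0 + 2 * ln (real N) + 0 * ln (real N) ^ 2"
    using val_le_ln[OF assms(1) \<open>w N \<noteq> 0\<close>] by simp
qed

lemma integrable_val_ln:
  assumes "p \<in> PP" shows "integrable (measure_pmf q) (\<lambda>N. val p N * ln (real N))"
proof (rule integrable_q[of _ 0 0 2])
  fix N assume "w N \<noteq> 0"
  then show "\<bar>val p N * ln (real N)\<bar> \<le> 0 + 0 * ln (real N) + 2 * ln (real N) ^ 2"
    using mult_right_mono[OF val_le_ln[OF assms, of N], of "ln (real N)"]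
    by (simp add: power2_eq_square mult.assoc abs_mult)
qed

lemma integrable_ln: "integrable (measure_pmf q) (\<lambda>N. ln (real N))"
  by (rule integrable_q[of _ 0 1 0]) auto

text \<open>Valuations vanish off the multiples of \<open>p\<close>, and \<open>w_rec\<close>
  transports the weight from \<open>p * m\<close> to \<open>m\<close>. This plays the role of a
  size-bias identity for the valuation at \<open>p\<close>.\<close>

lemma E_val_rec:
  assumes p: "p \<in> PP"
    and i1: "integrable (measure_pmf q) (\<lambda>N. val p N * k N)"
    and i2: "integrable (measure_pmf q) (\<lambda>N. k (p * N))"
    and i3: "integrable (measure_pmf q) (\<lambda>N. val p N * k (p * N))"
  shows "E (\<lambda>N. val p N * k N) = (\<theta> * E (\<lambda>N. k (p * N)) + \<kappa> * E (\<lambda>N. val p N * k (p * N))) / real p"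
proof -
  have p': "prime p" "p \<le> y" "p > 0" using PP(1,2)[OF p] prime_gt_0_nat by auto
  have "E (\<lambda>N. val p N * k N) = (\<Sum>N. w N / Z * (val p N * k N))"
    by (rule E_eq_suminf[OF i1])
  also have "\<dots> = (\<Sum>m. w (p * m) / Z * (val p (p * m) * k (p * m)))"
  proof (rule suminf_mono_reindex[symmetric])
    show "strict_mono ((*) p)" using p' by (simp add: strict_mono_def)
    show "w N / Z * (val p N * k N) = 0" if "N \<notin> range ((*) p)" for N
      using that by (auto simp: dvd_def image_iff not_dvd_imp_multiplicity_0)
  qed
  also have "\<dots> = (\<Sum>m. w m / Z * ((\<theta> * k (p * m) + \<kappa> * (val p m * k (p * m))) / real p))"
  proof (rule suminf_cong)
    fix m
    show "w (p * m) / Z * (val p (p * m) * k (p * m))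
        = w m / Z * ((\<theta> * k (p * m) + \<kappa> * (val p m * k (p * m))) / real p)"
    proof (cases "m = 0")
      case False
      then have "w (p * m) * val p (p * m) = w m * (\<theta> + \<kappa> * val p m) / real p"
        using w_rec[OF p'(1,2), of m] by (simp add: val_mult_self p')
      then have "w (p * m) * val p (p * m) * (k (p * m) / Z) = w m * (\<theta> + \<kappa> * val p m) / real p * (k (p * m) / Z)"
        by simp
      then show ?thesis by (simp add: algebra_simps add_divide_distrib)
    qed (simp add: w_0)
  qed
  also have "\<dots> = E (\<lambda>N. (\<theta> * k (p * N) + \<kappa> * (val p N * k (p * N))) / real p)"
    by (rule E_eq_suminf(1)[symmetric]) (intro integrable_divide Bochner_Integration.integrable_add integrable_mult_right i2 i3)
  also have "\<dots> = (\<theta> * E (\<lambda>N. k (p * N)) + \<kappa> * E (\<lambda>N. val p N * k (p * N))) / real p"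
    using i2 i3 by simp
  finally show ?thesis .
qed

lemma E_mono: "integrable (measure_pmf q) f \<Longrightarrow> integrable (measure_pmf q) g \<Longrightarrow>
    (\<And>N. w N \<noteq> 0 \<Longrightarrow> f N \<le> g N) \<Longrightarrow> E f \<le> E g"
  by (intro integral_mono_AE AE_q) auto

lemma E_nonneg: "(\<And>N. w N \<noteq> 0 \<Longrightarrow> 0 \<le> f N) \<Longrightarrow> 0 \<le> E f"
  by (intro integral_nonneg_AE AE_q) auto

text \<open>For antimonotone \<open>k\<close> the \<open>\<kappa>\<close> term on the right is at
  most \<open>E (val p N * k N)\<close> itself and can be absorbed; inserting the resulting bound
  shows that it contributes only a multiple of \<open>E k / p^2\<close>. Keeping the factor
  \<open>E k\<close> is what later makes the error proportional to \<open>F t\<close>.\<close>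

lemma E_val_antimono:
  assumes p: "p \<in> PP" and k: "\<And>N. 0 \<le> k N" "\<And>N. k N \<le> 1"
    and anti: "\<And>N. N > 0 \<Longrightarrow> k (p * N) \<le> k N"
  shows "E (\<lambda>N. val p N * k N) \<le> \<theta> / (real p - 1) * E k"
    and "\<bar>E (\<lambda>N. val p N * k N) - \<theta> / real p * E (\<lambda>N. k (p * N))\<bar>
           \<le> (1 + \<theta>) * \<theta> / (real p * (real p - 1)) * E k"
proof -
  have p2: "real p \<ge> 2" using PP(3)[OF p] .
  have int: "integrable (measure_pmf q) k" "integrable (measure_pmf q) (\<lambda>N. k (p * N))"
    "integrable (measure_pmf q) (\<lambda>N. val p N * k N)" "integrable (measure_pmf q) (\<lambda>N. val p N * k (p * N))"
    by (intro integrable_bounded integrable_val p; use k in \<open>auto simp: abs_le_iff intro: order_trans[OF _ k(1)]\<close>)+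
  have rec: "E (\<lambda>N. val p N * k N) = (\<theta> * E (\<lambda>N. k (p * N)) + \<kappa> * E (\<lambda>N. val p N * k (p * N))) / real p"
    by (rule E_val_rec[OF p]) (fact int)+
  have le1: "E (\<lambda>N. k (p * N)) \<le> E k"
    by (rule E_mono[OF int(2,1)]) (auto intro!: anti w_pos_imp)
  have le2: "E (\<lambda>N. val p N * k (p * N)) \<le> E (\<lambda>N. val p N * k N)"
    by (rule E_mono[OF int(4,3)]) (auto intro!: anti w_pos_imp mult_left_mono)
  have nn: "0 \<le> E (\<lambda>N. val p N * k (p * N))" "0 \<le> E k"
    by (intro E_nonneg mult_nonneg_nonneg k; simp)+
  have "\<theta> * E (\<lambda>N. k (p * N)) \<le> \<theta> * E k" using le1 theta by simp
  moreover have "\<kappa> * E (\<lambda>N. val p N * k (p * N)) \<le> 1 * E (\<lambda>N. val p N * k N)"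
    by (rule order_trans[OF mult_right_mono[OF kappa(1) nn(1)]]) (use le2 in simp)
  ultimately have "real p * E (\<lambda>N. val p N * k N) \<le> \<theta> * E k + E (\<lambda>N. val p N * k N)"
    using rec p2 by (simp add: field_simps)
  then show first: "E (\<lambda>N. val p N * k N) \<le> \<theta> / (real p - 1) * E k"
    using p2 by (simp add: field_simps)
  have "\<bar>\<kappa>\<bar> \<le> 1 + \<theta>" using kappa theta by linarith
  then have "\<bar>\<kappa>\<bar> * E (\<lambda>N. val p N * k (p * N)) \<le> (1 + \<theta>) * (\<theta> / (real p - 1) * E k)"
    using nn theta first le2 by (intro mult_mono) auto
  then have "\<bar>\<kappa>\<bar> * E (\<lambda>N. val p N * k (p * N)) / real p \<le> (1 + \<theta>) * (\<theta> / (real p - 1) * E k) / real p"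
    using p2 by (intro divide_right_mono) auto
  moreover have "E (\<lambda>N. val p N * k N) - \<theta> / real p * E (\<lambda>N. k (p * N)) = \<kappa> * E (\<lambda>N. val p N * k (p * N)) / real p"
    by (simp add: rec add_divide_distrib)
  ultimately show "\<bar>E (\<lambda>N. val p N * k N) - \<theta> / real p * E (\<lambda>N. k (p * N))\<bar>
           \<le> (1 + \<theta>) * \<theta> / (real p * (real p - 1)) * E k"
    using p2 nn by (simp add: abs_mult field_simps)
qed

section \<open>The rescaled logarithm and its partial means\<close>

definition "L = ln (real y)"

lemma L_ge: "L \<ge> ln 2" "L > 0"
proof -
  show "L \<ge> ln 2" unfolding L_def using y by (subst ln_le_cancel_iff) auto
  moreover have "ln 2 > (0::real)" by simp
  ultimately show "L > 0" by linarith
qed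

definition X :: "nat \<Rightarrow> real" where "X N = ln (real N) / L"

lemma X_nonneg: "X N \<ge> 0" using L_ge by (simp add: X_def)

lemma X_mult: "p > 0 \<Longrightarrow> N > 0 \<Longrightarrow> X (p * N) = X N + ln (real p) / L"
  by (simp add: X_def ln_mult add_divide_distrib)

lemma E_X_mult:
  assumes "\<And>N. 0 \<le> k N" "\<And>N. k N \<le> 1"
  shows "E (\<lambda>N. X N * k N) = (\<Sum>p\<in>PP. ln (real p) / L * E (\<lambda>N. val p N * k N))"
proof -
  have "E (\<lambda>N. X N * k N) = E (\<lambda>N. \<Sum>p\<in>PP. ln (real p) / L * (val p N * k N))"
  proof (rule E_cong)
    fix N assume "w N \<noteq> 0"
    then show "X N * k N = (\<Sum>p\<in>PP. ln (real p) / L * (val p N * k N))"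
      by (simp add: X_def ln_eq_sum_val sum_divide_distrib sum_distrib_right sum_distrib_left mult_ac)
  qed
  also have "\<dots> = (\<Sum>p\<in>PP. E (\<lambda>N. ln (real p) / L * (val p N * k N)))"
    using assms by (intro Bochner_Integration.integral_sum integrable_mult_right integrable_val) auto
  finally show ?thesis by simp
qed

text \<open>Mertens' sum in the scale of \<open>X\<close>: it is \<open>v\<close> up to
  \<open>O(1 / L)\<close> on \<open>[0, 1]\<close> and constant beyond 1, where all primes up to
  \<open>y\<close> have been counted.\<close>

definition A1 :: "real \<Rightarrow> real" where
  "A1 v = (\<Sum>p\<in>PP. ln (real p) / (L * real p) * of_bool (ln (real p) / L \<le> v))"

end

text \<open>Adds the three arithmetic inputs with constants that do not involve \<open>y\<close>, so
  that whatever is built from \<open>\<theta>\<close>, \<open>M\<close>, \<open>B\<close> and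
  \<open>C\<close> is uniform in \<open>n\<close>. \<open>M\<close> is the error in Mertens'
  theorem, \<open>B\<close> controls second-order terms in \<open>1 / p\<close>, and
  \<open>C\<close> accompanies the negative second-order term of the averaged sum.\<close>

locale panjer_law = panjer_weight +
  fixes M B C :: real
  assumes M: "M \<ge> 0" "x \<ge> 1 \<Longrightarrow> \<bar>(\<Sum>p | prime p \<and> real p \<le> x. ln (real p) / real p) - ln x\<bar> \<le> M"
    and B: "B \<ge> 0" "(\<Sum>p | prime p \<and> p \<le> n. ln (real p) / (real p * (real p - 1))) \<le> B"
    and C: "C \<ge> 0" "z \<ge> 1 \<Longrightarrow> (\<Sum>d\<in>{1..n}. mangoldt d / real d * (max 0 (ln (z / real d)))\<^sup>2)
     \<le> ln z ^ 3 / 3 - (1 - ln 2) * ln z ^ 2 + C * ln z"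
begin

lemma B_PP: "(\<Sum>p\<in>PP. ln (real p) / (real p * (real p - 1))) \<le> B"
  using B(2)[of y] by (simp add: PP_def)

lemma A1_neg: assumes "v < 0" shows "A1 v = 0"
proof -
  have "\<not> ln (real p) / L \<le> v" for p
    using assms L_ge(2) divide_nonneg_pos[of "ln (real p)" L] ln_of_nat_nonneg[of p] by linarith
  then show ?thesis unfolding A1_def by simp
qed

lemma A1_ge_1: assumes "v \<ge> 1" shows "A1 v = A1 1"
proof -
  have "ln (real p) / L \<le> 1" if "p \<in> PP" for p
    using PP(2,3)[OF that] L_ge by (simp add: L_def)
  then show ?thesis unfolding A1_def using assms by (intro sum.cong) force+
qed

text \<open>Mertens' bound at \<open>exp (v * L)\<close>, divided by \<open>L\<close>; the cut-off
  at 1 reflects \<open>exp L = y\<close>.\<close>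

lemma A1_approx: assumes "v \<ge> 0" shows "\<bar>A1 v - min 1 v\<bar> \<le> M / L"
proof -
  have *: "\<bar>A1 v - v\<bar> \<le> M / L" if v: "0 \<le> v" "v \<le> 1" for v
  proof -
    have eL: "exp L = real y" using y by (simp add: L_def)
    have set: "{p \<in> PP. ln (real p) / L \<le> v} = {p. prime p \<and> real p \<le> exp (v * L)}"
    proof -
      have "ln (real p) / L \<le> v \<longleftrightarrow> real p \<le> exp (v * L)" if "prime p" for p
      proof -
        have "real p > 0" using that prime_gt_0_nat by simp
        then have "real p \<le> exp (v * L) \<longleftrightarrow> ln (real p) \<le> v * L"
          by (metis exp_le_cancel_iff exp_ln)
        then show ?thesis using L_ge by (simp add: field_simps)
      qed
      moreover have "real p \<le> real y" if "real p \<le> exp (v * L)" for p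
      proof -
        have "exp (v * L) \<le> exp L" using v L_ge by (simp add: mult_left_le_one_le)
        then show ?thesis using that eL by simp
      qed
      ultimately show ?thesis by (auto simp: PP_def)
    qed
    have "A1 v = (\<Sum>p\<in>{p \<in> PP. ln (real p) / L \<le> v}. ln (real p) / (L * real p))"
      unfolding A1_def by (rule sum.mono_neutral_cong_right) (auto simp: PP)
    also have "\<dots> = (\<Sum>p | prime p \<and> real p \<le> exp (v * L). ln (real p) / real p) / L"
      unfolding set by (simp add: sum_divide_distrib mult.commute)
    finally have "A1 v - v = ((\<Sum>p | prime p \<and> real p \<le> exp (v * L). ln (real p) / real p) - ln (exp (v * L))) / L"
      using L_ge by (simp add: field_simps)
    then show ?thesis
      using M(2)[of "exp (v * L)"] v L_ge by (simp add: divide_right_mono)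
  qed
  show ?thesis using *[of v] *[of 1] A1_ge_1[of v] assms by (cases "v \<le> 1") auto
qed

text \<open>Multiplying \<open>N\<close> by \<open>p\<close> adds \<open>ln p / L\<close> to
  \<open>X\<close>, so the shifted indicators summed over \<open>p\<close> produce
  \<open>A1 (t - X N)\<close>.\<close>

lemma E_prime_shift:
  "(\<Sum>p\<in>PP. ln (real p) / L * (\<theta> / real p * E (\<lambda>N. of_bool (X (p * N) \<le> t)))) = \<theta> * E (\<lambda>N. A1 (t - X N))"
proof -
  have "E (\<lambda>N. A1 (t - X N)) = (\<Sum>p\<in>PP. E (\<lambda>N. ln (real p) / (L * real p) * of_bool (ln (real p) / L \<le> t - X N)))"
    unfolding A1_def by (intro Bochner_Integration.integral_sum integrable_mult_right integrable_bounded) auto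
  also have "\<dots> = (\<Sum>p\<in>PP. ln (real p) / (L * real p) * E (\<lambda>N. of_bool (X (p * N) \<le> t)))"
  proof (intro sum.cong refl)
    fix p assume p: "p \<in> PP"
    have "E (\<lambda>N. of_bool (ln (real p) / L \<le> t - X N)) = E (\<lambda>N. of_bool (X (p * N) \<le> t))"
    proof (rule E_cong)
      fix N assume "w N \<noteq> 0"
      then have "X (p * N) = X N + ln (real p) / L"
        using PP(3)[OF p] w_pos_imp[of N] by (intro X_mult) auto
      then show "of_bool (ln (real p) / L \<le> t - X N) = (of_bool (X (p * N) \<le> t) :: real)"
        by (simp add: algebra_simps)
    qed
    then show "E (\<lambda>N. ln (real p) / (L * real p) * of_bool (ln (real p) / L \<le> t - X N))
       = ln (real p) / (L * real p) * E (\<lambda>N. of_bool (X (p * N) \<le> t))" by simp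
  qed
  finally show ?thesis by (simp add: sum_distrib_left mult_ac)
qed

lemma A1_bounds: "0 \<le> A1 v" "A1 v \<le> A1 1"
proof -
  show "0 \<le> A1 v" for v
    unfolding A1_def using L_ge by (intro sum_nonneg) auto
  have "A1 v \<le> A1 (max v 1)"
    unfolding A1_def using L_ge by (intro sum_mono mult_left_mono) auto
  then show "A1 v \<le> A1 1" using A1_ge_1[of "max v 1"] by simp
qed

lemma integrable_A1: "integrable (measure_pmf q) (\<lambda>N. A1 (t - X N))"
  by (rule integrable_q[of _ "A1 1" 0 0]) (use A1_bounds in auto)

text \<open>\<open>X\<close> is expanded over primes and each valuation replaced by
  \<open>\<theta> / p\<close> times a shifted indicator, which costs the \<open>B\<close> term; then
  \<open>A1\<close> is replaced by the truncated linear function, which costs the \<open>M\<close>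
  term. Both costs carry the probability of \<open>X \<le> t\<close>: the indicator is antimonotone,
  and \<open>A1 (t - X)\<close> and its approximation vanish for \<open>X > t\<close>.\<close>

lemma law_lower:
  assumes t: "0 \<le> t"
  shows "\<bar>E (\<lambda>N. X N * of_bool (X N \<le> t)) - \<theta> * E (\<lambda>N. min 1 (max 0 (t - X N)))\<bar>
      \<le> (\<theta> * M + (1 + \<theta>) * \<theta> * B) / L * E (\<lambda>N. of_bool (X N \<le> t))"
proof -
  let ?k = "\<lambda>N. of_bool (X N \<le> t) :: real"
  have k0: "E ?k \<ge> 0" by (intro E_nonneg) simp
  have "\<bar>(\<Sum>p\<in>PP. ln (real p) / L * E (\<lambda>N. val p N * ?k N))
      - (\<Sum>p\<in>PP. ln (real p) / L * (\<theta> / real p * E (\<lambda>N. ?k (p * N))))\<bar>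
     \<le> (\<Sum>p\<in>PP. ln (real p) / L * ((1 + \<theta>) * \<theta> / (real p * (real p - 1)) * E ?k))"
    unfolding sum_subtractf[symmetric] right_diff_distrib[symmetric]
  proof (rule order_trans[OF sum_abs sum_mono])
    fix p assume p: "p \<in> PP"
    have "\<bar>E (\<lambda>N. val p N * ?k N) - \<theta> / real p * E (\<lambda>N. ?k (p * N))\<bar>
         \<le> (1 + \<theta>) * \<theta> / (real p * (real p - 1)) * E ?k"
    proof (rule E_val_antimono(2)[OF p])
      fix N :: nat assume "N > 0"
      then have "X N \<le> X (p * N)" using PP(3)[OF p] L_ge by (subst X_mult) auto
      then show "?k (p * N) \<le> ?k N" by auto
    qed auto
    then show "\<bar>ln (real p) / L * (E (\<lambda>N. val p N * ?k N) - \<theta> / real p * E (\<lambda>N. ?k (p * N)))\<bar>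
       \<le> ln (real p) / L * ((1 + \<theta>) * \<theta> / (real p * (real p - 1)) * E ?k)"
      unfolding abs_mult using L_ge by (intro mult_mono) auto
  qed
  also have "\<dots> = (\<Sum>p\<in>PP. ln (real p) / (real p * (real p - 1))) * ((1 + \<theta>) * \<theta> / L * E ?k)"
    unfolding sum_distrib_right by (intro sum.cong) auto
  also have "\<dots> \<le> B * ((1 + \<theta>) * \<theta> / L * E ?k)"
    using theta L_ge k0 by (intro mult_right_mono B_PP) auto
  finally have 0: "\<bar>(\<Sum>p\<in>PP. ln (real p) / L * E (\<lambda>N. val p N * ?k N))
      - (\<Sum>p\<in>PP. ln (real p) / L * (\<theta> / real p * E (\<lambda>N. ?k (p * N))))\<bar> \<le> B * ((1 + \<theta>) * \<theta> / L * E ?k)" .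
  have 1: "\<bar>E (\<lambda>N. X N * ?k N) - \<theta> * E (\<lambda>N. A1 (t - X N))\<bar> \<le> B * ((1 + \<theta>) * \<theta> / L * E ?k)"
  proof -
    have "E (\<lambda>N. X N * ?k N) = (\<Sum>p\<in>PP. ln (real p) / L * E (\<lambda>N. val p N * ?k N))"
      by (rule E_X_mult) auto
    then show ?thesis using 0 unfolding E_prime_shift by (simp only:)
  qed
  have "\<bar>E (\<lambda>N. A1 (t - X N)) - E (\<lambda>N. min 1 (max 0 (t - X N)))\<bar> \<le> E (\<lambda>N. \<bar>A1 (t - X N) - min 1 (max 0 (t - X N))\<bar>)"
    by (subst Bochner_Integration.integral_diff[symmetric]) (auto intro!: integrable_A1 integrable_bounded)
  also have "\<dots> \<le> E (\<lambda>N. M / L * ?k N)"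
  proof (rule E_mono)
    fix N
    show "\<bar>A1 (t - X N) - min 1 (max 0 (t - X N))\<bar> \<le> M / L * ?k N"
      using A1_approx[of "t - X N"] A1_neg[of "t - X N"] by (cases "X N \<le> t") auto
    show "integrable (measure_pmf q) (\<lambda>N. \<bar>A1 (t - X N) - min 1 (max 0 (t - X N))\<bar>)"
      by (intro integrable_abs Bochner_Integration.integrable_diff integrable_A1 integrable_bounded) auto
    show "integrable (measure_pmf q) (\<lambda>N. M / L * ?k N)"
      by (intro integrable_mult_right integrable_bounded) auto
  qed
  also have "\<dots> = M / L * E ?k" by simp
  finally have "\<theta> * \<bar>E (\<lambda>N. A1 (t - X N)) - E (\<lambda>N. min 1 (max 0 (t - X N)))\<bar> \<le> \<theta> * (M / L * E ?k)"
    using theta by (intro mult_left_mono) auto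
  then have 2: "\<bar>\<theta> * E (\<lambda>N. A1 (t - X N)) - \<theta> * E (\<lambda>N. min 1 (max 0 (t - X N)))\<bar> \<le> \<theta> * (M / L * E ?k)"
    using theta by (simp add: abs_mult flip: right_diff_distrib)
  have "\<bar>E (\<lambda>N. X N * ?k N) - \<theta> * E (\<lambda>N. min 1 (max 0 (t - X N)))\<bar>
     \<le> B * ((1 + \<theta>) * \<theta> / L * E ?k) + \<theta> * (M / L * E ?k)" using 1 2 by linarith
  also have "\<dots> = (\<theta> * M + (1 + \<theta>) * \<theta> * B) / L * E ?k"
    by (simp add: add_divide_distrib algebra_simps)
  finally show ?thesis .
qed


lemma E_val_le: assumes p: "p \<in> PP" shows "E (val p) \<le> \<theta> / (real p - 1)"
  using E_val_antimono(1)[OF p, of "\<lambda>_. 1"] by simp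

text \<open>Bound for the mean of \<open>X\<close>, uniform in \<open>n\<close> because
  \<open>L \<ge> ln 2\<close>.\<close>

definition "m0 = \<theta> * (1 + (M + B) / ln 2)"

lemma integrable_X: "integrable (measure_pmf q) X"
  unfolding X_def by (intro integrable_divide integrable_ln)

lemma E_X_le: "E X \<le> m0"
proof -
  have "E X = E (\<lambda>N. X N * 1)" by simp
  also have "\<dots> = (\<Sum>p\<in>PP. ln (real p) / L * E (\<lambda>N. val p N * 1))" by (rule E_X_mult) auto
  also have "\<dots> \<le> (\<Sum>p\<in>PP. ln (real p) / L * (\<theta> / (real p - 1)))"
    using E_val_le L_ge by (intro sum_mono mult_left_mono) auto
  also have "\<dots> = \<theta> / L * (\<Sum>p\<in>PP. ln (real p) / (real p - 1))"
    unfolding sum_distrib_left by (intro sum.cong) auto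
  also have "(\<Sum>p\<in>PP. ln (real p) / (real p - 1)) \<le> L + M + B"
  proof -
    have "(\<Sum>p\<in>PP. ln (real p) / (real p - 1))
      = (\<Sum>p\<in>PP. ln (real p) / real p) + (\<Sum>p\<in>PP. ln (real p) / (real p * (real p - 1)))"
    unfolding sum.distrib[symmetric]
  proof (intro sum.cong refl)
    fix p assume "p \<in> PP"
    then show "ln (real p) / (real p - 1) = ln (real p) / real p + ln (real p) / (real p * (real p - 1))"
      using PP(3)[of p] by (simp add: field_simps)
  qed
  also have "\<dots> \<le> (L + M) + B"
  proof (rule add_mono[OF _ B_PP])
    show "(\<Sum>p\<in>PP. ln (real p) / real p) \<le> L + M"
      using M(2)[of "real y"] y by (simp add: PP_def L_def)
  qed
  finally show ?thesis .
  qed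
  also have "\<theta> / L * (L + M + B) = \<theta> * (1 + (M + B) / L)"
    using L_ge by (simp add: field_simps)
  also have "\<dots> \<le> m0"
    unfolding m0_def using theta M(1) B(1) L_ge
    by (intro mult_left_mono add_left_mono divide_left_mono) auto
  finally show ?thesis using theta L_ge by (simp add: divide_right_mono mult_left_mono)
qed

lemma m0_pos: "m0 > 0"
  unfolding m0_def using theta M(1) B(1) by (intro mult_pos_pos add_pos_nonneg divide_nonneg_pos) auto

text \<open>The recursion with \<open>k = X\<close> and \<open>X (p * N) = X N + l\<close>, where
  \<open>l \<le> 1\<close>; the term \<open>\<kappa> * E (val p N * X N)\<close> is absorbed on the
  left and turns \<open>p\<close> into \<open>p - 1\<close>.\<close>

lemma E_val_X_le: assumes p: "p \<in> PP" shows "E (\<lambda>N. val p N * X N) \<le> \<theta> * (2 + m0) / (real p - 1)"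
proof -
  have p2: "real p \<ge> 2" using PP(3)[OF p] .
  define l where "l = ln (real p) / L"
  have l: "0 \<le> l" "l \<le> 1"
    using PP(2)[OF p] p2 L_ge by (auto simp: l_def L_def)
  have Xp: "X (p * N) = X N + l" if "w N \<noteq> 0" for N
    using that p2 w_pos_imp[of N] by (simp add: l_def X_mult)
  have iX: "integrable (measure_pmf q) (\<lambda>N. val p N * X N)"
    using integrable_divide[OF integrable_val_ln[OF p], of L] by (simp add: X_def)
  have iv: "integrable (measure_pmf q) (val p)"
    using integrable_val[OF p, of "\<lambda>_. 1"] by simp
  have i2: "integrable (measure_pmf q) (\<lambda>N. X (p * N))"
    and e2: "E (\<lambda>N. X (p * N)) = E X + l"
  proof -
    have "integrable (measure_pmf q) (\<lambda>N. X N + l)"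
      by (intro Bochner_Integration.integrable_add integrable_X) auto
    then show "integrable (measure_pmf q) (\<lambda>N. X (p * N))"
      by (rule integrable_cong_AE_imp) (auto intro!: AE_q simp: Xp)
    have "E (\<lambda>N. X (p * N)) = E (\<lambda>N. X N + l)" by (rule E_cong) (rule Xp)
    then show "E (\<lambda>N. X (p * N)) = E X + l" by (simp add: integrable_X)
  qed
  have i3: "integrable (measure_pmf q) (\<lambda>N. val p N * X (p * N))"
    and e3: "E (\<lambda>N. val p N * X (p * N)) = E (\<lambda>N. val p N * X N) + l * E (val p)"
  proof -
    have i: "integrable (measure_pmf q) (\<lambda>N. val p N * X N + l * val p N)"
      by (intro Bochner_Integration.integrable_add iX integrable_mult_right iv)
    then show "integrable (measure_pmf q) (\<lambda>N. val p N * X (p * N))"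
      by (rule integrable_cong_AE_imp) (auto intro!: AE_q simp: Xp distrib_left mult.commute[of l])
    have "E (\<lambda>N. val p N * X (p * N)) = E (\<lambda>N. val p N * X N + l * val p N)"
      by (rule E_cong) (simp add: Xp distrib_left mult.commute[of l])
    then show "E (\<lambda>N. val p N * X (p * N)) = E (\<lambda>N. val p N * X N) + l * E (val p)"
      using iX iv by simp
  qed
  have nn: "0 \<le> E (\<lambda>N. val p N * X N) + l * E (val p)" "0 \<le> E (val p)"
    using l by (auto intro!: E_nonneg add_nonneg_nonneg mult_nonneg_nonneg X_nonneg)
  have Ev: "E (val p) \<le> \<theta>"
  proof -
    have "\<theta> / (real p - 1) \<le> \<theta> / 1" using p2 theta by (intro divide_left_mono) auto
    then show ?thesis using E_val_le[OF p] by simp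
  qed
  have "real p * E (\<lambda>N. val p N * X N) = \<theta> * (E X + l) + \<kappa> * (E (\<lambda>N. val p N * X N) + l * E (val p))"
    using E_val_rec[OF p iX i2 i3, unfolded e2 e3] p2 by (simp add: eq_divide_eq mult.commute)
  also have "\<dots> \<le> \<theta> * (m0 + 1) + 1 * (E (\<lambda>N. val p N * X N) + 1 * \<theta>)"
    using l Ev nn theta by (intro add_mono mult_left_mono mult_mono E_X_le kappa
        order_trans[OF mult_right_mono[OF kappa(1)]]) auto
  finally show ?thesis using p2 by (simp add: field_simps)
qed

text \<open>Sum of the constants of the lower and the upper partial mean estimates, so that one
  \<open>\<epsilon>\<close> serves both forms of the equation.\<close>

definition "c_eps = \<theta> * M + (1 + \<theta>) * \<theta> * B + (1 + \<theta>) * (\<theta> * (4 + m0)) * B + \<theta> * (2 * M * (2 + m0))"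

text \<open>The indicator of \<open>t < X\<close> is not antimonotone, so the
  \<open>\<kappa>\<close> term is bounded by Markov's inequality instead:
  \<open>t < X (p * N) \<le> X N + 1\<close> gives \<open>1 \<le> (2 + X N) / (1 + t)\<close>. The
  same factor is available when \<open>A1\<close> is replaced, because both complements vanish
  unless \<open>t - X N < 1\<close>.\<close>

lemma law_upper:
  assumes t: "0 \<le> t"
  shows "\<bar>E (\<lambda>N. X N * of_bool (t < X N)) - \<theta> * E (\<lambda>N. 1 - min 1 (max 0 (t - X N)))\<bar>
      \<le> ((1 + \<theta>) * (\<theta> * (4 + m0)) * B + \<theta> * (2 * M * (2 + m0))) / L / (1 + t)"
proof -
  let ?k = "\<lambda>N. of_bool (t < X N) :: real"
  have main: "\<bar>(\<Sum>p\<in>PP. ln (real p) / L * E (\<lambda>N. val p N * ?k N))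
      - (\<Sum>p\<in>PP. ln (real p) / L * (\<theta> / real p * E (\<lambda>N. ?k (p * N))))\<bar>
     \<le> (\<Sum>p\<in>PP. ln (real p) / L * ((1 + \<theta>) * (\<theta> * (4 + m0) / (real p - 1) / (1 + t)) / real p))"
    unfolding sum_subtractf[symmetric] right_diff_distrib[symmetric]
  proof (rule order_trans[OF sum_abs sum_mono])
    fix p assume p: "p \<in> PP"
    have p2: "real p \<ge> 2" using PP(3)[OF p] .
    have rec: "E (\<lambda>N. val p N * ?k N) = (\<theta> * E (\<lambda>N. ?k (p * N)) + \<kappa> * E (\<lambda>N. val p N * ?k (p * N))) / real p"
      by (intro E_val_rec p integrable_val integrable_bounded) auto
    have iX: "integrable (measure_pmf q) (\<lambda>N. val p N * X N)"
      using integrable_divide[OF integrable_val_ln[OF p], of L] by (simp add: X_def)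
    have iv: "integrable (measure_pmf q) (val p)"
      using integrable_val[OF p, of "\<lambda>_. 1"] by simp
    have e: "E (\<lambda>N. val p N * ?k (p * N)) \<le> \<theta> * (4 + m0) / (real p - 1) / (1 + t)"
    proof -
      have "E (\<lambda>N. val p N * ?k (p * N)) \<le> E (\<lambda>N. (2 * val p N + val p N * X N) / (1 + t))"
      proof (rule E_mono)
        fix N assume N: "w N \<noteq> 0"
        have "ln (real p) / L \<le> 1" using PP(2)[OF p] p2 L_ge by (auto simp: L_def)
        then have "X (p * N) \<le> X N + 1" using X_mult[of p N] p2 w_pos_imp[OF N] by simp
        then have "val p N * ?k (p * N) \<le> val p N * ((2 + X N) / (1 + t))"
          using t X_nonneg[of N] by (intro mult_left_mono) (auto simp: field_simps)
        then show "val p N * ?k (p * N) \<le> (2 * val p N + val p N * X N) / (1 + t)"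
          by (simp add: algebra_simps)
      next
        show "integrable (measure_pmf q) (\<lambda>N. val p N * ?k (p * N))" by (intro integrable_val p) auto
        show "integrable (measure_pmf q) (\<lambda>N. (2 * val p N + val p N * X N) / (1 + t))"
          by (intro integrable_divide Bochner_Integration.integrable_add integrable_mult_right iX iv)
      qed
      also have "\<dots> = (2 * E (val p) + E (\<lambda>N. val p N * X N)) / (1 + t)"
        using iX iv by simp
      also have "\<dots> \<le> (2 * (\<theta> / (real p - 1)) + \<theta> * (2 + m0) / (real p - 1)) / (1 + t)"
        using t by (intro divide_right_mono add_mono mult_left_mono E_val_le E_val_X_le p) auto
      also have "2 * (\<theta> / (real p - 1)) + \<theta> * (2 + m0) / (real p - 1) = \<theta> * (4 + m0) / (real p - 1)"
        by (simp add: add_divide_distrib[symmetric] algebra_simps)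
      finally show ?thesis .
    qed
    have nn: "0 \<le> E (\<lambda>N. val p N * ?k (p * N))" by (intro E_nonneg) auto
    have "\<bar>\<kappa>\<bar> \<le> 1 + \<theta>" using kappa theta by linarith
    then have "\<bar>\<kappa>\<bar> * E (\<lambda>N. val p N * ?k (p * N)) \<le> (1 + \<theta>) * (\<theta> * (4 + m0) / (real p - 1) / (1 + t))"
      using nn theta e by (intro mult_mono) auto
    moreover have "E (\<lambda>N. val p N * ?k N) - \<theta> / real p * E (\<lambda>N. ?k (p * N)) = \<kappa> * E (\<lambda>N. val p N * ?k (p * N)) / real p"
      by (simp add: rec add_divide_distrib)
    ultimately have "\<bar>E (\<lambda>N. val p N * ?k N) - \<theta> / real p * E (\<lambda>N. ?k (p * N))\<bar>
        \<le> (1 + \<theta>) * (\<theta> * (4 + m0) / (real p - 1) / (1 + t)) / real p"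
      using p2 nn divide_right_mono[of "\<bar>\<kappa>\<bar> * E (\<lambda>N. val p N * ?k (p * N))" _ "real p"]
      by (simp only: abs_mult abs_divide abs_of_nonneg)
    then show "\<bar>ln (real p) / L * (E (\<lambda>N. val p N * ?k N) - \<theta> / real p * E (\<lambda>N. ?k (p * N)))\<bar>
       \<le> ln (real p) / L * ((1 + \<theta>) * (\<theta> * (4 + m0) / (real p - 1) / (1 + t)) / real p)"
      unfolding abs_mult using L_ge by (intro mult_mono) auto
  qed
  also have "\<dots> = (\<Sum>p\<in>PP. ln (real p) / (real p * (real p - 1))) * ((1 + \<theta>) * (\<theta> * (4 + m0)) / L / (1 + t))"
    unfolding sum_distrib_right by (intro sum.cong) auto
  also have "\<dots> \<le> B * ((1 + \<theta>) * (\<theta> * (4 + m0)) / L / (1 + t))"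
    using theta L_ge t m0_pos by (intro mult_right_mono B_PP) auto
  finally have 0: "\<bar>(\<Sum>p\<in>PP. ln (real p) / L * E (\<lambda>N. val p N * ?k N))
      - (\<Sum>p\<in>PP. ln (real p) / L * (\<theta> / real p * E (\<lambda>N. ?k (p * N))))\<bar>
      \<le> B * ((1 + \<theta>) * (\<theta> * (4 + m0)) / L / (1 + t))" .
  \<comment> \<open>\<open>A1 1\<close> is the full Mertens sum, so complementing the indicator
    complements \<open>A1\<close>.\<close>
  have shift: "(\<Sum>p\<in>PP. ln (real p) / L * (\<theta> / real p * E (\<lambda>N. ?k (p * N)))) = \<theta> * E (\<lambda>N. A1 1 - A1 (t - X N))"
  proof -
    have "E (\<lambda>N. ?k (p * N)) = 1 - E (\<lambda>N. of_bool (X (p * N) \<le> t))" for p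
    proof -
      have "E (\<lambda>N. ?k (p * N)) = E (\<lambda>N. 1 - of_bool (X (p * N) \<le> t))" by (rule E_cong) auto
      also have "\<dots> = 1 - E (\<lambda>N. of_bool (X (p * N) \<le> t))"
        by (subst Bochner_Integration.integral_diff) (auto intro!: integrable_bounded)
      finally show ?thesis .
    qed
    then have "(\<Sum>p\<in>PP. ln (real p) / L * (\<theta> / real p * E (\<lambda>N. ?k (p * N))))
       = (\<Sum>p\<in>PP. ln (real p) / L * (\<theta> / real p)) - \<theta> * E (\<lambda>N. A1 (t - X N))"
      by (simp only: E_prime_shift[symmetric] sum_subtractf[symmetric]) (simp add: algebra_simps)
    also have "(\<Sum>p\<in>PP. ln (real p) / L * (\<theta> / real p)) = \<theta> * A1 1"
    proof -
      have "ln (real p) / L \<le> 1" if "p \<in> PP" for p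
        using PP(2,3)[OF that] L_ge by (simp add: L_def)
      then show ?thesis by (simp add: A1_def sum_distrib_left mult_ac)
    qed
    finally show ?thesis by (simp add: integrable_A1 right_diff_distrib)
  qed
  have 1: "\<bar>E (\<lambda>N. X N * ?k N) - \<theta> * E (\<lambda>N. A1 1 - A1 (t - X N))\<bar> \<le> B * ((1 + \<theta>) * (\<theta> * (4 + m0)) / L / (1 + t))"
  proof -
    have "E (\<lambda>N. X N * ?k N) = (\<Sum>p\<in>PP. ln (real p) / L * E (\<lambda>N. val p N * ?k N))"
      by (rule E_X_mult) auto
    then show ?thesis using 0 unfolding shift by (simp only:)
  qed
  have iA: "integrable (measure_pmf q) (\<lambda>N. A1 1 - A1 (t - X N))"
    by (intro Bochner_Integration.integrable_diff integrable_A1) simp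
  have "\<bar>E (\<lambda>N. A1 1 - A1 (t - X N)) - E (\<lambda>N. 1 - min 1 (max 0 (t - X N)))\<bar>
      \<le> E (\<lambda>N. \<bar>A1 1 - A1 (t - X N) - (1 - min 1 (max 0 (t - X N)))\<bar>)"
    by (subst Bochner_Integration.integral_diff[symmetric]) (auto intro!: iA integrable_bounded)
  also have "\<dots> \<le> E (\<lambda>N. 2 * M / L / (1 + t) * (2 + X N))"
  proof (rule E_mono)
    show "integrable (measure_pmf q) (\<lambda>N. \<bar>A1 1 - A1 (t - X N) - (1 - min 1 (max 0 (t - X N)))\<bar>)"
      by (intro integrable_abs Bochner_Integration.integrable_diff iA integrable_bounded) auto
    show "integrable (measure_pmf q) (\<lambda>N. 2 * M / L / (1 + t) * (2 + X N))"
      by (intro integrable_mult_right Bochner_Integration.integrable_add integrable_X) auto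
    fix N
    have *: "0 \<le> 2 * M / L / (1 + t) * (2 + X N)"
      using M(1) L_ge t X_nonneg[of N] by (intro mult_nonneg_nonneg divide_nonneg_nonneg) auto
    show "\<bar>A1 1 - A1 (t - X N) - (1 - min 1 (max 0 (t - X N)))\<bar> \<le> 2 * M / L / (1 + t) * (2 + X N)"
    proof (cases "t - X N \<ge> 1")
      case True
      then show ?thesis using A1_ge_1[OF True] * by simp
    next
      case False
      have "\<bar>A1 1 - A1 (t - X N) - (1 - min 1 (max 0 (t - X N)))\<bar> \<le> 2 * M / L * 1"
        using A1_approx[of "t - X N"] A1_approx[of 1] A1_neg[of "t - X N"] False
          divide_nonneg_pos[OF M(1) L_ge(2)]
        by (cases "t - X N \<ge> 0") auto
      also have "\<dots> \<le> 2 * M / L * ((2 + X N) / (1 + t))"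
        using False t M(1) L_ge by (intro mult_left_mono) (auto simp: field_simps)
      finally show ?thesis by simp
    qed
  qed
  also have "\<dots> = 2 * M / L / (1 + t) * (2 + E X)"
    using integrable_X by simp
  also have "\<dots> \<le> 2 * M / L / (1 + t) * (2 + m0)"
    using M(1) L_ge t E_X_le by (intro mult_left_mono divide_nonneg_nonneg) auto
  finally have "\<theta> * \<bar>E (\<lambda>N. A1 1 - A1 (t - X N)) - E (\<lambda>N. 1 - min 1 (max 0 (t - X N)))\<bar>
      \<le> \<theta> * (2 * M / L / (1 + t) * (2 + m0))"
    using theta by (intro mult_left_mono) auto
  then have 2: "\<bar>\<theta> * E (\<lambda>N. A1 1 - A1 (t - X N)) - \<theta> * E (\<lambda>N. 1 - min 1 (max 0 (t - X N)))\<bar>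
      \<le> \<theta> * (2 * M / L / (1 + t) * (2 + m0))"
    using theta abs_mult[of \<theta>] unfolding right_diff_distrib[symmetric] by simp
  have "\<bar>E (\<lambda>N. X N * ?k N) - \<theta> * E (\<lambda>N. 1 - min 1 (max 0 (t - X N)))\<bar>
     \<le> B * ((1 + \<theta>) * (\<theta> * (4 + m0)) / L / (1 + t)) + \<theta> * (2 * M / L / (1 + t) * (2 + m0))"
    using 1 2 by linarith
  also have "\<dots> = ((1 + \<theta>) * (\<theta> * (4 + m0)) * B + \<theta> * (2 * M * (2 + m0))) / L / (1 + t)"
    by (simp add: add_divide_distrib mult_ac)
  finally show ?thesis .
qed

end

section \<open>A one-sided second-order estimate, and the atom at 0\<close>

context panjer_law
begin

definition U :: "nat \<Rightarrow> real" where "U N = max 0 (1 - X N)"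

lemma U_bounds: "0 \<le> U N" "U N \<le> 1"
  using X_nonneg[of N] by (auto simp: U_def)

lemma U_power_bounds: "0 \<le> U N ^ k" "U N ^ k \<le> 1"
  using U_bounds[of N] by (auto intro: power_le_one)

lemma U_eq_0: assumes "N \<ge> y" shows "U N = 0"
proof -
  have "L \<le> ln (real N)" unfolding L_def using assms y by simp
  then show ?thesis using L_ge by (simp add: U_def X_def field_simps)
qed

text \<open>Since \<open>\<kappa> \<le> 1\<close>, the recursion bounds the expectation with
  \<open>U (p ^ j * N)\<close> by the ones with \<open>p ^ (j + 1)\<close>. Unrolling collects all
  powers of \<open>p\<close> and ends because \<open>U\<close> vanishes from \<open>y\<close> on.
  The powers are what turns the sum over primes into a sum against \<open>mangoldt\<close>.\<close>

lemma E_val_U_square_le: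
  assumes p: "p \<in> PP"
  shows "E (\<lambda>N. val p N * U N ^ 2) \<le> \<theta> * (\<Sum>j | 1 \<le> j \<and> p ^ j \<le> y. E (\<lambda>N. U (p ^ j * N) ^ 2) / real (p ^ j))"
proof -
  define g where "g j = E (\<lambda>N. U (p ^ j * N) ^ 2)" for j
  define h where "h j = E (\<lambda>N. val p N * U (p ^ j * N) ^ 2)" for j
  have p2: "real p \<ge> 2" using PP(3)[OF p] .
  have abs1: "\<bar>U N ^ 2\<bar> \<le> 1" for N using U_power_bounds[of N 2] by simp
  have h_nonneg: "h j \<ge> 0" for j unfolding h_def by (intro E_nonneg) simp
  have step: "h j \<le> (\<theta> * g (Suc j) + h (Suc j)) / real p" for j
  proof -
    have eq: "p ^ j * (p * N) = p ^ Suc j * N" for N by simp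
    have "h j = (\<theta> * g (Suc j) + \<kappa> * h (Suc j)) / real p"
      unfolding h_def g_def
      by (rule E_val_rec[OF p, of "\<lambda>N. U (p ^ j * N) ^ 2", unfolded eq];
          intro integrable_val integrable_bounded p abs1)
    also have "\<dots> \<le> (\<theta> * g (Suc j) + 1 * h (Suc j)) / real p"
      using p2 by (intro divide_right_mono add_left_mono mult_right_mono kappa h_nonneg) auto
    finally show ?thesis by simp
  qed
  have iter: "h 0 \<le> \<theta> * (\<Sum>j\<in>{1..n}. g j / real p ^ j) + h n / real p ^ n" for n
  proof (induction n)
    case (Suc n)
    have "h n / real p ^ n \<le> (\<theta> * g (Suc n) + h (Suc n)) / real p / real p ^ n"
      using p2 by (intro divide_right_mono step) auto
    also have "\<dots> = \<theta> * (g (Suc n) / real p ^ Suc n) + h (Suc n) / real p ^ Suc n"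
      by (simp add: add_divide_distrib)
    finally show ?case using Suc.IH by (simp add: distrib_left)
  qed simp
  have expt: "j < p ^ j" for j using p2 by (intro power_gt_expt) auto
  have g0: "g j = 0" if "y < p ^ j" for j
  proof -
    have "g j = E (\<lambda>N. 0)" unfolding g_def
    proof (rule E_cong)
      fix N assume "w N \<noteq> 0"
      then have "p ^ j * 1 \<le> p ^ j * N" using w_pos_imp[of N] by (intro mult_le_mono) auto
      then have "y \<le> p ^ j * N" using that by linarith
      then show "U (p ^ j * N) ^ 2 = 0" by (simp add: U_eq_0)
    qed
    then show ?thesis by simp
  qed
  \<comment> \<open>\<open>y\<close> iterations are enough to remove the remainder, as
    \<open>y < p ^ y\<close>.\<close>
  have "h y = E (\<lambda>N. 0)" unfolding h_def
  proof (rule E_cong)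
    fix N assume "w N \<noteq> 0"
    then have "p ^ y * 1 \<le> p ^ y * N" using w_pos_imp[of N] by (intro mult_le_mono) auto
    then have "y \<le> p ^ y * N" using expt[of y] by linarith
    then show "val p N * U (p ^ y * N) ^ 2 = 0" by (simp add: U_eq_0)
  qed
  then have "h 0 \<le> \<theta> * (\<Sum>j\<in>{1..y}. g j / real p ^ j)" using iter[of y] by simp
  also have "(\<Sum>j\<in>{1..y}. g j / real p ^ j) = (\<Sum>j | 1 \<le> j \<and> p ^ j \<le> y. g j / real p ^ j)"
  proof (rule sum.mono_neutral_right)
    show "{j. 1 \<le> j \<and> p ^ j \<le> y} \<subseteq> {1..y}"
    proof
      fix j assume "j \<in> {j. 1 \<le> j \<and> p ^ j \<le> y}"
      then show "j \<in> {1..y}" using expt[of j] by simp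
    qed
    show "\<forall>j\<in>{1..y} - {j. 1 \<le> j \<and> p ^ j \<le> y}. g j / real p ^ j = 0"
    proof
      fix j assume "j \<in> {1..y} - {j. 1 \<le> j \<and> p ^ j \<le> y}"
      then have "y < p ^ j" by auto
      then show "g j / real p ^ j = 0" by (simp add: g0)
    qed
  qed simp
  finally show ?thesis by (simp add: h_def g_def)
qed

text \<open>With \<open>z = y / N\<close> one has \<open>L * U (d * N) = max 0 (ln (z / d))\<close>,
  so the averaged bound applies at \<open>z\<close>; for \<open>z < 1\<close> both sides are
  0.\<close>

lemma sum_mangoldt_U_le:
  assumes N: "w N \<noteq> 0"
  shows "(\<Sum>d\<in>{1..y}. mangoldt d / real d * U (d * N) ^ 2)
     \<le> L * (U N ^ 3 / 3) - (1 - ln 2) * U N ^ 2 + C / L * U N"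
proof -
  have N0: "N > 0" using w_pos_imp[OF N] .
  define z where "z = real y / real N"
  have z0: "z > 0" using N0 y by (simp add: z_def)
  have Ud: "U (d * N) = max 0 (ln (z / real d)) / L" if "d \<in> {1..y}" for d
  proof -
    have "1 - X (d * N) = ln (z / real d) / L"
      using that N0 y L_ge by (simp add: X_def z_def L_def ln_mult ln_div field_simps)
    then show ?thesis using L_ge by (simp add: U_def max_def divide_le_0_iff zero_le_divide_iff)
  qed
  have UN: "U N = max 0 (ln z) / L"
    using Ud[of 1] y by simp
  have S: "(\<Sum>d\<in>{1..y}. mangoldt d / real d * U (d * N) ^ 2)
      = (\<Sum>d\<in>{1..y}. mangoldt d / real d * (max 0 (ln (z / real d)))\<^sup>2) / L\<^sup>2"
    unfolding sum_divide_distrib by (intro sum.cong refl) (simp add: Ud power_divide)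
  show ?thesis
  proof (cases "z \<ge> 1")
    case True
    then have UL: "ln z = U N * L" using UN L_ge by simp
    have "(\<Sum>d\<in>{1..y}. mangoldt d / real d * U (d * N) ^ 2)
      \<le> (ln z ^ 3 / 3 - (1 - ln 2) * ln z ^ 2 + C * ln z) / L\<^sup>2"
      unfolding S by (intro divide_right_mono C(2) True) auto
    also have "\<dots> = L * (U N ^ 3 / 3) - (1 - ln 2) * U N ^ 2 + C / L * U N"
      unfolding UL using L_ge by (simp add: field_simps power2_eq_square power3_eq_cube)
    finally show ?thesis .
  next
    case False
    have "ln (z / real d) \<le> 0" if "d \<in> {1..y}" for d
    proof -
      have "z / real d \<le> 1" using False that z0 by (simp add: pos_divide_le_eq)
      then show ?thesis using z0 that by simp
    qed
    then have "(\<Sum>d\<in>{1..y}. mangoldt d / real d * U (d * N) ^ 2) = 0"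
      by (intro sum.neutral) (auto simp: Ud)
    moreover have "U N = 0" using UN False z0 by simp
    ultimately show ?thesis by simp
  qed
qed

text \<open>For the Dickman law the left side equals the first term on the right, so the negative
  term of order \<open>1 / L\<close> forces a discrepancy of that order.\<close>

lemma law_test:
  "E (\<lambda>N. X N * U N ^ 2) \<le> \<theta> * E (\<lambda>N. U N ^ 3 / 3) - \<theta> * (1 - ln 2) / L * E (\<lambda>N. U N ^ 2) + \<theta> * C / L ^ 2"
proof -
  have abs1: "\<bar>U N ^ k\<bar> \<le> 1" for N k using U_power_bounds[of N k] by simp
  have iU: "integrable (measure_pmf q) (\<lambda>N. U N ^ k)" for k by (rule integrable_bounded[OF abs1])
  have iU1: "integrable (measure_pmf q) U" using iU[of 1] by simp
  have "E (\<lambda>N. X N * U N ^ 2) = (\<Sum>p\<in>PP. ln (real p) / L * E (\<lambda>N. val p N * U N ^ 2))"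
    by (rule E_X_mult) (use U_power_bounds in auto)
  also have "\<dots> \<le> (\<Sum>p\<in>PP. ln (real p) / L *
      (\<theta> * (\<Sum>j | 1 \<le> j \<and> p ^ j \<le> y. E (\<lambda>N. U (p ^ j * N) ^ 2) / real (p ^ j))))"
    using L_ge by (intro sum_mono mult_left_mono E_val_U_square_le) auto
  also have "\<dots> = \<theta> / L * (\<Sum>p | prime p \<and> p \<le> y. ln (real p) *
      (\<Sum>j | 1 \<le> j \<and> p ^ j \<le> y. E (\<lambda>N. U (p ^ j * N) ^ 2) / real (p ^ j)))"
    unfolding sum_distrib_left[of "\<theta> / L"] PP_def by (intro sum.cong) auto
  also have "\<dots> = \<theta> / L * (\<Sum>d\<in>{1..y}. mangoldt d * (E (\<lambda>N. U (d * N) ^ 2) / real d))"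
    by (simp only: sum_mangoldt_eq_sum_primes)
  also have "(\<Sum>d\<in>{1..y}. mangoldt d * (E (\<lambda>N. U (d * N) ^ 2) / real d))
      = E (\<lambda>N. \<Sum>d\<in>{1..y}. mangoldt d / real d * U (d * N) ^ 2)"
    by (subst Bochner_Integration.integral_sum) (intro integrable_mult_right integrable_bounded abs1, simp)
  also have "\<dots> \<le> E (\<lambda>N. L * (U N ^ 3 / 3) - (1 - ln 2) * U N ^ 2 + C / L * U N)"
  proof (rule E_mono)
    show "integrable (measure_pmf q) (\<lambda>N. \<Sum>d\<in>{1..y}. mangoldt d / real d * U (d * N) ^ 2)"
      by (intro Bochner_Integration.integrable_sum integrable_mult_right integrable_bounded abs1)
    show "integrable (measure_pmf q) (\<lambda>N. L * (U N ^ 3 / 3) - (1 - ln 2) * U N ^ 2 + C / L * U N)"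
      by (intro Bochner_Integration.integrable_add Bochner_Integration.integrable_diff
          integrable_mult_right integrable_divide iU iU1)
  qed (rule sum_mangoldt_U_le)
  also have "\<dots> = L * E (\<lambda>N. U N ^ 3 / 3) - (1 - ln 2) * E (\<lambda>N. U N ^ 2) + C / L * E U"
    using iU iU1 by simp
  also have "\<dots> \<le> L * E (\<lambda>N. U N ^ 3 / 3) - (1 - ln 2) * E (\<lambda>N. U N ^ 2) + C / L * 1"
  proof -
    have "E U \<le> E (\<lambda>N. 1)" by (intro E_mono iU1) (use U_bounds in auto)
    then show ?thesis using C(1) L_ge by (intro add_left_mono mult_left_mono) auto
  qed
  finally have "E (\<lambda>N. X N * U N ^ 2) \<le> \<theta> / L * (L * E (\<lambda>N. U N ^ 3 / 3) - (1 - ln 2) * E (\<lambda>N. U N ^ 2) + C / L * 1)"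
    using theta L_ge by (simp add: divide_right_mono mult_left_mono)
  also have "\<dots> = \<theta> * E (\<lambda>N. U N ^ 3 / 3) - \<theta> * (1 - ln 2) / L * E (\<lambda>N. U N ^ 2) + \<theta> * C / L ^ 2"
    using L_ge by (simp add: field_simps power2_eq_square)
  finally show ?thesis .
qed

text \<open>As \<open>w 1 = 1\<close>, each \<open>N\<close> has at most \<open>c N\<close> times
  the probability of the integer 1, the only one of positive weight with
  \<open>X = 0\<close>.\<close>

lemma atom_lower:
  fixes K :: nat
  assumes K: "\<And>N. w N \<le> c N" "\<And>N. 0 \<le> c N"
  shows "E (\<lambda>N. of_bool (real N \<le> real K)) \<le> (\<Sum>N\<in>{1..K}. c N) * E (\<lambda>N. of_bool (X N \<le> 0))"
proof -
  have E0: "E (\<lambda>N. of_bool (X N \<le> 0)) = 1 / Z"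
  proof -
    have "E (\<lambda>N. of_bool (X N \<le> 0)) = (\<Sum>N. w N / Z * of_bool (X N \<le> 0))"
      by (intro E_eq_suminf integrable_bounded) auto
    also have "\<dots> = (\<Sum>N\<in>{1}. w N / Z * of_bool (X N \<le> 0))"
    proof (rule suminf_finite)
      fix N :: nat assume "N \<notin> {1}"
      then have "N = 0 \<or> N \<ge> 2" by auto
      then show "w N / Z * of_bool (X N \<le> 0) = 0"
        using w_0 L_ge by (auto simp: X_def divide_le_0_iff not_le)
    qed simp
    also have "\<dots> = 1 / Z" using w_1 by (simp add: X_def)
    finally show ?thesis .
  qed
  have "E (\<lambda>N. of_bool (real N \<le> real K)) = (\<Sum>N. w N / Z * of_bool (real N \<le> real K))"
    by (intro E_eq_suminf integrable_bounded) auto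
  also have "\<dots> = (\<Sum>N\<in>{1..K}. w N / Z * of_bool (real N \<le> real K))"
    by (rule suminf_finite) (auto simp: w_0 not_le Suc_le_eq)
  also have "\<dots> \<le> (\<Sum>N\<in>{1..K}. c N / Z)"
    using Z_ge_1 K by (intro sum_mono) (auto simp: divide_right_mono)
  finally show ?thesis by (simp add: E0 sum_divide_distrib)
qed

lemma atom_pos: "E (\<lambda>N. of_bool (X N \<le> 0)) > 0"
proof -
  have "E (\<lambda>N. of_bool (X N \<le> 0)) \<ge> E (\<lambda>N. of_bool (N = 1))"
    by (intro E_mono integrable_bounded) (auto simp: X_def)
  moreover have "E (\<lambda>N. of_bool (N = 1)) = 1 / Z"
  proof -
    have "E (\<lambda>N. of_bool (N = 1)) = (\<Sum>N. w N / Z * of_bool (N = 1))"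
      by (intro E_eq_suminf integrable_bounded) auto
    also have "\<dots> = (\<Sum>N\<in>{1}. w N / Z * of_bool (N = 1))"
      by (rule suminf_finite) auto
    also have "\<dots> = 1 / Z" using w_1 by simp
    finally show ?thesis .
  qed
  moreover have "1 / Z > 0" using Z_ge_1 by simp
  ultimately show ?thesis by linarith
qed

end

section \<open>Laws on the half-line and the generalized Dickman law\<close>

locale nonneg_law = prob_space \<nu> for \<nu> :: "real measure" +
  assumes sets_borel [simp, measurable_cong]: "sets \<nu> = sets borel"
    and nonneg: "AE x in \<nu>. 0 \<le> x"
    and integrable_id: "integrable \<nu> (\<lambda>x. x)"
begin

definition cdf0 :: "real \<Rightarrow> real" where "cdf0 t = measure \<nu> {..t}"
definition stop :: "real \<Rightarrow> real" where "stop t = (\<integral>x. max 0 (t - x) \<partial>\<nu>)"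
definition mean :: real where "mean = (\<integral>x. x \<partial>\<nu>)"

lemma space_eq [simp]: "space \<nu> = UNIV"
  using sets_eq_imp_space_eq[OF sets_borel] by simp

lemma integrable_stop: "integrable \<nu> (\<lambda>x. max 0 (t - x))"
  by (intro integrable_max Bochner_Integration.integrable_diff integrable_id) auto

lemma integrable_indicator_atMost: "integrable \<nu> (indicat_real {..u})"
  by (rule integrable_real_indicator) (auto simp: emeasure_eq_measure)

lemma cdf0_eq: "cdf0 t = (\<integral>x. of_bool (x \<le> t) \<partial>\<nu>)"
proof -
  have "(\<integral>x. of_bool (x \<le> t) \<partial>\<nu>) = (\<integral>x. indicat_real {..t} x \<partial>\<nu>)"
    by (intro Bochner_Integration.integral_cong) (auto simp: indicator_def)
  then show ?thesis by (simp add: cdf0_def)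
qed

text \<open>The increment of the positive part of \<open>t - x\<close> lies between two indicators
  times \<open>t - s\<close>. This yields both the Lipschitz continuity and the right derivative of
  \<open>stop\<close>.\<close>

lemma stop_diff_bounds:
  assumes "s \<le> t"
  shows "cdf0 s * (t - s) \<le> stop t - stop s" "stop t - stop s \<le> cdf0 t * (t - s)"
proof -
  have eq: "stop t - stop s = (\<integral>x. max 0 (t - x) - max 0 (s - x) \<partial>\<nu>)"
    unfolding stop_def by (simp add: integrable_stop)
  have i: "integrable \<nu> (\<lambda>x. of_bool (x \<le> u) * c)" for u c :: real
  proof -
    have "integrable \<nu> (\<lambda>x. indicator {..u} x * c)" by (intro integrable_mult_left integrable_indicator_atMost)
    then show ?thesis by (simp add: indicator_def of_bool_def)
  qed
  have "cdf0 s * (t - s) = (\<integral>x. of_bool (x \<le> s) * (t - s) \<partial>\<nu>)"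
    unfolding cdf0_eq using i[of s 1] by simp
  also have "\<dots> \<le> stop t - stop s"
    unfolding eq using assms
    by (intro integral_mono i Bochner_Integration.integrable_diff integrable_stop) auto
  finally show "cdf0 s * (t - s) \<le> stop t - stop s" .
  have "stop t - stop s \<le> (\<integral>x. of_bool (x \<le> t) * (t - s) \<partial>\<nu>)"
    unfolding eq using assms
    by (intro integral_mono i Bochner_Integration.integrable_diff integrable_stop) auto
  also have "\<dots> = cdf0 t * (t - s)"
    unfolding cdf0_eq using i[of t 1] by simp
  finally show "stop t - stop s \<le> cdf0 t * (t - s)" .
qed

lemma cdf0_mono: "mono cdf0"
  unfolding cdf0_def by (intro monoI finite_measure_mono) auto

lemma cdf0_right_cont: "continuous (at_right t) cdf0"
proof -
  interpret real_distribution \<nu> by standard auto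
  have "cdf0 = cdf \<nu>" by (simp add: fun_eq_iff cdf0_def cdf_def)
  then show ?thesis using cdf_is_right_cont by simp
qed

lemma max_eq_plus_stop: "(\<integral>x. max 0 (x - t) \<partial>\<nu>) = mean - t + stop t"
proof -
  have "(\<integral>x. max 0 (x - t) \<partial>\<nu>) = (\<integral>x. x - t + max 0 (t - x) \<partial>\<nu>)"
    by (intro Bochner_Integration.integral_cong) auto
  also have "\<dots> = mean - t + stop t"
    unfolding mean_def stop_def using integrable_id integrable_stop prob_space by simp
  finally show ?thesis .
qed

text \<open>The difference quotients of \<open>stop\<close> from the right are trapped between
  \<open>cdf0 t\<close> and \<open>cdf0 s\<close>, so right continuity of the distribution function
  gives the right derivative.\<close>

lemma cdf_data: "cdf_data cdf0 stop mean"
proof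
  show "mono cdf0" by (rule cdf0_mono)
  show "0 \<le> cdf0 t" "cdf0 t \<le> 1" for t by (simp_all add: cdf0_def)
  have lip: "\<bar>stop t - stop s\<bar> \<le> \<bar>t - s\<bar>" for s t
  proof -
    have *: "\<bar>stop t - stop s\<bar> \<le> \<bar>t - s\<bar>" if "s \<le> t" for s t
    proof -
      have 1: "0 \<le> cdf0 s * (t - s)" and 2: "cdf0 t * (t - s) \<le> 1 * (t - s)"
        using that by (intro mult_nonneg_nonneg mult_right_mono; simp add: cdf0_def)+
      show ?thesis
        using order_trans[OF 1 stop_diff_bounds(1)[OF that]] order_trans[OF stop_diff_bounds(2)[OF that] 2]
        by simp
    qed
    show ?thesis using *[of s t] *[of t s] by (cases "s \<le> t") (auto simp: abs_minus_commute)
  qed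
  have "1-lipschitz_on A stop" for A
    by (rule lipschitz_onI) (auto simp: dist_real_def lip)
  then show "continuous_on A stop" for A
    by (rule lipschitz_on_continuous_on)
  show "(stop has_real_derivative cdf0 t) (at t within {t..})" for t
  proof -
    have "((\<lambda>s. (stop s - stop t) / (s - t)) \<longlongrightarrow> cdf0 t) (at_right t)"
    proof (rule tendsto_sandwich[where f = "\<lambda>_. cdf0 t" and h = cdf0])
      show "\<forall>\<^sub>F s in at_right t. cdf0 t \<le> (stop s - stop t) / (s - t)"
        unfolding eventually_at_right_field
        by (intro exI[of _ "t + 1"]) (auto simp: pos_le_divide_eq intro: stop_diff_bounds)
      show "\<forall>\<^sub>F s in at_right t. (stop s - stop t) / (s - t) \<le> cdf0 s"
        unfolding eventually_at_right_field
        by (intro exI[of _ "t + 1"]) (auto simp: pos_divide_le_eq intro: stop_diff_bounds)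
      show "(cdf0 \<longlongrightarrow> cdf0 t) (at_right t)"
        using cdf0_right_cont by (simp add: continuous_within)
    qed simp
    then show ?thesis
      unfolding has_field_derivative_iff by (simp add: at_within_Ici_at_right)
  qed
  show "stop t = 0" if "t \<le> 0" for t
  proof -
    have "stop t = (\<integral>x. 0 \<partial>\<nu>)"
      unfolding stop_def
    proof (rule integral_cong_AE)
      show "AE x in \<nu>. max 0 (t - x) = 0" using nonneg by eventually_elim (use that in auto)
    qed auto
    then show ?thesis by simp
  qed
  show "t \<le> mean + stop t" for t
  proof -
    have "0 \<le> (\<integral>x. max 0 (x - t) \<partial>\<nu>)" by (intro integral_nonneg_AE) auto
    then show ?thesis unfolding max_eq_plus_stop by simp
  qed
qed

lemma lower_partial_mean: "(\<integral>x. x * of_bool (x \<le> t) \<partial>\<nu>) = t * cdf0 t - stop t"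
proof -
  have i: "integrable \<nu> (\<lambda>x. t * indicator {..t} x)" by (intro integrable_mult_right integrable_indicator_atMost)
  have "(\<integral>x. x * of_bool (x \<le> t) \<partial>\<nu>) = (\<integral>x. t * indicator {..t} x - max 0 (t - x) \<partial>\<nu>)"
    by (intro Bochner_Integration.integral_cong) (auto simp: indicator_def)
  also have "\<dots> = (\<integral>x. t * indicator {..t} x \<partial>\<nu>) - stop t"
    unfolding stop_def by (rule Bochner_Integration.integral_diff[OF i integrable_stop])
  finally show ?thesis by (simp add: cdf0_def)
qed

lemma upper_partial_mean: "(\<integral>x. x * of_bool (t < x) \<partial>\<nu>) = t * (1 - cdf0 t) + (mean - t + stop t)"
proof -
  have i: "integrable \<nu> (\<lambda>x. t * indicator {..t} x - max 0 (t - x))"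
    by (intro Bochner_Integration.integrable_diff integrable_mult_right integrable_stop integrable_indicator_atMost)
  have "(\<integral>x. x * of_bool (t < x) \<partial>\<nu>) = (\<integral>x. x - (t * indicator {..t} x - max 0 (t - x)) \<partial>\<nu>)"
    by (intro Bochner_Integration.integral_cong) (auto simp: indicator_def)
  also have "\<dots> = mean - (\<integral>x. t * indicator {..t} x - max 0 (t - x) \<partial>\<nu>)"
    unfolding mean_def by (rule Bochner_Integration.integral_diff[OF integrable_id i])
  also have "(\<integral>x. t * indicator {..t} x - max 0 (t - x) \<partial>\<nu>) = t * cdf0 t - stop t"
    unfolding stop_def cdf0_def
    by (subst Bochner_Integration.integral_diff)
       (auto intro!: integrable_mult_right integrable_stop integrable_indicator_atMost)
  finally show ?thesis by (simp add: algebra_simps)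
qed

lemma stop_increment: "(\<integral>x. min 1 (max 0 (t - x)) \<partial>\<nu>) = stop t - stop (t - 1)"
proof -
  have "(\<integral>x. min 1 (max 0 (t - x)) \<partial>\<nu>) = (\<integral>x. max 0 (t - x) - max 0 (t - 1 - x) \<partial>\<nu>)"
    by (intro Bochner_Integration.integral_cong) auto
  then show ?thesis unfolding stop_def by (simp add: integrable_stop)
qed

end

context panjer_law
begin

definition lawX :: "real measure" where "lawX = distr (measure_pmf q) borel X"

lemma integral_lawX: "f \<in> borel_measurable borel \<Longrightarrow> (\<integral>x. f x \<partial>lawX) = E (\<lambda>N. f (X N))"
  unfolding lawX_def by (subst integral_distr) auto

sublocale lawX: nonneg_law lawX
proof -
  have "prob_space lawX" unfolding lawX_def by (rule measure_pmf.prob_space_distr) auto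
  moreover have "AE x in lawX. 0 \<le> x"
    unfolding lawX_def by (subst AE_distr_iff) (auto simp: X_nonneg)
  moreover have "integrable lawX (\<lambda>x. x)"
    unfolding lawX_def using integrable_X by (subst integrable_distr_eq) auto
  ultimately show "nonneg_law lawX"
    by (intro nonneg_law.intro nonneg_law_axioms.intro) (auto simp: lawX_def)
qed

text \<open>Partial means written through \<open>stop\<close> turn \<open>law_lower\<close> and
  \<open>law_upper\<close> into the two forms of the delay equation; the truncated linear function
  is an increment of \<open>stop\<close> over one unit.\<close>

lemma near_dickman_lawX: "near_dickman lawX.cdf0 lawX.stop lawX.mean \<theta> (c_eps / L)"
proof -
  interpret cdf_data lawX.cdf0 lawX.stop lawX.mean by (rule lawX.cdf_data)
  have pos: "0 \<le> \<theta> * M + (1 + \<theta>) * \<theta> * B" "0 \<le> (1 + \<theta>) * (\<theta> * (4 + m0)) * B + \<theta> * (2 * M * (2 + m0))"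
    using theta M(1) B(1) m0_pos by (auto intro!: add_nonneg_nonneg mult_nonneg_nonneg)
  then have c: "0 \<le> c_eps" "\<theta> * M + (1 + \<theta>) * \<theta> * B \<le> c_eps"
      "(1 + \<theta>) * (\<theta> * (4 + m0)) * B + \<theta> * (2 * M * (2 + m0)) \<le> c_eps"
    by (auto simp: c_eps_def)
  show ?thesis
  proof
    show "0 < \<theta>" by (rule theta)
    show "0 \<le> c_eps / L" using c L_ge by simp
    fix t :: real assume t: "0 \<le> t"
    have "\<bar>t * lawX.cdf0 t - (1 + \<theta>) * lawX.stop t + \<theta> * lawX.stop (t - 1)\<bar>
        = \<bar>(t * lawX.cdf0 t - lawX.stop t) - \<theta> * (lawX.stop t - lawX.stop (t - 1))\<bar>"
      by (simp add: algebra_simps)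
    also have "\<dots> \<le> (\<theta> * M + (1 + \<theta>) * \<theta> * B) / L * lawX.cdf0 t"
      using law_lower[OF t]
        integral_lawX[of "\<lambda>x. x * of_bool (x \<le> t)"] integral_lawX[of "\<lambda>x. min 1 (max 0 (t - x))"]
        integral_lawX[of "\<lambda>x. of_bool (x \<le> t)"]
      by (simp add: lawX.lower_partial_mean lawX.stop_increment lawX.cdf0_eq)
    also have "\<dots> \<le> c_eps / L * lawX.cdf0 t"
      using c L_ge F_nonneg by (intro mult_right_mono divide_right_mono) auto
    finally show "\<bar>t * lawX.cdf0 t - (1 + \<theta>) * lawX.stop t + \<theta> * lawX.stop (t - 1)\<bar> \<le> c_eps / L * lawX.cdf0 t" .
    have i: "(\<integral>x. 1 - min 1 (max 0 (t - x)) \<partial>lawX) = 1 - (lawX.stop t - lawX.stop (t - 1))"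
    proof -
      have "integrable lawX (\<lambda>x. min 1 (max 0 (t - x)))"
        by (intro integrable_min lawX.integrable_stop) auto
      then show ?thesis using lawX.prob_space by (simp add: lawX.stop_increment)
    qed
    have "\<bar>t * (1 - lawX.cdf0 t) + (1 + \<theta>) * P t - \<theta> * P (t - 1)\<bar>
        = \<bar>(t * (1 - lawX.cdf0 t) + (lawX.mean - t + lawX.stop t)) - \<theta> * (1 - (lawX.stop t - lawX.stop (t - 1)))\<bar>"
      by (simp add: P_def algebra_simps)
    also have "\<dots> \<le> ((1 + \<theta>) * (\<theta> * (4 + m0)) * B + \<theta> * (2 * M * (2 + m0))) / L / (1 + t)"
      using law_upper[OF t] i
        integral_lawX[of "\<lambda>x. x * of_bool (t < x)"] integral_lawX[of "\<lambda>x. 1 - min 1 (max 0 (t - x))"]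
      by (simp add: lawX.upper_partial_mean)
    also have "\<dots> \<le> c_eps / L / (1 + t)"
      using c L_ge t by (intro divide_right_mono) auto
    finally show "\<bar>t * (1 - lawX.cdf0 t) + (1 + \<theta>) * P t - \<theta> * P (t - 1)\<bar> \<le> c_eps / L / (1 + t)" .
  qed
qed

end

lemma integral_uniform_unit:
  fixes g :: "real \<Rightarrow> real"
  assumes [measurable]: "g \<in> borel_measurable borel"
  shows "(\<integral>u. g u \<partial>uniform_measure lborel {0..1}) = (LINT u:{0..1}|lborel. g u)"
proof -
  have "uniform_measure lborel {0..1::real} = density lborel (\<lambda>x. ennreal (indicator {0..1} x))"
    unfolding uniform_measure_def by (intro density_cong) (auto simp: indicator_def)
  then show ?thesis
    by (simp add: integral_density set_lebesgue_integral_def)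
qed

text \<open>The antiderivative behind the substitution is \<open>u \<mapsto> u * f (u powr (1 / \<theta>) * a)\<close>.\<close>

lemma integral_unit_powr:
  fixes f f' h :: "real \<Rightarrow> real"
  assumes theta: "\<theta> > 0" and a: "a > 0" and S: "finite S"
    and cont: "continuous_on {0..} f"
    and deriv: "\<And>x. \<lbrakk>0 < x; x \<notin> S\<rbrakk> \<Longrightarrow> (f has_real_derivative f' x) (at x)"
    and h: "\<And>x. \<lbrakk>0 < x; x \<notin> S\<rbrakk> \<Longrightarrow> h x = f x + x * f' x / \<theta>"
    and [measurable]: "h \<in> borel_measurable borel" and bounded: "\<And>x. \<bar>h x\<bar> \<le> K"
  shows "(LINT u:{0..1}|lborel. h (u powr (1 / \<theta>) * a)) = f a"
proof -
  define c where "c = 1 / \<theta>"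
  have c: "c > 0" using theta by (simp add: c_def)
  define F where "F u = u * f (u powr c * a)" for u
  \<comment> \<open>Covers the preimage of the exceptional set under
    \<open>u \<mapsto> u powr c * a\<close>; it is finite, as the fundamental theorem
    requires.\<close>
  define T where "T = (\<lambda>v. (v / a) powr \<theta>) ` S"
  have "((\<lambda>u. h (u powr c * a)) has_integral (F 1 - F 0)) {0..1}"
  proof (rule fundamental_theorem_of_calculus_interior_strong)
    show "finite T" using S by (simp add: T_def)
    show "continuous_on {0..1} F"
      unfolding F_def using c a
      by (intro continuous_intros continuous_on_compose2[OF cont] continuous_on_powr') auto
    fix u assume u: "u \<in> {0<..<1} - T"
    then have u0: "u > 0" by simp
    define v where "v = u powr c * a"
    have v: "v > 0" using u0 a by (simp add: v_def)
    have "v \<notin> S"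
    proof
      assume "v \<in> S"
      moreover have "(v / a) powr \<theta> = u" using a u0 theta by (simp add: v_def powr_powr c_def)
      ultimately have "u \<in> T" by (force simp: T_def)
      then show False using u by simp
    qed
    have inner: "((\<lambda>u. u powr c * a) has_real_derivative c * u powr (c - 1) * a) (at u)"
      using u0 by (auto intro!: derivative_eq_intros simp: powr_diff)
    have "((\<lambda>u. f (u powr c * a)) has_real_derivative f' v * (c * u powr (c - 1) * a)) (at u)"
      by (rule DERIV_chain2[OF _ inner]) (use deriv[OF v \<open>v \<notin> S\<close>] in \<open>simp add: v_def\<close>)
    then have "(F has_real_derivative (u * (f' v * (c * u powr (c - 1) * a)) + 1 * f (u powr c * a))) (at u)"
      unfolding F_def by (intro DERIV_mult' DERIV_ident)
    also have "u * (f' v * (c * u powr (c - 1) * a)) + 1 * f (u powr c * a) = h v"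
    proof -
      have "u * u powr (c - 1) = u powr c" using u0 by (simp add: powr_diff)
      then have "u * (f' v * (c * u powr (c - 1) * a)) = v * f' v * c"
        by (simp add: v_def mult_ac)
      then show ?thesis using h[OF v \<open>v \<notin> S\<close>] by (simp add: v_def c_def)
    qed
    finally show "(F has_vector_derivative h (u powr c * a)) (at u)"
      by (simp add: v_def has_real_derivative_iff_has_vector_derivative)
  qed simp
  then have "integral {0..1} (\<lambda>u. h (u powr c * a)) = f a"
    using a by (simp add: F_def integral_unique)
  moreover have "set_integrable lborel {0..1} (\<lambda>u. h (u powr c * a))"
    unfolding set_integrable_def
    by (rule integrableI_bounded_set_indicator[where B = K]) (use bounded in auto)
  ultimately show ?thesis
    by (simp add: set_borel_integral_eq_integral c_def)
qed

section \<open>The generalized Dickman law and its Stein identity\<close>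

locale dickman_law =
  fixes \<theta> :: real and D :: "real measure"
  assumes theta: "\<theta> > 0" and D: "gen_dickman \<theta> D"
begin

sublocale prob_space D using D by (simp add: gen_dickman_def)

lemma sets_D [simp, measurable_cong]: "sets D = sets borel"
  using D by (simp add: gen_dickman_def)

lemma space_D [simp]: "space D = UNIV"
  using sets_eq_imp_space_eq[OF sets_D] by simp

lemma nonneg: "AE x in D. 0 \<le> x" using D by (simp add: gen_dickman_def)

text \<open>After the fixed-point equation and Fubini, the inner integral over \<open>u\<close> is
  evaluated by \<open>integral_unit_powr\<close> at \<open>a = x + 1\<close>. Integrability comes
  from the bound on \<open>h\<close>, so the identity is available before any moment of
  \<open>D\<close> is known.\<close>

lemma stein_identity:
  fixes f f' h :: "real \<Rightarrow> real"
  assumes S: "finite S" and cont: "continuous_on {0..} f"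
    and deriv: "\<And>x. \<lbrakk>0 < x; x \<notin> S\<rbrakk> \<Longrightarrow> (f has_real_derivative f' x) (at x)"
    and h: "\<And>x. \<lbrakk>0 < x; x \<notin> S\<rbrakk> \<Longrightarrow> h x = f x + x * f' x / \<theta>"
    and hm [measurable]: "h \<in> borel_measurable borel" and bounded: "\<And>x. \<bar>h x\<bar> \<le> K"
    and fm [measurable]: "f \<in> borel_measurable borel"
  shows "(\<integral>x. h x \<partial>D) = (\<integral>x. f (x + 1) \<partial>D)"
proof -
  let ?U = "uniform_measure lborel {0..1::real}"
  interpret U: prob_space ?U by (rule prob_space_uniform_measure) auto
  interpret pair_sigma_finite ?U D ..
  interpret UD: prob_space "?U \<Otimes>\<^sub>M D" by (intro prob_space_pair) unfold_locales
  let ?g = "\<lambda>(u, x). u powr (1 / \<theta>) * (x + 1)"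
  have "(\<integral>x. h x \<partial>D) = (\<integral>x. h x \<partial>distr (?U \<Otimes>\<^sub>M D) borel ?g)"
    using D by (simp add: gen_dickman_def)
  also have "\<dots> = (\<integral>z. h (?g z) \<partial>(?U \<Otimes>\<^sub>M D))"
    by (rule integral_distr) measurable
  also have "\<dots> = (\<integral>z. (\<lambda>(u, x). h (u powr (1 / \<theta>) * (x + 1))) z \<partial>(?U \<Otimes>\<^sub>M D))"
    by (simp add: case_prod_beta)
  also have "\<dots> = (\<integral>x. (\<integral>u. h (u powr (1 / \<theta>) * (x + 1)) \<partial>?U) \<partial>D)"
  proof (rule integral_snd[symmetric])
    show "integrable (?U \<Otimes>\<^sub>M D) (\<lambda>(u, x). h (u powr (1 / \<theta>) * (x + 1)))"
      by (rule UD.integrable_const_bound[where B = K]) (use bounded in auto)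
  qed
  also have "\<dots> = (\<integral>x. f (x + 1) \<partial>D)"
  proof (rule integral_cong_AE)
    show "AE x in D. (\<integral>u. h (u powr (1 / \<theta>) * (x + 1)) \<partial>?U) = f (x + 1)"
      using nonneg
    proof eventually_elim
      case (elim x)
      have "(\<integral>u. h (u powr (1 / \<theta>) * (x + 1)) \<partial>?U) = (LINT u:{0..1}|lborel. h (u powr (1 / \<theta>) * (x + 1)))"
        by (rule integral_uniform_unit) measurable
      also have "\<dots> = f (x + 1)"
        using elim by (intro integral_unit_powr[OF theta _ S cont deriv h hm bounded]) auto
      finally show ?case .
    qed
  qed measurable
  finally show ?thesis .
qed

text \<open>The Stein identity for \<open>f x = min x t\<close>; the difference of
  \<open>min (x + 1) t\<close> and \<open>min x t\<close> is the truncated linear function.\<close>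

lemma partial_mean:
  assumes t: "0 \<le> t"
  shows "(\<integral>x. x * of_bool (x \<le> t) \<partial>D) = \<theta> * (\<integral>x. min 1 (max 0 (t - x)) \<partial>D)"
proof -
  \<comment> \<open>The value 0 on the negative half-line, which is null for \<open>D\<close>, keeps
    \<open>h\<close> bounded.\<close>
  define h where "h x = (if x < 0 then 0 else min x t + x * of_bool (x \<le> t) / \<theta>)" for x :: real
  have [measurable]: "h \<in> borel_measurable borel" unfolding h_def by measurable
  have bdd: "\<bar>h x\<bar> \<le> t + t / \<theta>" for x
    using t theta by (auto simp: h_def divide_right_mono intro!: add_mono)
  have "(\<integral>x. h x \<partial>D) = (\<integral>x. min (x + 1) t \<partial>D)"
  proof (rule stein_identity[where S = "{t}" and f' = "\<lambda>x. of_bool (x \<le> t)"])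
    show "continuous_on {0..} (\<lambda>x. min x t)" by (intro continuous_intros)
    fix x :: real assume x: "0 < x" "x \<notin> {t}"
    show "((\<lambda>x. min x t) has_real_derivative of_bool (x \<le> t)) (at x)"
    proof (cases "x < t")
      case True
      have "((\<lambda>x. x) has_real_derivative 1) (at x)" by simp
      then show ?thesis
        by (rule has_field_derivative_transform_within_open[of _ _ _ "{..<t}", THEN DERIV_cong])
           (use True in auto)
    next
      case False
      have "((\<lambda>x. t) has_real_derivative 0) (at x)" by simp
      then show ?thesis
        by (rule has_field_derivative_transform_within_open[of _ _ _ "{t<..}", THEN DERIV_cong])
           (use False x in auto)
    qed
    show "h x = min x t + x * of_bool (x \<le> t) / \<theta>" using x by (simp add: h_def)
  qed (use bdd in auto)
  moreover have "(\<integral>x. h x \<partial>D) = (\<integral>x. min (x + 1) t + (x * of_bool (x \<le> t) / \<theta> - min 1 (max 0 (t - x))) \<partial>D)"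
  proof (rule integral_cong_AE)
    show "AE x in D. h x = min (x + 1) t + (x * of_bool (x \<le> t) / \<theta> - min 1 (max 0 (t - x)))"
      using nonneg by eventually_elim (auto simp: h_def)
  qed measurable
  moreover have i1: "integrable D (\<lambda>x. min (x + 1) t)"
    by (rule integrable_const_bound[where B = "t + 1"]) (use nonneg t in \<open>auto elim!: eventually_mono\<close>)
  moreover have i2: "integrable D (\<lambda>x. x * of_bool (x \<le> t))"
    by (rule integrable_const_bound[where B = t]) (use nonneg t in \<open>auto elim!: eventually_mono\<close>)
  moreover have i3: "integrable D (\<lambda>x. min 1 (max 0 (t - x)))"
    by (rule integrable_const_bound[where B = 1]) auto
  ultimately have "(\<integral>x. x * of_bool (x \<le> t) \<partial>D) / \<theta> = (\<integral>x. min 1 (max 0 (t - x)) \<partial>D)"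
    by simp
  then show ?thesis using theta by (simp add: field_simps)
qed

text \<open>The truncated means given by \<open>partial_mean\<close> increase to
  \<open>\<theta>\<close>, and monotone convergence delivers integrability together with the
  value.\<close>

lemma has_mean: "has_bochner_integral D (\<lambda>x. x) \<theta>"
proof (rule has_bochner_integral_monotone_convergence)
  let ?f = "\<lambda>n::nat. \<lambda>x::real. x * of_bool (x \<le> real n)"
  show "integrable D (?f n)" for n
    by (rule integrable_const_bound[where B = "real n"]) (use nonneg in \<open>auto elim!: eventually_mono\<close>)
  show "AE x in D. mono (\<lambda>n. ?f n x)"
    using nonneg by eventually_elim (auto simp: mono_def)
  show "AE x in D. (\<lambda>n. ?f n x) \<longlonglongrightarrow> x"
  proof (rule AE_I2)
    fix x :: real
    have "\<forall>\<^sub>F n in sequentially. ?f n x = x"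
      using eventually_ge_at_top[of "nat \<lceil>x\<rceil>"] by eventually_elim (auto simp: nat_le_iff ceiling_le_iff)
    then show "(\<lambda>n. ?f n x) \<longlonglongrightarrow> x" by (rule tendsto_eventually)
  qed
  have "(\<lambda>n. \<integral>x. min 1 (max 0 (real n - x)) \<partial>D) \<longlonglongrightarrow> (\<integral>x. 1 \<partial>D)"
  proof (rule integral_dominated_convergence[where w = "\<lambda>_. 1"])
    show "AE x in D. (\<lambda>n. min 1 (max 0 (real n - x))) \<longlonglongrightarrow> 1"
    proof (rule AE_I2)
      fix x :: real
      have "\<forall>\<^sub>F n in sequentially. min 1 (max 0 (real n - x)) = 1"
        using eventually_ge_at_top[of "nat \<lceil>x + 1\<rceil>"] 
      proof eventually_elim
        case (elim n)
        then have "x + 1 \<le> real n" by (simp only: nat_le_iff ceiling_le_iff of_int_of_nat_eq)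
        then show ?case by simp
      qed
      then show "(\<lambda>n. min 1 (max 0 (real n - x))) \<longlonglongrightarrow> 1" by (rule tendsto_eventually)
    qed
  qed auto
  then have "(\<lambda>n. \<theta> * (\<integral>x. min 1 (max 0 (real n - x)) \<partial>D)) \<longlonglongrightarrow> \<theta> * 1"
    by (intro tendsto_intros) (simp add: prob_space[unfolded space_D])
  then show "(\<lambda>n. \<integral>x. ?f n x \<partial>D) \<longlonglongrightarrow> \<theta>" by (simp add: partial_mean)
qed simp

sublocale nonneg_law D
  by standard (use nonneg has_mean in \<open>auto simp: has_bochner_integral_iff\<close>)

lemma mean_eq: "mean = \<theta>"
  using has_mean by (simp add: mean_def has_bochner_integral_iff)

lemma near_dickman_D: "near_dickman cdf0 stop mean \<theta> 0"
proof -
  interpret cdf_data cdf0 stop mean by (rule cdf_data)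
  have eq: "t * cdf0 t - stop t = \<theta> * (stop t - stop (t - 1))" if "0 \<le> t" for t
    using partial_mean[OF that] by (simp add: lower_partial_mean stop_increment)
  show ?thesis
  proof
    fix t :: real assume t: "0 \<le> t"
    show "\<bar>t * cdf0 t - (1 + \<theta>) * stop t + \<theta> * stop (t - 1)\<bar> \<le> 0 * cdf0 t"
      using eq[OF t] by (simp add: algebra_simps)
    show "\<bar>t * (1 - cdf0 t) + (1 + \<theta>) * P t - \<theta> * P (t - 1)\<bar> \<le> 0 / (1 + t)"
      using eq[OF t] unfolding P_def unfolding mean_eq by (simp add: algebra_simps)
  qed (use theta in auto)
qed

text \<open>The Stein identity for \<open>f x = - ((max 0 (1 - x)) ^ 3 / 3)\<close>, which vanishes
  from 1 on, so \<open>f (x + 1)\<close> is 0 almost surely; the integrand is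
  \<open>\<theta> * h\<close>.\<close>

lemma test_identity:
  "(\<integral>x. x * (max 0 (1 - x)) ^ 2 - \<theta> * (max 0 (1 - x)) ^ 3 / 3 \<partial>D) = 0"
proof -
  define f where "f x = - ((max 0 (1 - x)) ^ 3 / 3)" for x :: real
  define h where "h x = (if x < 0 then 0 else f x + x * (max 0 (1 - x)) ^ 2 / \<theta>)" for x :: real
  have [measurable]: "f \<in> borel_measurable borel" "h \<in> borel_measurable borel"
    unfolding h_def f_def by measurable
  have pow: "0 \<le> (max 0 (1 - x)) ^ k" "(max 0 (1 - x)) ^ k \<le> 1" if "0 \<le> x" for x :: real and k
    using that by (auto intro!: power_le_one)
  have bdd: "\<bar>h x\<bar> \<le> 1 + 1 / \<theta>" for x
  proof (cases "x < 0")
    case False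
    then have x: "0 \<le> x" by simp
    have "x * (max 0 (1 - x)) ^ 2 \<le> 1"
      using x pow[OF x, of 2] by (cases "x \<le> 1") (auto intro: mult_le_one)
    then have "x * (max 0 (1 - x)) ^ 2 / \<theta> \<le> 1 / \<theta>" using theta by (intro divide_right_mono) auto
    moreover have "0 \<le> x * (max 0 (1 - x)) ^ 2 / \<theta>" using x theta pow[OF x, of 2] by simp
    ultimately have "\<bar>- ((max 0 (1 - x)) ^ 3 / 3) + x * (max 0 (1 - x)) ^ 2 / \<theta>\<bar> \<le> 1 + 1 / \<theta>"
      using pow[OF x, of 3] by linarith
    then show ?thesis using False by (simp add: h_def f_def)
  qed (use theta in \<open>simp add: h_def\<close>)
  have "(\<integral>x. h x \<partial>D) = (\<integral>x. f (x + 1) \<partial>D)"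
  proof (rule stein_identity[where S = "{1}" and f' = "\<lambda>x. (max 0 (1 - x)) ^ 2"])
    show "continuous_on {0..} f" unfolding f_def by (intro continuous_intros) auto
    fix x :: real assume x: "0 < x" "x \<notin> {1}"
    show "(f has_real_derivative (max 0 (1 - x)) ^ 2) (at x)"
    proof (cases "x < 1")
      case True
      have "((\<lambda>x. - ((1 - x) ^ 3 / 3)) has_real_derivative (1 - x) ^ 2) (at x)"
        by (auto intro!: derivative_eq_intros)
      then show ?thesis
        by (rule has_field_derivative_transform_within_open[of _ _ _ "{..<1}", THEN DERIV_cong])
           (use True in \<open>auto simp: f_def\<close>)
    next
      case False
      have "((\<lambda>x. 0) has_real_derivative 0) (at x)" by simp
      then show ?thesis
        by (rule has_field_derivative_transform_within_open[of _ _ _ "{1<..}", THEN DERIV_cong])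
           (use False x in \<open>auto simp: f_def\<close>)
    qed
    show "h x = f x + x * (max 0 (1 - x)) ^ 2 / \<theta>" using x by (simp add: h_def)
  qed (use bdd in auto)
  also have "\<dots> = (\<integral>x. 0 \<partial>D)"
  proof (rule integral_cong_AE)
    show "AE x in D. f (x + 1) = 0" using nonneg by eventually_elim (simp add: f_def)
  qed auto
  finally have "(\<integral>x. \<theta> * h x \<partial>D) = 0" by simp
  also have "(\<integral>x. \<theta> * h x \<partial>D) = (\<integral>x. x * (max 0 (1 - x)) ^ 2 - \<theta> * (max 0 (1 - x)) ^ 3 / 3 \<partial>D)"
  proof (rule integral_cong_AE)
    show "AE x in D. \<theta> * h x = x * (max 0 (1 - x)) ^ 2 - \<theta> * (max 0 (1 - x)) ^ 3 / 3"
      using nonneg by eventually_elim (use theta in \<open>simp add: h_def f_def field_simps\<close>)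
  qed measurable
  finally show ?thesis .
qed

end

section \<open>The two distances\<close>

context nonneg_law
begin

text \<open>A layer-cake formula by Fubini: as \<open>g\<close> is bounded by 1, the inner integral
  of the absolute value is at most the absolute value of \<open>x\<close>, which is
  integrable.\<close>

lemma set_integral_tail_eq:
  fixes g :: "real \<Rightarrow> real"
  assumes [measurable]: "g \<in> borel_measurable borel" and bounded: "\<And>t. \<bar>g t\<bar> \<le> 1"
  shows "integrable lborel (\<lambda>t. indicator {0<..} t * (g t * (1 - cdf0 t)))"
    and "(\<integral>x. (\<integral>t. indicator {0<..<x} t * g t \<partial>lborel) \<partial>\<nu>)
         = (\<integral>t. indicator {0<..} t * (g t * (1 - cdf0 t)) \<partial>lborel)"
proof -
  interpret pair_sigma_finite \<nu> lborel ..
  define f where "f x t = of_bool (0 < t \<and> t < x) * g t" for x t :: real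
  have [measurable]: "(\<lambda>(x, t). f x t) \<in> borel_measurable (\<nu> \<Otimes>\<^sub>M lborel)"
    unfolding f_def by measurable
  have f_eq: "f x t = indicator {0<..<x} t * g t" for x t
    by (auto simp: f_def)
  have fin: "emeasure lborel {0<..<x} < \<infinity>" for x :: real
    by (rule emeasure_bounded_finite) simp
  have i: "integrable lborel (\<lambda>t. indicator {0<..<x} t * g t)" for x
  proof -
    have "integrable lborel (\<lambda>t. indicator {0<..<x} t *\<^sub>R g t)"
      by (rule integrableI_bounded_set_indicator[where B = 1]) (use bounded fin in auto)
    then show ?thesis by simp
  qed
  have int: "integrable (\<nu> \<Otimes>\<^sub>M lborel) (\<lambda>(x, t). f x t)"
  proof (rule Fubini_integrable)
    have "integrable \<nu> (\<lambda>x. \<bar>x\<bar>)" using integrable_id by simp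
    then show "integrable \<nu> (\<lambda>x. \<integral>t. norm (case (x, t) of (x, t) \<Rightarrow> f x t) \<partial>lborel)"
    proof (rule Bochner_Integration.integrable_bound)
      show "(\<lambda>x. \<integral>t. norm (case (x, t) of (x, t) \<Rightarrow> f x t) \<partial>lborel) \<in> borel_measurable \<nu>"
        by measurable
      show "AE x in \<nu>. norm (\<integral>t. norm (case (x, t) of (x, t) \<Rightarrow> f x t) \<partial>lborel) \<le> norm \<bar>x\<bar>"
      proof (rule AE_I2)
        fix x :: real
        have ind: "integrable lborel (\<lambda>t. indicat_real {0<..<x} t)"
          by (rule integrable_real_indicator[OF _ fin]) simp
        have "(\<integral>t. norm (f x t) \<partial>lborel) \<le> (\<integral>t. indicat_real {0<..<x} t \<partial>lborel)"
        proof (rule integral_mono[OF _ ind])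
          show "integrable lborel (\<lambda>t. norm (f x t))"
            unfolding f_eq by (intro integrable_norm i)
          show "norm (f x t) \<le> indicat_real {0<..<x} t" for t
            using bounded[of t] by (auto simp: f_def indicator_def)
        qed
        also have "\<dots> \<le> \<bar>x\<bar>" by (cases "0 \<le> x") auto
        finally show "norm (\<integral>t. norm (case (x, t) of (x, t) \<Rightarrow> f x t) \<partial>lborel) \<le> norm \<bar>x\<bar>"
          by (simp add: abs_of_nonneg[OF Bochner_Integration.integral_nonneg])
      qed
    qed
    show "AE x in \<nu>. integrable lborel (\<lambda>t. case (x, t) of (x, t) \<Rightarrow> f x t)"
      by (simp add: f_eq i)
  qed measurable
  have inner: "(\<integral>x. f x t \<partial>\<nu>) = indicator {0<..} t * (g t * (1 - cdf0 t))" for t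
  proof -
    have "(\<integral>x. f x t \<partial>\<nu>) = (\<integral>x. indicator {0<..} t * g t * (1 - indicat_real {..t} x) \<partial>\<nu>)"
      by (intro Bochner_Integration.integral_cong) (auto simp: f_def indicator_def)
    also have "\<dots> = indicator {0<..} t * g t * (\<integral>x. 1 - indicat_real {..t} x \<partial>\<nu>)" by simp
    also have "(\<integral>x. 1 - indicat_real {..t} x \<partial>\<nu>) = 1 - cdf0 t"
      using prob_space[unfolded space_eq]
      by (subst Bochner_Integration.integral_diff) (auto intro!: integrable_indicator_atMost simp: cdf0_def)
    finally show ?thesis by simp
  qed
  show "integrable lborel (\<lambda>t. indicator {0<..} t * (g t * (1 - cdf0 t)))"
    using integrable_snd[OF int] by (simp add: inner)
  have "(\<integral>t. (\<integral>x. f x t \<partial>\<nu>) \<partial>lborel) = (\<integral>x. (\<integral>t. f x t \<partial>lborel) \<partial>\<nu>)"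
    by (rule Fubini_integral[OF int])
  then show "(\<integral>x. (\<integral>t. indicator {0<..<x} t * g t \<partial>lborel) \<partial>\<nu>)
         = (\<integral>t. indicator {0<..} t * (g t * (1 - cdf0 t)) \<partial>lborel)"
    by (simp add: inner) (simp add: f_eq)
qed

lemma expectation_eq_tail_integral:
  fixes h h' :: "real \<Rightarrow> real"
  assumes deriv: "\<And>x. (h has_real_derivative h' x) (at x)" and cont: "continuous_on UNIV h'"
    and bounded: "\<And>x. \<bar>h' x\<bar> \<le> 1"
  shows "(\<integral>x. h x \<partial>\<nu>) = h 0 + (\<integral>t. indicator {0<..} t * (h' t * (1 - cdf0 t)) \<partial>lborel)"
proof -
  have [measurable]: "h' \<in> borel_measurable borel"
    using cont by (rule borel_measurable_continuous_onI)
  have "continuous_on UNIV h"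
    by (intro DERIV_continuous_on[OF has_field_derivative_at_within[OF deriv]])
  then have [measurable]: "h \<in> borel_measurable borel"
    by (rule borel_measurable_continuous_onI)
  have ftc: "h x = h 0 + (\<integral>t. indicator {0<..<x} t * h' t \<partial>lborel)" if "0 \<le> x" for x
  proof -
    have "(\<integral>t. indicator {0<..<x} t * h' t \<partial>lborel) = (LBINT t=ereal 0..ereal x. h' t)"
      using interval_integral_Ioo[of 0 x h'] that
      by (simp add: set_lebesgue_integral_def zero_ereal_def)
    also have "\<dots> = h x - h 0"
    proof (rule interval_integral_FTC_finite)
      show "continuous_on {min 0 x..max 0 x} h'" using cont by (rule continuous_on_subset) simp
      show "(h has_vector_derivative h' t) (at t within {min 0 x..max 0 x})" for t
        using deriv[of t] by (simp add: has_field_derivative_at_within has_real_derivative_iff_has_vector_derivative[symmetric])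
    qed
    finally show ?thesis by simp
  qed
  have lip: "\<bar>h x - h 0\<bar> \<le> \<bar>x\<bar>" for x
  proof -
    have "norm (h x - h 0) \<le> 1 * norm (x - 0)"
      by (rule field_differentiable_bound[of UNIV h h'])
         (use deriv bounded in \<open>auto simp: has_field_derivative_at_within\<close>)
    then show ?thesis by simp
  qed
  have "integrable \<nu> (\<lambda>x. h x - h 0)"
    by (rule Bochner_Integration.integrable_bound[OF integrable_id]) (use lip in auto)
  then have "integrable \<nu> (\<lambda>x. (h x - h 0) + h 0)" by (intro Bochner_Integration.integrable_add) auto
  then have ih: "integrable \<nu> h" by simp
  have "(\<integral>x. h x \<partial>\<nu>) - h 0 = (\<integral>x. h x - h 0 \<partial>\<nu>)"
    using ih prob_space[unfolded space_eq] by simp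
  also have "\<dots> = (\<integral>x. (\<integral>t. indicator {0<..<x} t * h' t \<partial>lborel) \<partial>\<nu>)"
  proof (rule integral_cong_AE)
    show "AE x in \<nu>. h x - h 0 = (\<integral>t. indicator {0<..<x} t * h' t \<partial>lborel)"
      using nonneg
    proof eventually_elim
      case (elim x) then show ?case using ftc[of x] by simp
    qed
    have eq: "indicator {0<..<x} t * h' t = of_bool (0 < t \<and> t < x) * h' t" for x t by auto
    show "(\<lambda>x. \<integral>t. indicator {0<..<x} t * h' t \<partial>lborel) \<in> borel_measurable \<nu>"
      unfolding eq by measurable
  qed measurable
  finally show ?thesis using set_integral_tail_eq(2)[of h'] bounded by simp
qed

end

locale law_pair = A: nonneg_law \<mu> + B: nonneg_law \<nu> for \<mu> \<nu>
begin

lemma dist_K_bounded: "bdd_above ((\<lambda>t. \<bar>measure \<mu> {..t} - measure \<nu> {..t}\<bar>) ` {0..})"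
proof (rule bdd_aboveI2[where M = 1])
  fix t show "\<bar>measure \<mu> {..t} - measure \<nu> {..t}\<bar> \<le> 1"
    using A.prob_le_1[of "{..t}"] B.prob_le_1[of "{..t}"]
      measure_nonneg[of \<mu> "{..t}"] measure_nonneg[of \<nu> "{..t}"] by linarith
qed

lemma dist_K_ge: "0 \<le> t \<Longrightarrow> \<bar>A.cdf0 t - B.cdf0 t\<bar> \<le> dist_K \<mu> \<nu>"
  unfolding dist_K_def A.cdf0_def B.cdf0_def by (rule cSUP_upper[OF _ dist_K_bounded]) simp

lemma dist_K_le: "(\<And>t. 0 \<le> t \<Longrightarrow> \<bar>A.cdf0 t - B.cdf0 t\<bar> \<le> K) \<Longrightarrow> dist_K \<mu> \<nu> \<le> K"
  unfolding dist_K_def A.cdf0_def B.cdf0_def by (rule cSUP_least) auto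

text \<open>Subtracting the two tail integrals leaves \<open>deriv h\<close> times the difference of
  the distribution functions, and the Lipschitz condition bounds \<open>deriv h\<close> by 1. So the
  distance is at most the area between the distribution functions, for which \<open>\<beta>\<close>
  is any majorant.\<close>

lemma dist_11_le:
  assumes le: "\<And>t. 0 < t \<Longrightarrow> \<bar>A.cdf0 t - B.cdf0 t\<bar> \<le> \<beta> t"
    and [measurable]: "\<beta> \<in> borel_measurable borel"
    and int: "(\<integral>\<^sup>+t. indicator {0<..} t * ennreal (\<beta> t) \<partial>lborel) \<le> ennreal K" and K: "K \<ge> 0"
  shows "dist_11 \<mu> \<nu> \<le> ereal K"
  unfolding dist_11_def
proof (rule SUP_least)
  fix h :: "real \<Rightarrow> real"
  assume "h \<in> {h. (\<forall>x. h differentiable at x) \<and> 1-lipschitz_on UNIV h \<and> 1-lipschitz_on UNIV (deriv h)}"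
  then have h: "\<And>x. h differentiable at x" "1-lipschitz_on UNIV h" "1-lipschitz_on UNIV (deriv h)" by auto
  have deriv: "(h has_real_derivative deriv h x) (at x)" for x
    using h(1) by (metis DERIV_imp_deriv real_differentiable_def)
  have cont: "continuous_on UNIV (deriv h)" using h(3) by (rule lipschitz_on_continuous_on)
  have [measurable]: "deriv h \<in> borel_measurable borel"
    using cont by (rule borel_measurable_continuous_onI)
  have bounded: "\<bar>deriv h x\<bar> \<le> 1" for x
  proof (rule tendsto_upperbound)
    show "((\<lambda>y. \<bar>(h y - h x) / (y - x)\<bar>) \<longlongrightarrow> \<bar>deriv h x\<bar>) (at x)"
      using deriv[of x] unfolding has_field_derivative_iff by (rule tendsto_rabs)
    have "\<bar>h y - h x\<bar> \<le> \<bar>y - x\<bar>" for y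
      using lipschitz_onD[OF h(2), of y x] by (simp add: dist_real_def)
    then have "\<bar>(h y - h x) / (y - x)\<bar> \<le> 1" for y
      unfolding abs_divide by (cases "y = x") (auto simp: divide_le_eq_1)
    then show "\<forall>\<^sub>F y in at x. \<bar>(h y - h x) / (y - x)\<bar> \<le> 1" by simp
  qed simp
  note eqA = A.expectation_eq_tail_integral[OF deriv cont bounded] and eqB = B.expectation_eq_tail_integral[OF deriv cont bounded]
  note iA = A.set_integral_tail_eq(1)[of "deriv h"] and iB = B.set_integral_tail_eq(1)[of "deriv h"]
  define d where "d t = indicator {0<..} t * (deriv h t * (1 - A.cdf0 t)) - indicator {0<..} t * (deriv h t * (1 - B.cdf0 t))" for t
  have id: "integrable lborel d"
    unfolding d_def using iA iB bounded by (intro Bochner_Integration.integrable_diff) auto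
  have "(\<integral>x. h x \<partial>\<mu>) - (\<integral>x. h x \<partial>\<nu>) = (\<integral>t. d t \<partial>lborel)"
    unfolding eqA eqB d_def using iA iB bounded by (subst Bochner_Integration.integral_diff) auto
  then have "\<bar>(\<integral>x. h x \<partial>\<mu>) - (\<integral>x. h x \<partial>\<nu>)\<bar> \<le> (\<integral>t. \<bar>d t\<bar> \<partial>lborel)"
    using integral_abs_bound[of lborel d] by simp
  moreover have "ennreal (\<integral>t. \<bar>d t\<bar> \<partial>lborel) \<le> ennreal K"
  proof -
    have "ennreal (\<integral>t. \<bar>d t\<bar> \<partial>lborel) = (\<integral>\<^sup>+t. ennreal \<bar>d t\<bar> \<partial>lborel)"
      using id by (intro nn_integral_eq_integral[symmetric]) auto
    also have "\<dots> \<le> (\<integral>\<^sup>+t. indicator {0<..} t * ennreal (\<beta> t) \<partial>lborel)"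
    proof (rule nn_integral_mono)
      fix t
      show "ennreal \<bar>d t\<bar> \<le> indicator {0<..} t * ennreal (\<beta> t)"
      proof (cases "0 < t")
        case True
        have "d t = deriv h t * (B.cdf0 t - A.cdf0 t)" using True by (simp add: d_def algebra_simps)
        then have "\<bar>d t\<bar> \<le> 1 * \<bar>A.cdf0 t - B.cdf0 t\<bar>"
          unfolding abs_minus_commute[of "A.cdf0 t"] using bounded[of t]
          by (simp only: abs_mult) (intro mult_right_mono, auto)
        then show ?thesis using True le[OF True] by (simp add: ennreal_leI)
      qed (simp add: d_def)
    qed
    finally show ?thesis using int by (rule order_trans)
  qed
  ultimately have "\<bar>(\<integral>x. h x \<partial>\<mu>) - (\<integral>x. h x \<partial>\<nu>)\<bar> \<le> K"
    using K by (simp add: ennreal_le_iff)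
  then show "ereal \<bar>(\<integral>x. h x \<partial>\<mu>) - (\<integral>x. h x \<partial>\<nu>)\<bar> \<le> ereal K" by simp
qed

text \<open>The test function is controlled on the half-line only. Freezing its derivative to the
  left of 0 and integrating again gives an admissible \<open>H\<close> that agrees with
  \<open>\<phi> / K\<close> up to a constant wherever the two laws live.\<close>

lemma dist_11_ge_test:
  fixes \<phi> \<phi>' :: "real \<Rightarrow> real"
  assumes deriv: "\<And>x. (\<phi> has_real_derivative \<phi>' x) (at x)" and K: "K > 0"
    and lip: "\<And>x y. 0 \<le> x \<Longrightarrow> 0 \<le> y \<Longrightarrow> \<bar>\<phi>' x - \<phi>' y\<bar> \<le> K * \<bar>x - y\<bar>"
    and bounded: "\<And>x. 0 \<le> x \<Longrightarrow> \<bar>\<phi>' x\<bar> \<le> K"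
    and im: "integrable \<mu> \<phi>" and in': "integrable \<nu> \<phi>"
  shows "ereal (\<bar>(\<integral>x. \<phi> x \<partial>\<mu>) - (\<integral>x. \<phi> x \<partial>\<nu>)\<bar> / K) \<le> dist_11 \<mu> \<nu>"
proof -
  define g where "g x = \<phi>' (max 0 x) / K" for x
  have g_lip: "\<bar>g x - g y\<bar> \<le> \<bar>x - y\<bar>" for x y
  proof -
    have "\<bar>\<phi>' (max 0 x) - \<phi>' (max 0 y)\<bar> \<le> K * \<bar>max 0 x - max 0 y\<bar>" by (intro lip) auto
    also have "\<dots> \<le> K * \<bar>x - y\<bar>" using K by (intro mult_left_mono) auto
    finally have "\<bar>\<phi>' (max 0 x) - \<phi>' (max 0 y)\<bar> / K \<le> \<bar>x - y\<bar>" using K by (simp add: divide_le_eq mult.commute)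
    then show ?thesis using K by (simp add: g_def abs_divide flip: diff_divide_distrib)
  qed
  then have g_lip': "1-lipschitz_on UNIV g" by (intro lipschitz_onI) (auto simp: dist_real_def)
  have g_bdd: "\<bar>g x\<bar> \<le> 1" for x
    using bounded[of "max 0 x"] K by (simp add: g_def abs_divide)
  have g_cont: "continuous_on UNIV g" using g_lip' by (rule lipschitz_on_continuous_on)
  define H where "H x = (LBINT t=ereal 0..ereal x. g t)" for x :: real
  have H: "(H has_real_derivative g x) (at x)" for x
  proof -
    have "\<exists>F. \<forall>x::real. -\<infinity> < ereal x \<longrightarrow> ereal x < \<infinity> \<longrightarrow> (F has_vector_derivative g x) (at x)"
      by (rule einterval_antiderivative) (use g_cont in \<open>auto simp: continuous_on_eq_continuous_at\<close>)
    then obtain F where F: "\<And>x. (F has_real_derivative g x) (at x)"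
      by (auto simp: has_real_derivative_iff_has_vector_derivative)
    have "H x = F x - F 0" for x
      unfolding H_def
    proof (rule interval_integral_FTC_finite)
      show "continuous_on {min 0 x..max 0 x} g" using g_cont by (rule continuous_on_subset) simp
      show "(F has_vector_derivative g t) (at t within {min 0 x..max 0 x})" for t
        using F[of t] by (simp add: has_field_derivative_at_within has_real_derivative_iff_has_vector_derivative[symmetric])
    qed
    then have "H = (\<lambda>x. F x - F 0)" by auto
    then show ?thesis by (auto intro!: derivative_eq_intros F)
  qed
  have H_eq: "H x = \<phi> x / K - \<phi> 0 / K" if "0 \<le> x" for x
  proof (cases "x = 0")
    case False
    have "H x - \<phi> x / K = H 0 - \<phi> 0 / K"
    proof (rule DERIV_isconst_end[where f = "\<lambda>x. H x - \<phi> x / K"])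
      show "0 < x" using that False by simp
      show "continuous_on {0..x} (\<lambda>x. H x - \<phi> x / K)"
        by (intro continuous_intros DERIV_continuous_on[OF has_field_derivative_at_within[OF H]]
            DERIV_continuous_on[OF has_field_derivative_at_within[OF deriv]]) (use K in auto)
      fix t :: real assume "0 < t"
      then show "((\<lambda>x. H x - \<phi> x / K) has_real_derivative 0) (at t)"
        using K by (auto intro!: derivative_eq_intros H deriv simp: g_def)
    qed
    then show ?thesis by (simp add: H_def)
  qed (simp add: H_def)
  have dH: "deriv H = g" by (rule ext) (rule DERIV_imp_deriv[OF H])
  have "1-lipschitz_on UNIV H"
  proof (rule lipschitz_onI)
    fix x y
    have "norm (H x - H y) \<le> 1 * norm (x - y)"
      by (rule field_differentiable_bound[of UNIV H g])
         (use H g_bdd in \<open>auto simp: has_field_derivative_at_within\<close>)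
    then show "dist (H x) (H y) \<le> 1 * dist x y" by (simp add: dist_real_def)
  qed simp
  then have mem: "H \<in> {h. (\<forall>x. h differentiable at x) \<and> 1-lipschitz_on UNIV h \<and> 1-lipschitz_on UNIV (deriv h)}"
    using H g_lip' by (auto simp: dH real_differentiable_def)
  have [measurable]: "H \<in> borel_measurable borel"
    by (intro borel_measurable_continuous_onI DERIV_continuous_on[OF has_field_derivative_at_within[OF H]])
  have EA: "(\<integral>x. H x \<partial>\<mu>) = (\<integral>x. \<phi> x \<partial>\<mu>) / K - \<phi> 0 / K"
  proof -
    have "(\<integral>x. H x \<partial>\<mu>) = (\<integral>x. \<phi> x / K - \<phi> 0 / K \<partial>\<mu>)"
    proof (rule integral_cong_AE)
      show "AE x in \<mu>. H x = \<phi> x / K - \<phi> 0 / K" using A.nonneg by eventually_elim (rule H_eq)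
    qed (use im in \<open>auto intro!: borel_measurable_integrable\<close>)
    then show ?thesis using im A.prob_space[unfolded A.space_eq] by simp
  qed
  have EB: "(\<integral>x. H x \<partial>\<nu>) = (\<integral>x. \<phi> x \<partial>\<nu>) / K - \<phi> 0 / K"
  proof -
    have "(\<integral>x. H x \<partial>\<nu>) = (\<integral>x. \<phi> x / K - \<phi> 0 / K \<partial>\<nu>)"
    proof (rule integral_cong_AE)
      show "AE x in \<nu>. H x = \<phi> x / K - \<phi> 0 / K" using B.nonneg by eventually_elim (rule H_eq)
    qed (use in' in \<open>auto intro!: borel_measurable_integrable\<close>)
    then show ?thesis using in' B.prob_space[unfolded B.space_eq] by simp
  qed
  have "(\<integral>x. H x \<partial>\<mu>) - (\<integral>x. H x \<partial>\<nu>) = ((\<integral>x. \<phi> x \<partial>\<mu>) - (\<integral>x. \<phi> x \<partial>\<nu>)) / K"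
    unfolding EA EB by (simp add: diff_divide_distrib)
  then have "\<bar>(\<integral>x. H x \<partial>\<mu>) - (\<integral>x. H x \<partial>\<nu>)\<bar> = \<bar>(\<integral>x. \<phi> x \<partial>\<mu>) - (\<integral>x. \<phi> x \<partial>\<nu>)\<bar> / K"
    using K by (simp add: abs_divide)
  then show ?thesis
    unfolding dist_11_def by (intro SUP_upper2[OF mem]) simp
qed

end

text \<open>Sum of the constants of the decay estimate, of the estimate near 0 and of the bound for
  \<open>F (2 * \<epsilon>)\<close>, plus 2 for the case of large \<open>\<epsilon>\<close>, so that
  one constant serves all ranges.\<close>

definition dk_const :: "real \<Rightarrow> real" where
  "dk_const \<theta> = 2 + (1 + 24 * (1 + \<theta>) ^ 2) + (1 + \<theta>) * (2 + 4 * (1 + \<theta>) * (3/2) powr (1 + \<theta>))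
     + 2 * (1 + \<theta>) * (3/2) powr (1 + \<theta>) * 2 powr \<theta>"

lemma dk_const_bounds:
  assumes "\<theta> > 0"
  shows "2 \<le> dk_const \<theta>" "1 + 24 * (1 + \<theta>) ^ 2 \<le> dk_const \<theta>"
    "(1 + \<theta>) * (2 + 4 * (1 + \<theta>) * (3/2) powr (1 + \<theta>)) \<le> dk_const \<theta>"
    "2 * (1 + \<theta>) * (3/2) powr (1 + \<theta>) * 2 powr \<theta> \<le> dk_const \<theta>"
proof -
  have "0 \<le> 1 + 24 * (1 + \<theta>) ^ 2" "0 \<le> (1 + \<theta>) * (2 + 4 * (1 + \<theta>) * (3/2) powr (1 + \<theta>))"
    "0 \<le> 2 * (1 + \<theta>) * (3/2) powr (1 + \<theta>) * 2 powr \<theta>"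
    using assms by (auto intro!: mult_nonneg_nonneg add_nonneg_nonneg)
  then show "2 \<le> dk_const \<theta>" "1 + 24 * (1 + \<theta>) ^ 2 \<le> dk_const \<theta>"
    "(1 + \<theta>) * (2 + 4 * (1 + \<theta>) * (3/2) powr (1 + \<theta>)) \<le> dk_const \<theta>"
    "2 * (1 + \<theta>) * (3/2) powr (1 + \<theta>) * 2 powr \<theta> \<le> dk_const \<theta>"
    unfolding dk_const_def by linarith+
qed

section \<open>Uniform bounds for the difference of the distribution functions\<close>

context dickman_pair
begin

lemma diff_le_1: "\<bar>F t - G t\<bar> \<le> 1"
  using X.F_nonneg[of t] X.F_le_1[of t] D.F_nonneg[of t] D.F_le_1[of t] by linarith

lemma diff_tail: "0 < t \<Longrightarrow> \<bar>F t - G t\<bar> \<le> dk_const \<theta> * \<epsilon> / (t * (1 + t))"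
  using X.eps dk_const_bounds(2)[OF X.theta]
  by (intro order_trans[OF diff_decay] divide_right_mono mult_right_mono) auto

lemma diff_head: "0 < t \<Longrightarrow> 2 * \<epsilon> \<le> t \<Longrightarrow> t \<le> 1 \<Longrightarrow> \<bar>F t - G t\<bar> \<le> dk_const \<theta> * \<epsilon> * t powr (\<theta> - 1)"
  using X.eps dk_const_bounds(3)[OF X.theta]
  by (intro order_trans[OF diff_near_zero] mult_right_mono) auto

text \<open>Below \<open>2 * \<epsilon>\<close> both functions are
  \<open>O(\<epsilon> powr \<theta>)\<close> by monotonicity. Up to 1 the bound
  \<open>\<epsilon> * t powr (\<theta> - 1)\<close> is worst for \<open>t\<close> of order
  \<open>\<epsilon>\<close> if \<open>\<theta> < 1\<close> and at 1 otherwise; beyond 1 the bound is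
  \<open>O(\<epsilon>)\<close>. This is where \<open>min 1 \<theta>\<close> originates.\<close>

lemma kolmogorov_bound:
  assumes eps: "\<epsilon> > 0"
  shows "\<bar>F t - G t\<bar> \<le> dk_const \<theta> * \<epsilon> powr min 1 \<theta>"
proof -
  define c where "c = dk_const \<theta>"
  define r where "r = min 1 \<theta>"
  have c: "c \<ge> 2" unfolding c_def by (rule dk_const_bounds(1)[OF X.theta])
  have th: "\<theta> > 0" by (rule X.theta)
  show ?thesis
  proof (cases "\<epsilon> \<le> 1/2")
    case False
    have "1 \<le> (2 * \<epsilon>) powr r" using False th by (intro ge_one_powr_ge_zero) (auto simp: r_def)
    also have "\<dots> = 2 powr r * \<epsilon> powr r" using eps by (simp add: powr_mult)
    also have "\<dots> \<le> 2 powr 1 * \<epsilon> powr r" by (intro mult_right_mono powr_mono) (auto simp: r_def)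
    also have "\<dots> \<le> c * \<epsilon> powr r" using c by (intro mult_right_mono) auto
    finally show ?thesis using diff_le_1[of t] by (simp add: c_def r_def)
  next
    case True
    have er: "\<epsilon> powr 1 \<le> \<epsilon> powr r" "\<epsilon> powr \<theta> \<le> \<epsilon> powr r"
      using True eps by (intro powr_mono'; simp add: r_def)+
    consider "t < 2 * \<epsilon>" | "2 * \<epsilon> \<le> t" "t \<le> 1" | "2 * \<epsilon> \<le> t" "t > 1" by linarith
    then show ?thesis
    proof cases
      case 1
      have mono: "F t \<le> F (2 * \<epsilon>)" "G t \<le> G (2 * \<epsilon>)"
        using 1 X.F_mono D.F_mono by (auto simp: mono_def)
      have "2 * (1 + \<theta>) * (3/2) powr (1 + \<theta>) * (2 * \<epsilon>) powr \<theta>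
          = 2 * (1 + \<theta>) * (3/2) powr (1 + \<theta>) * 2 powr \<theta> * \<epsilon> powr \<theta>"
        using eps by (simp add: powr_mult)
      also have "\<dots> \<le> c * \<epsilon> powr r"
        unfolding c_def using er dk_const_bounds(4)[OF th] c by (intro mult_mono) (auto simp: c_def)
      finally have "2 * (1 + \<theta>) * (3/2) powr (1 + \<theta>) * (2 * \<epsilon>) powr \<theta> \<le> c * \<epsilon> powr r" .
      then have "F t \<le> c * \<epsilon> powr r" "G t \<le> c * \<epsilon> powr r"
        using X.F_upper[of "2 * \<epsilon>"] D.F_upper[of "2 * \<epsilon>"] eps mono by auto
      then show ?thesis using X.F_nonneg[of t] D.F_nonneg[of t] by (simp add: c_def r_def)
    next
      case 2
      have "\<bar>F t - G t\<bar> \<le> c * (\<epsilon> * t powr (\<theta> - 1))"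
        using diff_head[of t] 2 eps by (simp add: c_def)
      also have "\<epsilon> * t powr (\<theta> - 1) \<le> \<epsilon> powr r"
      proof (cases "\<theta> \<ge> 1")
        case True
        have "t powr (\<theta> - 1) \<le> 1" using 2 eps True by (intro powr_le1) auto
        then have "\<epsilon> * t powr (\<theta> - 1) \<le> \<epsilon> * 1" using eps by (intro mult_left_mono) auto
        moreover have "\<epsilon> powr 1 = \<epsilon>" using eps by simp
        ultimately show ?thesis using er(1) by linarith
      next
        case False
        have "t powr (\<theta> - 1) \<le> \<epsilon> powr (\<theta> - 1)"
          using 2 eps False by (intro powr_mono2') auto
        then have "\<epsilon> * t powr (\<theta> - 1) \<le> \<epsilon> powr 1 * \<epsilon> powr (\<theta> - 1)" using eps by (simp add: mult_left_mono)
        also have "\<dots> = \<epsilon> powr \<theta>" by (subst powr_add[symmetric]) simp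
        finally show ?thesis using er by simp
      qed
      then have "c * (\<epsilon> * t powr (\<theta> - 1)) \<le> c * \<epsilon> powr r" using c by (intro mult_left_mono) auto
      finally show ?thesis by (simp add: c_def r_def)
    next
      case 3
      have "1 * 1 \<le> t * (1 + t)" using 3 by (intro mult_mono) auto
      then have "c * \<epsilon> / (t * (1 + t)) \<le> c * \<epsilon> / 1"
        using c eps 3 by (intro divide_left_mono) auto
      also have "\<dots> \<le> c * \<epsilon> powr r" using er eps c by simp
      finally show ?thesis using diff_tail[of t] 3 eps by (simp add: c_def r_def)
    qed
  qed
qed

lemma G_0: "G 0 = 0"
proof -
  let ?c = "2 * (1 + \<theta>) * (3/2) powr (1 + \<theta>)"
  have "G 0 \<le> 0"
  proof (rule le_if_le_add_vanishing[where t = 1 and M = ?c and a = \<theta>])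
    fix T :: real assume T: "1 < T"
    have "G 0 \<le> G (1 / T)" using D.F_mono T by (simp add: mono_def)
    also have "\<dots> \<le> ?c * (1 / T) powr \<theta>" using T by (intro D.F_upper) auto
    also have "(1 / T) powr \<theta> = T powr (- \<theta>)" using T by (simp add: powr_divide powr_minus_divide)
    finally show "G 0 \<le> 0 + ?c * T powr (- \<theta>)" by simp
  qed (rule X.theta)
  then show ?thesis using D.F_nonneg[of 0] by simp
qed

end

text \<open>The common shape of the majorants: a plateau near 0, an integrable power singularity and
  an inverse-square tail.\<close>

lemma nn_integral_majorant:
  fixes a b c d e \<theta> :: real
  assumes "a \<ge> 0" "b > 0" "c \<ge> 0" "d \<ge> 0" "e \<ge> 0" "\<theta> > 0"
  shows "(\<integral>\<^sup>+t. indicator {0<..} t * ennreal (d * indicator {0..a} t + c * t powr (\<theta> - 1) * indicator {0..1} t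
            + e * t powr (-2) * indicator {b..} t) \<partial>lborel) \<le> ennreal (d * a + c / \<theta> + e / b)"
proof -
  have "(\<integral>\<^sup>+t. indicator {0<..} t * ennreal (d * indicator {0..a} t + c * t powr (\<theta> - 1) * indicator {0..1} t
            + e * t powr (-2) * indicator {b..} t) \<partial>lborel)
     \<le> (\<integral>\<^sup>+t. ((indicator {0..a} t * ennreal d + indicator {0..1} t * ennreal (c * t powr (\<theta> - 1)))
            + indicator {b..} t * ennreal (e * t powr (-2))) \<partial>lborel)"
  proof (rule nn_integral_mono)
    fix t :: real
    have nn: "0 \<le> d * indicator {0..a} t" "0 \<le> c * t powr (\<theta> - 1) * indicator {0..1} t"
      "0 \<le> e * t powr (-2) * indicator {b..} t"
      using assms by simp_all
    have ind: "ennreal (x * indicator S t) = indicator S t * ennreal x" for x S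
      by (simp add: indicator_def)
    have "indicator {0<..} t * ennreal (d * indicator {0..a} t + c * t powr (\<theta> - 1) * indicator {0..1} t
            + e * t powr (-2) * indicator {b..} t)
        \<le> 1 * ennreal (d * indicator {0..a} t + c * t powr (\<theta> - 1) * indicator {0..1} t
            + e * t powr (-2) * indicator {b..} t)"
      by (intro mult_right_mono) (simp_all add: indicator_def)
    also have "\<dots> = (ennreal (d * indicator {0..a} t) + ennreal (c * t powr (\<theta> - 1) * indicator {0..1} t))
        + ennreal (e * t powr (-2) * indicator {b..} t)"
      by (simp only: ennreal_plus[OF add_nonneg_nonneg[OF nn(1,2)] nn(3)] ennreal_plus[OF nn(1,2)] mult_1)
    finally show "indicator {0<..} t * ennreal (d * indicator {0..a} t + c * t powr (\<theta> - 1) * indicator {0..1} t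
            + e * t powr (-2) * indicator {b..} t)
        \<le> (indicator {0..a} t * ennreal d + indicator {0..1} t * ennreal (c * t powr (\<theta> - 1)))
            + indicator {b..} t * ennreal (e * t powr (-2))"
      by (simp only: ind)
  qed
  also have "\<dots> = (\<integral>\<^sup>+t. indicator {0..a} t * ennreal d \<partial>lborel)
      + (\<integral>\<^sup>+t. indicator {0..1} t * ennreal (c * t powr (\<theta> - 1)) \<partial>lborel)
      + (\<integral>\<^sup>+t. indicator {b..} t * ennreal (e * t powr (-2)) \<partial>lborel)"
    by (simp add: nn_integral_add)
  also have "(\<integral>\<^sup>+t. indicator {0..a} t * ennreal d \<partial>lborel) = ennreal (d * a)"
    using has_integral_const_real[of d 0 a] assms
    by (subst mult.commute, intro nn_integral_has_integral_lebesgue') (auto simp: mult.commute)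
  also have "(\<integral>\<^sup>+t. indicator {0..1} t * ennreal (c * t powr (\<theta> - 1)) \<partial>lborel) = ennreal (c * (1 / \<theta>))"
    using has_integral_mult_right[OF has_integral_powr_from_0[of "\<theta> - 1" 1], of c] assms
    by (subst mult.commute, intro nn_integral_has_integral_lebesgue') auto
  also have "(\<integral>\<^sup>+t. indicator {b..} t * ennreal (e * t powr (-2)) \<partial>lborel) = ennreal (e * (1 / b))"
    using has_integral_mult_right[OF has_integral_powr_to_inf[of "-2" b], of e] assms
    by (subst mult.commute, intro nn_integral_has_integral_lebesgue') (auto simp: powr_minus_divide)
  finally show ?thesis using assms by (simp add: ennreal_plus[symmetric] del: ennreal_plus)
qed

lemma DERIV_max0_cube: "((\<lambda>x. (max 0 x) ^ 3) has_real_derivative 3 * (max 0 x)\<^sup>2) (at (x::real))"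
proof -
  have "((\<lambda>x. x * (max 0 x)\<^sup>2) has_real_derivative (x * (2 * max 0 x) + 1 * (max 0 x)\<^sup>2)) (at x)"
    by (intro DERIV_mult' DERIV_ident DERIV_max0_square)
  moreover have "(\<lambda>x. x * (max 0 x)\<^sup>2) = (\<lambda>x::real. (max 0 x) ^ 3)"
    by (auto simp: max_def power2_eq_square power3_eq_cube)
  moreover have "x * (2 * max 0 x) + 1 * (max 0 x)\<^sup>2 = 3 * (max 0 x)\<^sup>2"
    by (auto simp: max_def power2_eq_square)
  ultimately show ?thesis by (simp only:)
qed

section \<open>Upper and lower bounds for both distances\<close>

locale law_vs_dickman = panjer_law w y \<theta> \<kappa> M B C + D: dickman_law \<theta> D
  for w y \<theta> \<kappa> M B C D
begin

sublocale pair: law_pair lawX D ..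

sublocale dp: dickman_pair lawX.cdf0 lawX.stop lawX.mean \<theta> "c_eps / L" D.cdf0 D.stop D.mean
  by (intro dickman_pair.intro near_dickman_lawX D.near_dickman_D)

text \<open>Mertens' bound at \<open>3/2\<close>, below the first prime, forces
  \<open>M \<ge> ln (3/2)\<close>.\<close>

lemma c_eps_pos: "c_eps > 0"
proof -
  have "{p. prime p \<and> real p \<le> 3/2} = {}"
  proof -
    have "\<not> real p \<le> 3/2" if "prime p" for p using prime_ge_2_nat[OF that] by linarith
    then show ?thesis by blast
  qed
  then have "\<bar>0 - ln (3/2)\<bar> \<le> M" using M(2)[of "3/2"] by (simp only: sum.empty)
  then have "0 < M" using ln_gt_zero[of "3/2::real"] by linarith
  moreover have "0 \<le> (1 + \<theta>) * \<theta> * B" "0 \<le> (1 + \<theta>) * (\<theta> * (4 + m0)) * B" "0 \<le> \<theta> * (2 * M * (2 + m0))"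
    using theta M(1) B(1) m0_pos by (auto intro!: mult_nonneg_nonneg)
  ultimately show ?thesis unfolding c_eps_def using theta by (simp add: add_pos_nonneg)
qed

lemma mean_le: "lawX.mean \<le> m0"
  using E_X_le integral_lawX[of "\<lambda>x. x"] by (simp add: lawX.mean_def)

lemma dist_K_upper: "dist_K lawX D \<le> dk_const \<theta> * c_eps powr min 1 \<theta> / L powr min 1 \<theta>"
proof (rule pair.dist_K_le)
  fix t :: real
  have "\<bar>lawX.cdf0 t - D.cdf0 t\<bar> \<le> dk_const \<theta> * (c_eps / L) powr min 1 \<theta>"
    using c_eps_pos L_ge by (intro dp.kolmogorov_bound) auto
  then show "\<bar>lawX.cdf0 t - D.cdf0 t\<bar> \<le> dk_const \<theta> * c_eps powr min 1 \<theta> / L powr min 1 \<theta>"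
    using c_eps_pos L_ge by (simp add: powr_divide)
qed

lemma dist_11_upper: "dist_11 lawX D \<le> ereal ((2 + dk_const \<theta> / \<theta> + dk_const \<theta>) * c_eps / L)"
proof -
  let ?e = "c_eps / L" and ?c = "dk_const \<theta>"
  have e: "?e > 0" using c_eps_pos L_ge by simp
  have c: "?c \<ge> 2" by (rule dk_const_bounds(1)[OF theta])
  define \<beta> where "\<beta> t = 1 * indicator {0..2 * ?e} t + ?c * ?e * t powr (\<theta> - 1) * indicator {0..1} t
      + ?c * ?e * t powr (-2) * indicator {1..} t" for t
  have [measurable]: "\<beta> \<in> borel_measurable borel" unfolding \<beta>_def by measurable
  have ce: "?c * ?e \<ge> 0" using c e by (intro mult_nonneg_nonneg) auto
  have "dist_11 lawX D \<le> ereal (1 * (2 * ?e) + ?c * ?e / \<theta> + ?c * ?e / 1)"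
  proof (rule pair.dist_11_le)
    fix t :: real assume t: "0 < t"
    have nn: "0 \<le> ?c * ?e * t powr (\<theta> - 1) * indicator {0..1} t" "0 \<le> ?c * ?e * t powr (-2) * indicator {1..} t"
      by (intro mult_nonneg_nonneg[OF mult_nonneg_nonneg[OF ce]]; simp)+
    consider "t \<le> 2 * ?e" | "2 * ?e < t" "t \<le> 1" | "2 * ?e < t" "t > 1" by linarith
    then show "\<bar>lawX.cdf0 t - D.cdf0 t\<bar> \<le> \<beta> t"
    proof cases
      case 1
      then have "\<beta> t \<ge> 1" using t nn by (simp add: \<beta>_def)
      then show ?thesis using dp.diff_le_1[of t] by linarith
    next
      case 2
      have "\<bar>lawX.cdf0 t - D.cdf0 t\<bar> \<le> ?c * ?e * t powr (\<theta> - 1)"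
        using 2 t by (intro dp.diff_head) auto
      also have "\<dots> \<le> \<beta> t" using 2 t nn by (simp add: \<beta>_def)
      finally show ?thesis .
    next
      case 3
      have "\<bar>lawX.cdf0 t - D.cdf0 t\<bar> \<le> ?c * ?e / (t * (1 + t))" by (rule dp.diff_tail[OF t])
      also have "\<dots> \<le> ?c * ?e / (t * t)"
        using t ce by (intro divide_left_mono mult_left_mono) auto
      also have "\<dots> = ?c * ?e * t powr (-2)" using t by (simp add: powr_minus_divide power2_eq_square)
      also have "\<dots> \<le> \<beta> t" using 3 t nn by (simp add: \<beta>_def)
      finally show ?thesis .
    qed
  next
    show "(\<integral>\<^sup>+t. indicator {0<..} t * ennreal (\<beta> t) \<partial>lborel) \<le> ennreal (1 * (2 * ?e) + ?c * ?e / \<theta> + ?c * ?e / 1)"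
      unfolding \<beta>_def using e ce theta by (intro nn_integral_majorant) auto
    show "0 \<le> 1 * (2 * ?e) + ?c * ?e / \<theta> + ?c * ?e / 1"
      using e ce theta by (intro add_nonneg_nonneg divide_nonneg_nonneg[OF ce]) auto
  qed measurable
  also have "1 * (2 * ?e) + ?c * ?e / \<theta> + ?c * ?e / 1 = (2 + ?c / \<theta> + ?c) * c_eps / L"
    by (simp add: algebra_simps add_divide_distrib)
  finally show ?thesis .
qed

text \<open>The area up to \<open>R\<close> is at most \<open>R\<close> times the Kolmogorov
  distance, the rest is controlled by the decay estimate. With \<open>R\<close> large but fixed, a
  lower bound of order \<open>1 / L\<close> passes from the smooth to the Kolmogorov
  distance.\<close>

lemma dist_11_le_dist_K:
  fixes R :: real
  assumes R: "R \<ge> 1"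
  shows "dist_11 lawX D \<le> ereal (R * dist_K lawX D + dk_const \<theta> * c_eps / L / R)"
proof -
  let ?e = "c_eps / L" and ?c = "dk_const \<theta>" and ?d = "dist_K lawX D"
  have ce: "?c * ?e \<ge> 0" using c_eps_pos L_ge dk_const_bounds(1)[OF theta] by simp
  have d: "?d \<ge> 0" using pair.dist_K_ge[of 0] by simp
  define \<beta> where "\<beta> t = ?d * indicator {0..R} t + 0 * t powr (\<theta> - 1) * indicator {0..1} t
      + ?c * ?e * t powr (-2) * indicator {R..} t" for t
  have [measurable]: "\<beta> \<in> borel_measurable borel" unfolding \<beta>_def by measurable
  have "dist_11 lawX D \<le> ereal (?d * R + 0 / \<theta> + ?c * ?e / R)"
  proof (rule pair.dist_11_le)
    fix t :: real assume t: "0 < t"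
    have nn: "0 \<le> ?c * ?e * t powr (-2) * indicator {R..} t"
      by (intro mult_nonneg_nonneg[OF mult_nonneg_nonneg[OF ce]]; simp)+
    show "\<bar>lawX.cdf0 t - D.cdf0 t\<bar> \<le> \<beta> t"
    proof (cases "t \<le> R")
      case True
      then have "?d \<le> \<beta> t" using t nn by (simp add: \<beta>_def)
      then show ?thesis using pair.dist_K_ge[of t] t by simp
    next
      case False
      have "\<bar>lawX.cdf0 t - D.cdf0 t\<bar> \<le> ?c * ?e / (t * (1 + t))" by (rule dp.diff_tail[OF t])
      also have "\<dots> \<le> ?c * ?e / (t * t)"
        using t ce by (intro divide_left_mono mult_left_mono) auto
      also have "\<dots> = ?c * ?e * t powr (-2)" using t by (simp add: powr_minus_divide power2_eq_square)
      also have "\<dots> \<le> \<beta> t" using False t nn by (simp add: \<beta>_def)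
      finally show ?thesis .
    qed
  next
    show "(\<integral>\<^sup>+t. indicator {0<..} t * ennreal (\<beta> t) \<partial>lborel) \<le> ennreal (?d * R + 0 / \<theta> + ?c * ?e / R)"
      unfolding \<beta>_def using d ce theta R by (intro nn_integral_majorant) auto
    show "0 \<le> ?d * R + 0 / \<theta> + ?c * ?e / R" using d ce R by (intro add_nonneg_nonneg divide_nonneg_nonneg[OF ce]) auto
  qed measurable
  then show ?thesis by (simp add: mult.commute)
qed

lemma atom_eq: "E (\<lambda>N. of_bool (X N \<le> t)) = lawX.cdf0 t"
  using integral_lawX[of "\<lambda>x. of_bool (x \<le> t)"] by (simp add: lawX.cdf0_eq)

lemma dist_K_ge_atom: "E (\<lambda>N. of_bool (X N \<le> 0)) \<le> dist_K lawX D"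
  using pair.dist_K_ge[of 0] dp.G_0 lawX.cdf0_def[of 0] by (simp add: atom_eq)

text \<open>The value of \<open>I_lower\<close> at \<open>t = 1\<close>, made uniform in
  \<open>n\<close> by \<open>\<epsilon> \<le> 1/2\<close> and by the bound \<open>m0\<close> for the
  mean.\<close>

definition "c_stop = (1 / (2 * (m0 + 1))) powr (1 + \<theta>)"

lemma stop_1_ge: assumes "2 * c_eps \<le> L" shows "c_stop \<le> lawX.stop 1"
proof -
  have e: "c_eps / L \<le> 1/2" using assms L_ge by (simp add: divide_le_eq)
  then have e1: "c_eps / L \<le> 1" by linarith
  have "c_stop \<le> ((1 - c_eps / L) / (lawX.mean + 1)) powr (1 + \<theta>)"
    unfolding c_stop_def
  proof (rule powr_mono2)
    have "(1/2) / (m0 + 1) \<le> (1 - c_eps / L) / (lawX.mean + 1)"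
      using e e1 mean_le dp.X.m_nonneg by (intro frac_le) auto
    then show "1 / (2 * (m0 + 1)) \<le> (1 - c_eps / L) / (lawX.mean + 1)" by simp
  qed (use m0_pos theta in auto)
  also have "\<dots> \<le> lawX.stop 1"
  proof (rule dp.X.I_lower)
    show "c_eps / L < 1" "1 \<le> lawX.mean + 1" using e dp.X.m_nonneg by linarith+
  qed
  finally show ?thesis .
qed

text \<open>\<open>I_lower\<close> at \<open>2 * \<epsilon>\<close> makes
  \<open>F (2 * \<epsilon>)\<close> at least of order \<open>\<epsilon> powr \<theta>\<close>. As
  \<open>\<epsilon> = c_eps / L\<close>, the event \<open>X \<le> 2 * \<epsilon>\<close> means
  \<open>N \<le> exp (2 * c_eps)\<close>, a bound free of \<open>n\<close>; so
  \<open>atom_lower\<close> assigns a fixed share of this mass to the atom at 0, where the Dickman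
  law has none.\<close>

lemma dist_K_ge_power:
  assumes L: "2 * c_eps \<le> L" and c: "\<And>N. w N \<le> c N" "\<And>N. 0 \<le> c N"
  shows "(c_eps / (m0 + 1)) powr (1 + \<theta>) / (2 * c_eps) / (1 + (\<Sum>N\<in>{1..nat \<lceil>exp (2 * c_eps)\<rceil>}. c N)) / L powr \<theta>
           \<le> dist_K lawX D"
proof -
  let ?e = "c_eps / L" and ?K = "nat \<lceil>exp (2 * c_eps)\<rceil>"
  have e: "0 < ?e" "?e \<le> 1/2" using c_eps_pos L L_ge by (auto simp: divide_le_eq)
  let ?S = "\<Sum>N\<in>{1..?K}. c N"
  have S: "?S \<ge> 0" by (intro sum_nonneg c)
  have "(?e / (m0 + 1)) powr (1 + \<theta>) \<le> ((2 * ?e - ?e) / (lawX.mean + 1)) powr (1 + \<theta>)"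
    using e mean_le m0_pos dp.X.m_nonneg theta divide_nonneg_pos[of ?e "m0 + 1"]
    by (intro powr_mono2 frac_le) auto
  also have "\<dots> \<le> lawX.stop (2 * ?e)"
  proof (rule dp.X.I_lower)
    show "?e < 2 * ?e" "2 * ?e \<le> lawX.mean + 1" using e dp.X.m_nonneg by linarith+
  qed
  also have "\<dots> \<le> lawX.cdf0 (2 * ?e) * (2 * ?e)" using e by (intro dp.X.I_le) auto
  finally have "(?e / (m0 + 1)) powr (1 + \<theta>) / (2 * ?e) \<le> lawX.cdf0 (2 * ?e)"
    using e by (simp only: pos_divide_le_eq)
  also have "\<dots> = E (\<lambda>N. of_bool (X N \<le> 2 * ?e))" by (simp add: atom_eq)
  also have "\<dots> \<le> E (\<lambda>N. of_bool (real N \<le> real ?K))"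
  proof (rule E_mono)
    fix N assume "w N \<noteq> 0"
    then have N: "N > 0" by (rule w_pos_imp)
    have "real N \<le> real ?K" if "X N \<le> 2 * ?e"
    proof -
      have "ln (real N) \<le> 2 * c_eps" using that L_ge by (simp add: X_def divide_le_cancel field_simps)
      then have "real N \<le> exp (2 * c_eps)" using N by (metis exp_le_cancel_iff exp_ln of_nat_0_less_iff)
      then show ?thesis by linarith
    qed
    then show "of_bool (X N \<le> 2 * ?e) \<le> (of_bool (real N \<le> real ?K) :: real)" by auto
  qed (auto intro!: integrable_bounded)
  also have "\<dots> \<le> ?S * E (\<lambda>N. of_bool (X N \<le> 0))" by (rule atom_lower) (fact c)+
  also have "\<dots> \<le> ?S * dist_K lawX D" by (intro mult_left_mono dist_K_ge_atom S)
  \<comment> \<open>Adding 1 makes the factor positive, so that it can be divided by.\<close>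
  also have "\<dots> \<le> (1 + ?S) * dist_K lawX D"
    using order_trans[OF less_imp_le[OF atom_pos] dist_K_ge_atom] by (intro mult_right_mono) auto
  finally have "(?e / (m0 + 1)) powr (1 + \<theta>) / (2 * ?e) / (1 + ?S) \<le> dist_K lawX D"
    using S by (simp only: pos_divide_le_eq[of "1 + ?S"] add_pos_nonneg zero_less_one mult.commute[of _ "1 + ?S"])
  also have "(?e / (m0 + 1)) powr (1 + \<theta>) / (2 * ?e) = (c_eps / (m0 + 1)) powr (1 + \<theta>) / (2 * c_eps) / L powr \<theta>"
  proof -
    have "(?e / (m0 + 1)) = (c_eps / (m0 + 1)) / L" by simp
    then have "(?e / (m0 + 1)) powr (1 + \<theta>) = (c_eps / (m0 + 1)) powr (1 + \<theta>) / (L * L powr \<theta>)"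
      using c_eps_pos m0_pos L_ge by (simp only: powr_divide) (simp add: powr_add)
    then show ?thesis using L_ge c_eps_pos by (simp add: field_simps)
  qed
  finally show ?thesis by (simp add: mult_ac)
qed

text \<open>The mean of \<open>\<phi>\<close> is 0 under the Dickman law by
  \<open>test_identity\<close> and negative of order \<open>1 / L\<close> under \<open>X\<close> by
  \<open>law_test\<close>. The second condition on \<open>L\<close> makes the term
  \<open>C / L^2\<close> at most half of the main one.\<close>

lemma dist_11_lower:
  assumes L: "2 * c_eps \<le> L" "2 * C / ((1 - ln 2) * c_stop ^ 2) \<le> L"
  shows "ereal (\<theta> * (1 - ln 2) * c_stop ^ 2 / 2 / L / (8 + 2 * \<theta>)) \<le> dist_11 lawX D"
proof -
  define u where "u x = max 0 (1 - x)" for x :: real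
  define \<phi> where "\<phi> x = x * u x ^ 2 - \<theta> * u x ^ 3 / 3" for x
  define \<phi>' where "\<phi>' x = (1 + \<theta>) * u x ^ 2 - 2 * (x * u x)" for x
  have u01: "0 \<le> u x" "u x \<le> 1" if "0 \<le> x" for x using that by (auto simp: u_def)
  have \<phi>'_eq: "\<phi>' x = (3 + \<theta>) * u x ^ 2 - 2 * u x" if "0 \<le> x" for x
  proof -
    have "x * u x = u x - u x ^ 2" by (auto simp: u_def max_def power2_eq_square algebra_simps)
    then show ?thesis by (simp add: \<phi>'_def algebra_simps)
  qed
  have c_stop: "c_stop > 0" using m0_pos by (simp add: c_stop_def)
  have l2: "1 - ln 2 > (0::real)" using ln_2_less_1 by simp
  have deriv: "(\<phi> has_real_derivative \<phi>' x) (at x)" for x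
  proof -
    have d1: "((\<lambda>x. 1 - x) has_real_derivative -1) (at x)" by (auto intro!: derivative_eq_intros)
    have u2: "((\<lambda>x. u x ^ 2) has_real_derivative 2 * u x * -1) (at x)"
      unfolding u_def by (rule DERIV_chain2[OF DERIV_max0_square d1])
    have u3: "((\<lambda>x. u x ^ 3) has_real_derivative 3 * u x ^ 2 * -1) (at x)"
      unfolding u_def by (rule DERIV_chain2[OF DERIV_max0_cube d1])
    have "(\<phi> has_real_derivative (x * (2 * u x * -1) + 1 * u x ^ 2 - \<theta> * (3 * u x ^ 2 * -1) / 3)) (at x)"
      unfolding \<phi>_def by (intro DERIV_diff DERIV_mult' DERIV_ident DERIV_cdivide DERIV_cmult u2 u3)
    then show ?thesis by (simp add: \<phi>'_def algebra_simps)
  qed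
  have cont: "continuous_on UNIV \<phi>"
    by (rule DERIV_continuous_on[OF has_field_derivative_at_within[OF deriv]])
  then have [measurable]: "\<phi> \<in> borel_measurable borel" by (rule borel_measurable_continuous_onI)
  have u_pow: "0 \<le> u x ^ k" "u x ^ k \<le> 1" if "0 \<le> x" for x k using u01[OF that] by (auto intro: power_le_one)
  have xu: "0 \<le> x * u x ^ 2" "x * u x ^ 2 \<le> 1" if "0 \<le> x" for x
    using u_pow[OF that, of 2] that by (cases "x \<le> 1"; auto simp: u_def intro: mult_le_one)+
  have bdd: "norm (\<phi> x) \<le> 1 + \<theta>" if "0 \<le> x" for x
  proof -
    have "0 \<le> \<theta> * u x ^ 3 / 3" using u_pow[OF that, of 3] theta by simp
    moreover have "\<theta> * u x ^ 3 / 3 \<le> \<theta>"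
      using mult_left_mono[OF u_pow(2)[OF that, of 3], of \<theta>] theta by simp
    ultimately show ?thesis unfolding \<phi>_def real_norm_def using xu[OF that] theta by linarith
  qed
  have iX: "integrable lawX \<phi>"
    by (rule lawX.integrable_const_bound[where B = "1 + \<theta>"])
       (use bdd lawX.nonneg in \<open>auto elim!: eventually_mono\<close>)
  have iD: "integrable D \<phi>"
    by (rule D.integrable_const_bound[where B = "1 + \<theta>"])
       (use bdd D.nonneg in \<open>auto elim!: eventually_mono\<close>)
  have ED: "(\<integral>x. \<phi> x \<partial>D) = 0"
    using D.test_identity by (simp add: \<phi>_def u_def)
  have EX: "(\<integral>x. \<phi> x \<partial>lawX) \<le> - (\<theta> * (1 - ln 2) * c_stop ^ 2 / 2 / L)"
  proof -
    have uX: "u (X N) = U N" for N by (simp add: u_def U_def)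
    have abs1: "\<bar>U N ^ k\<bar> \<le> 1" for N k using U_power_bounds[of N k] by simp
    have iU: "integrable (measure_pmf q) (\<lambda>N. U N ^ k)" for k by (rule integrable_bounded[OF abs1])
    have iU1: "integrable (measure_pmf q) U" using iU[of 1] by simp
    have xu': "\<bar>X N * U N ^ 2\<bar> \<le> 1" for N using xu[OF X_nonneg[of N]] by (simp add: uX)
    have "(\<integral>x. \<phi> x \<partial>lawX) = E (\<lambda>N. X N * U N ^ 2 - \<theta> * (U N ^ 3 / 3))"
      by (subst integral_lawX) (auto simp: \<phi>_def uX)
    also have "\<dots> = E (\<lambda>N. X N * U N ^ 2) - \<theta> * E (\<lambda>N. U N ^ 3 / 3)"
      by (subst Bochner_Integration.integral_diff)
         (auto intro!: integrable_bounded xu' integrable_mult_right integrable_divide iU)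
    also have "\<dots> \<le> - (\<theta> * (1 - ln 2) / L * E (\<lambda>N. U N ^ 2)) + \<theta> * C / L ^ 2"
      using law_test by simp
    also have "\<dots> \<le> - (\<theta> * (1 - ln 2) / L * c_stop ^ 2) + \<theta> * C / L ^ 2"
    proof -
      define a where "a = E U"
      have "a = lawX.stop 1"
        using integral_lawX[of "\<lambda>x. max 0 (1 - x)"] by (simp add: a_def lawX.stop_def U_def[abs_def])
      then have a: "c_stop \<le> a" using stop_1_ge L by simp
      \<comment> \<open>Jensen's inequality for the square, through the tangent at the mean
        \<open>a\<close>.\<close>
      have "E (\<lambda>N. 2 * a * U N - a ^ 2) \<le> E (\<lambda>N. U N ^ 2)"
      proof (rule E_mono)
        show "integrable (measure_pmf q) (\<lambda>N. 2 * a * U N - a ^ 2)"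
          by (intro Bochner_Integration.integrable_diff integrable_mult_right iU1) auto
        show "2 * a * U N - a ^ 2 \<le> U N ^ 2" for N
          using zero_le_power2[of "U N - a"] by (simp add: power2_eq_square algebra_simps)
      qed (rule iU)
      moreover have "E (\<lambda>N. 2 * a * U N - a ^ 2) = a ^ 2"
        using iU1 by (simp add: a_def[symmetric] power2_eq_square)
      moreover have "c_stop ^ 2 \<le> a ^ 2" using a c_stop by (intro power_mono) auto
      ultimately have "c_stop ^ 2 \<le> E (\<lambda>N. U N ^ 2)" by linarith
      then have "\<theta> * (1 - ln 2) / L * c_stop ^ 2 \<le> \<theta> * (1 - ln 2) / L * E (\<lambda>N. U N ^ 2)"
        using theta l2 L_ge by (intro mult_left_mono) auto
      then show ?thesis by simp
    qed
    also have "\<theta> * C / L ^ 2 \<le> \<theta> * (1 - ln 2) * c_stop ^ 2 / 2 / L"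
    proof -
      have "2 * C \<le> L * ((1 - ln 2) * c_stop ^ 2)"
        using L(2) l2 c_stop by (simp add: divide_le_eq)
      then have "C / L ^ 2 \<le> (1 - ln 2) * c_stop ^ 2 / 2 / L"
        using L_ge by (simp add: field_simps power2_eq_square)
      then have "\<theta> * (C / L ^ 2) \<le> \<theta> * ((1 - ln 2) * c_stop ^ 2 / 2 / L)"
        using theta by (intro mult_left_mono) auto
      then show ?thesis by simp
    qed
    also have "- (\<theta> * (1 - ln 2) / L * c_stop ^ 2) + \<theta> * (1 - ln 2) * c_stop ^ 2 / 2 / L
        = - (\<theta> * (1 - ln 2) * c_stop ^ 2 / 2 / L)" by simp
    finally show ?thesis by simp
  qed
  have pos: "0 \<le> \<theta> * (1 - ln 2) * c_stop ^ 2 / 2 / L" using theta l2 L_ge by simp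
  have "ereal (\<bar>(\<integral>x. \<phi> x \<partial>lawX) - (\<integral>x. \<phi> x \<partial>D)\<bar> / (8 + 2 * \<theta>)) \<le> dist_11 lawX D"
  proof (rule pair.dist_11_ge_test[OF deriv _ _ _ iX iD])
    \<comment> \<open>On the half-line \<open>\<phi>'\<close> is the polynomial
      \<open>(3 + \<theta>) * u ^ 2 - 2 * u\<close>, and for \<open>u\<close> in
      \<open>[0, 1]\<close> its difference quotients in \<open>u\<close> are at most
      \<open>2 * (3 + \<theta>) + 2\<close> in absolute value.\<close>
    show "8 + 2 * \<theta> > 0" using theta by simp
    fix x :: real assume x: "0 \<le> x"
    have "0 \<le> (3 + \<theta>) * u x ^ 2" "(3 + \<theta>) * u x ^ 2 \<le> (3 + \<theta>) * 1"
      using u_pow[OF x, of 2] theta by (intro mult_nonneg_nonneg mult_left_mono; simp)+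
    moreover have "\<bar>a - 2 * b\<bar> \<le> 8 + 2 * \<theta>" if "0 \<le> a" "a \<le> (3 + \<theta>) * 1" "0 \<le> b" "b \<le> 1" for a b
      using that theta by (simp add: abs_le_iff)
    ultimately show "\<bar>\<phi>' x\<bar> \<le> 8 + 2 * \<theta>"
      unfolding \<phi>'_eq[OF x] using u01[OF x] by blast
    fix y :: real assume y: "0 \<le> y"
    have "\<phi>' x - \<phi>' y = (u x - u y) * ((3 + \<theta>) * (u x + u y) - 2)"
      unfolding \<phi>'_eq[OF x] \<phi>'_eq[OF y] by (simp add: power2_eq_square algebra_simps)
    moreover have "\<bar>(3 + \<theta>) * (u x + u y) - 2\<bar> \<le> 8 + 2 * \<theta>"
    proof -
      have "0 \<le> (3 + \<theta>) * (u x + u y)" "(3 + \<theta>) * (u x + u y) \<le> (3 + \<theta>) * 2"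
        using u01[OF x] u01[OF y] theta by (intro mult_nonneg_nonneg mult_left_mono; simp)+
      then show ?thesis using theta by (simp add: abs_le_iff)
    qed
    moreover have "\<bar>u x - u y\<bar> \<le> \<bar>x - y\<bar>" by (auto simp: u_def)
    ultimately have "\<bar>\<phi>' x - \<phi>' y\<bar> \<le> \<bar>x - y\<bar> * (8 + 2 * \<theta>)"
      by (simp only: abs_mult) (intro mult_mono, auto)
    then show "\<bar>\<phi>' x - \<phi>' y\<bar> \<le> (8 + 2 * \<theta>) * \<bar>x - y\<bar>" by (simp only: mult.commute)
  qed
  moreover have "\<theta> * (1 - ln 2) * c_stop ^ 2 / 2 / L \<le> \<bar>(\<integral>x. \<phi> x \<partial>lawX) - (\<integral>x. \<phi> x \<partial>D)\<bar>"
    using EX ED pos by linarith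
  then have "\<theta> * (1 - ln 2) * c_stop ^ 2 / 2 / L / (8 + 2 * \<theta>) \<le> \<bar>(\<integral>x. \<phi> x \<partial>lawX) - (\<integral>x. \<phi> x \<partial>D)\<bar> / (8 + 2 * \<theta>)"
    using theta by (intro divide_right_mono) auto
  ultimately show ?thesis
    by (meson ereal_less_eq(3) order_trans)
qed

text \<open>The test function \<open>(max 0 (s - x))\<^sup>2 / 2\<close> with small \<open>s\<close> separates the atom at \<open>0\<close> from \<open>D\<close>.\<close>

lemma dist_11_ge_atom:
  fixes a :: real
  assumes a: "0 < a" "a \<le> E (\<lambda>N. of_bool (X N \<le> 0))"
  defines "c \<equiv> 2 * (1 + \<theta>) * (3/2) powr (1 + \<theta>)"
  defines "s \<equiv> min 1 ((a / (2 * c)) powr (1 / \<theta>))"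
  shows "ereal (s ^ 2 * a / 4) \<le> dist_11 lawX D"
proof -
  have c: "c > 0" using theta by (simp add: c_def)
  have s: "0 < s" "s \<le> 1" using a c by (auto simp: s_def)
  \<comment> \<open>The choice of \<open>s\<close> keeps the Dickman mass of \<open>{..s}\<close>,
    at most \<open>c * s powr \<theta>\<close>, below half of the atom.\<close>
  have "s powr \<theta> \<le> ((a / (2 * c)) powr (1 / \<theta>)) powr \<theta>"
    using s theta by (intro powr_mono2) (auto simp: s_def)
  also have "\<dots> = a / (2 * c)" using theta a c by (simp add: powr_powr)
  finally have cs: "c * s powr \<theta> \<le> a / 2" using c by (simp add: field_simps)
  define v where "v x = max 0 (s - x)" for x :: real
  have deriv: "((\<lambda>x. v x ^ 2 / 2) has_real_derivative - v x) (at x)" for x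
  proof -
    have d1: "((\<lambda>x. s - x) has_real_derivative -1) (at x)" by (auto intro!: derivative_eq_intros)
    have "((\<lambda>x. v x ^ 2) has_real_derivative 2 * v x * -1) (at x)"
      unfolding v_def by (rule DERIV_chain2[OF DERIV_max0_square d1])
    from DERIV_cdivide[OF this, of 2] show ?thesis by simp
  qed
  have [measurable]: "v \<in> borel_measurable borel" unfolding v_def by measurable
  have v: "0 \<le> v x" "v x \<le> s * of_bool (x \<le> s)" if "0 \<le> x" for x using that s by (auto simp: v_def)
  have v2: "v x ^ 2 / 2 \<le> s ^ 2 / 2 * of_bool (x \<le> s)" if "0 \<le> x" for x
    using power_mono[OF v(2)[OF that] v(1)[OF that], of 2] by (cases "x \<le> s") auto
  have s1: "s ^ 2 / 2 \<le> 1" using s power_le_one[of s 2] by simp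
  have i: "AE x in lawX. norm (v x ^ 2 / 2) \<le> 1" "AE x in D. norm (v x ^ 2 / 2) \<le> 1"
  proof -
    have *: "norm (v x ^ 2 / 2) \<le> 1" if "0 \<le> x" for x
      using v2[OF that] s1 by (cases "x \<le> s") auto
    show "AE x in lawX. norm (v x ^ 2 / 2) \<le> 1" using lawX.nonneg by eventually_elim (rule *)
    show "AE x in D. norm (v x ^ 2 / 2) \<le> 1" using D.nonneg by eventually_elim (rule *)
  qed
  have iX: "integrable lawX (\<lambda>x. v x ^ 2 / 2)"
    by (rule lawX.integrable_const_bound[OF i(1)]) measurable
  have iD: "integrable D (\<lambda>x. v x ^ 2 / 2)"
    by (rule D.integrable_const_bound[OF i(2)]) measurable
  have io: "integrable D (\<lambda>x. s ^ 2 / 2 * of_bool (x \<le> s))" "integrable lawX (\<lambda>x. s ^ 2 / 2 * of_bool (x \<le> 0))"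
    by (intro integrable_mult_right D.integrable_const_bound[where B = 1]; simp)
       (intro integrable_mult_right lawX.integrable_const_bound[where B = 1]; simp)
  have "(\<integral>x. v x ^ 2 / 2 \<partial>D) \<le> (\<integral>x. s ^ 2 / 2 * of_bool (x \<le> s) \<partial>D)"
  proof (intro integral_mono_AE iD io)
    show "AE x in D. v x ^ 2 / 2 \<le> s ^ 2 / 2 * of_bool (x \<le> s)"
      using D.nonneg by eventually_elim (rule v2)
  qed
  also have "\<dots> = s ^ 2 / 2 * D.cdf0 s" by (simp add: D.cdf0_eq)
  also have "\<dots> \<le> s ^ 2 / 2 * (a / 2)"
    using dp.D.F_upper[of s] s cs by (intro mult_left_mono) (auto simp: c_def)
  finally have D: "(\<integral>x. v x ^ 2 / 2 \<partial>D) \<le> s ^ 2 / 2 * (a / 2)" .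
  have "s ^ 2 / 2 * a \<le> s ^ 2 / 2 * lawX.cdf0 0" using a atom_eq[of 0] by (intro mult_left_mono) auto
  also have "\<dots> = (\<integral>x. s ^ 2 / 2 * of_bool (x \<le> 0) \<partial>lawX)" by (simp add: lawX.cdf0_eq)
  also have "\<dots> \<le> (\<integral>x. v x ^ 2 / 2 \<partial>lawX)"
  proof (intro integral_mono_AE iX io)
    show "AE x in lawX. s ^ 2 / 2 * of_bool (x \<le> 0) \<le> v x ^ 2 / 2"
      using lawX.nonneg by eventually_elim (use s in \<open>auto simp: v_def\<close>)
  qed
  finally have "s ^ 2 / 2 * a - s ^ 2 / 2 * (a / 2) \<le> (\<integral>x. v x ^ 2 / 2 \<partial>lawX) - (\<integral>x. v x ^ 2 / 2 \<partial>D)"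
    using D by (rule diff_mono)
  moreover have "s ^ 2 / 2 * a - s ^ 2 / 2 * (a / 2) = s ^ 2 * a / 4" by simp
  ultimately have "s ^ 2 * a / 4 \<le> (\<integral>x. v x ^ 2 / 2 \<partial>lawX) - (\<integral>x. v x ^ 2 / 2 \<partial>D)"
    by (simp only:)
  then have "s ^ 2 * a / 4 \<le> \<bar>(\<integral>x. v x ^ 2 / 2 \<partial>lawX) - (\<integral>x. v x ^ 2 / 2 \<partial>D)\<bar> / 1"
    unfolding div_by_1 by (rule order_trans[OF _ abs_ge_self])
  moreover have "ereal (\<bar>(\<integral>x. v x ^ 2 / 2 \<partial>lawX) - (\<integral>x. v x ^ 2 / 2 \<partial>D)\<bar> / 1) \<le> dist_11 lawX D"
  proof (rule pair.dist_11_ge_test[OF deriv _ _ _ iX iD])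
    show "\<bar>- v x - - v y\<bar> \<le> 1 * \<bar>x - y\<bar>" for x y by (auto simp: v_def)
    show "\<bar>- v x\<bar> \<le> 1" if "0 \<le> x" for x using that s by (auto simp: v_def)
  qed simp
  ultimately show ?thesis by (meson ereal_less_eq(3) order_trans)
qed

end

section \<open>The random integers of the theorem\<close>

context panjer_law
begin

lemma infsum_eq_Z:
  assumes w: "\<And>N. w N = (if N \<in> A then g N else 0)"
  shows "infsum g A = Z"
proof -
  have "infsum g A = infsum w UNIV"
    by (rule infsum_cong_neutral) (auto simp: w)
  also have "(w has_sum Z) UNIV"
    by (rule norm_summable_imp_has_sum) (auto simp: w_nonneg summable_w Z_def intro!: summable_sums)
  then have "infsum w UNIV = Z" by (rule infsumI)
  finally show ?thesis .
qed

text \<open>Links the point measure used to state the theorem to the probability mass function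
  \<open>q\<close>, which puts no mass outside \<open>A\<close>.\<close>

lemma distr_point_measure_eq:
  assumes w: "\<And>N. w N = (if N \<in> A then g N else 0)"
  shows "distr (point_measure A (\<lambda>N. ennreal (1 / infsum g A * g N))) borel X = lawX"
proof (rule measure_eqI)
  fix S assume "S \<in> sets (distr (point_measure A (\<lambda>N. ennreal (1 / infsum g A * g N))) borel X)"
  then have S: "S \<in> sets borel" by simp
  have "emeasure (distr (point_measure A (\<lambda>N. ennreal (1 / infsum g A * g N))) borel X) S
      = emeasure (point_measure A (\<lambda>N. ennreal (1 / infsum g A * g N))) (X -` S \<inter> A)"
    using S by (subst emeasure_distr) (auto simp: space_point_measure)
  also have "\<dots> = (\<integral>\<^sup>+N. ennreal (1 / Z * g N) * indicator (X -` S \<inter> A) N \<partial>count_space A)"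
    unfolding point_measure_def infsum_eq_Z[OF w] by (subst emeasure_density) auto
  also have "\<dots> = (\<integral>\<^sup>+N. ennreal (1 / Z * g N) * indicator (X -` S \<inter> A) N * indicator A N \<partial>count_space UNIV)"
    by (rule nn_integral_count_space_indicator) simp
  also have "\<dots> = (\<integral>\<^sup>+N. ennreal (pmf q N) * indicator (X -` S) N \<partial>count_space UNIV)"
    by (rule nn_integral_cong) (auto simp: pmf_q w indicator_def)
  also have "\<dots> = emeasure (measure_pmf q) (X -` S)"
    unfolding measure_pmf_eq_density by (subst emeasure_density) auto
  also have "\<dots> = emeasure lawX S"
    unfolding lawX_def using S by (subst emeasure_distr) auto
  finally show "emeasure (distr (point_measure A (\<lambda>N. ennreal (1 / infsum g A * g N))) borel X) S = emeasure lawX S" .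
qed (simp add: lawX_def)

end

section \<open>The recursion for the weights of the theorem\<close>

lemma tau_mult_prime:
  assumes p: "prime p" and m: "m > 0"
  shows "tau \<theta> (p * m) * (val p m + 1) = tau \<theta> m * (\<theta> + val p m)"
proof -
  define j where "j = multiplicity p m"
  obtain m' where m': "m = p ^ j * m'" "\<not> p dvd m'"
  proof -
    have "m \<noteq> 0" "\<not> is_unit p" using m p not_prime_unit by auto
    from multiplicity_decompose'[OF this] that show thesis unfolding j_def by blast
  qed
  have m'0: "m' > 0" using m m' by (cases m') auto
  have cop: "coprime (p ^ k) m'" for k
    using p m'(2) by (simp add: prime_imp_coprime)
  have tau: "tau \<theta> (p ^ k * m') = pochhammer \<theta> k / fact k * tau \<theta> m'" for k
    using tau_mult_coprime[OF cop _ m'0] prime_gt_0_nat[OF p] by (simp add: tau_prime_power[OF p])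
  have "tau \<theta> (p * m) = pochhammer \<theta> (Suc j) / fact (Suc j) * tau \<theta> m'"
    using tau[of "Suc j"] m' by (simp add: mult.assoc)
  moreover have "tau \<theta> m = pochhammer \<theta> j / fact j * tau \<theta> m'"
    using tau[of j] m' by simp
  \<comment> \<open>Raising the exponent from \<open>j\<close> to \<open>j + 1\<close> multiplies
    the value by \<open>(\<theta> + j) / (j + 1)\<close>.\<close>
  moreover have "pochhammer \<theta> (Suc j) / fact (Suc j) * (real j + 1) = pochhammer \<theta> j / fact j * (\<theta> + real j)"
  proof -
    have "pochhammer \<theta> (Suc j) / fact (Suc j) * (real j + 1)
        = (real j + 1) * (pochhammer \<theta> j * (\<theta> + real j)) / ((real j + 1) * fact j)"
      by (simp add: pochhammer_Suc add.commute mult_ac)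
    also have "\<dots> = pochhammer \<theta> j / fact j * (\<theta> + real j)"
      by (subst mult_divide_mult_cancel_left) auto
    finally show ?thesis .
  qed
  ultimately show ?thesis unfolding j_def[symmetric]
    by (metis (no_types, lifting) mult.assoc mult.commute)
qed

lemma tau_nonneg: assumes "\<theta> > 0" shows "tau \<theta> N \<ge> 0"
  unfolding tau_def using assms
  by (intro prod_nonneg divide_nonneg_nonneg ballI) (auto intro: less_imp_le pochhammer_pos)

lemma smooth_mult_prime:
  assumes "prime p" "p \<le> nth_prime n"
  shows "p * m \<in> smooth n \<longleftrightarrow> m \<in> smooth n"
  using assms prime_gt_0_nat[of p] by (auto simp: smooth_def prime_dvd_mult_iff dest: primes_dvd_imp_eq)

lemma nth_prime_ge_2: "nth_prime n \<ge> 2"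
  using prime_nth_prime prime_ge_2_nat by blast

text \<open>The denominator \<open>real (p * m)\<close> supplies the factor \<open>1 / p\<close>,
  and the pochhammer recursion has \<open>\<kappa> = 1\<close>.\<close>

lemma panjer_weight_smooth:
  assumes theta: "\<theta> > 0"
  shows "panjer_weight (\<lambda>N. if N \<in> smooth n then tau \<theta> N / real N else 0) (nth_prime n) \<theta> 1"
proof
  fix p m assume p: "prime p" "p \<le> nth_prime n" and m: "0 < (m :: nat)"
  have "tau \<theta> (p * m) / real (p * m) * (val p m + 1) = tau \<theta> m / real m * (\<theta> + 1 * val p m) / real p"
    using tau_mult_prime[OF p(1) m, of \<theta>] m prime_gt_0_nat[OF p(1)] by (simp add: field_simps)
  then show "(if p * m \<in> smooth n then tau \<theta> (p * m) / real (p * m) else 0) * (val p m + 1)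
     = (if m \<in> smooth n then tau \<theta> m / real m else 0) * (\<theta> + 1 * val p m) / real p"
    by (simp only: smooth_mult_prime[OF p]) simp
qed (use theta tau_nonneg[OF theta] nth_prime_ge_2 tau_1[of \<theta>] in
      \<open>auto simp: smooth_def split: if_splits\<close>)

text \<open>With \<open>\<kappa> = - \<theta>\<close> the factor
  \<open>\<theta> + \<kappa> * val p m\<close> is \<open>\<theta>\<close> when \<open>p\<close> does
  not divide \<open>m\<close> and 0 when it divides \<open>m\<close> once, which is how square-free
  integers extend.\<close>

lemma panjer_weight_smooth_sq:
  assumes theta: "\<theta> > 0"
  shows "panjer_weight (\<lambda>N. if N \<in> smooth_sq n then tau \<theta> N / real N else 0) (nth_prime n) \<theta> (- \<theta>)"
proof
  fix p m assume p: "prime p" "p \<le> nth_prime n" and m: "0 < (m :: nat)"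
  note sm = smooth_mult_prime[OF p, of m]
  show "(if p * m \<in> smooth_sq n then tau \<theta> (p * m) / real (p * m) else 0) * (val p m + 1)
     = (if m \<in> smooth_sq n then tau \<theta> m / real m else 0) * (\<theta> + - \<theta> * val p m) / real p"
  proof (cases "m \<in> smooth_sq n")
    case False
    then have "p * m \<notin> smooth_sq n"
      using sm squarefree_mono[of m "p * m"] by (auto simp: smooth_sq_def)
    then show ?thesis using False by simp
  next
    case True
    show ?thesis
    proof (cases "p dvd m")
      case False
      then have "coprime p m" using p by (simp add: prime_imp_coprime)
      moreover have "squarefree p" using p(1) by (rule squarefree_prime)
      ultimately have "squarefree (p * m)"
        using True by (intro squarefree_mult_coprime) (auto simp: smooth_sq_def)
      then have "p * m \<in> smooth_sq n" using True sm by (auto simp: smooth_sq_def)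
      moreover have "multiplicity p m = 0" using False by (rule not_dvd_imp_multiplicity_0)
      ultimately show ?thesis
        using True tau_mult_prime[OF p(1) m, of \<theta>] m prime_gt_0_nat[OF p(1)] by (simp add: field_simps)
    next
      case dvd: True
      have "p ^ 2 dvd p * m" using dvd by (simp add: power2_eq_square)
      then have "\<not> squarefree (p * m)" using p(1) not_prime_unit squarefreeD by blast
      then have "p * m \<notin> smooth_sq n" by (simp add: smooth_sq_def)
      moreover have "multiplicity p m = 1"
      proof -
        have "\<not> p ^ 2 dvd m" using True p(1) not_prime_unit squarefreeD by (auto simp: smooth_sq_def)
        moreover have "1 \<le> multiplicity p m" using dvd m p(1) not_prime_unit by (intro multiplicity_geI) auto
        ultimately show ?thesis
          using multiplicity_dvd'[of 2 p m] by (cases "2 \<le> multiplicity p m") auto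
      qed
      ultimately show ?thesis by simp
    qed
  qed
qed (use theta tau_nonneg[OF theta] nth_prime_ge_2 tau_1[of \<theta>] in
      \<open>auto simp: smooth_sq_def smooth_def split: if_splits\<close>)

text \<open>A bound for large \<open>n\<close> becomes one for all \<open>n \<ge> 2\<close> by a
  minimum with finitely many positive numbers \<open>a n * g n\<close>; these may depend on
  \<open>n\<close> but not on \<open>D\<close>.\<close>

lemma uniform_lower_bound:
  fixes f :: "nat \<Rightarrow> 'a \<Rightarrow> ereal" and g :: "nat \<Rightarrow> real"
  assumes small: "\<And>n. n \<ge> 2 \<Longrightarrow> \<exists>a>0. \<forall>D. P D \<longrightarrow> ereal a \<le> f n D"
    and large: "0 < c" "\<And>n D. n \<ge> 2 \<Longrightarrow> n \<ge> n0 \<Longrightarrow> P D \<Longrightarrow> ereal (c / g n) \<le> f n D"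
    and g: "\<And>n. n \<ge> 2 \<Longrightarrow> g n > 0"
  shows "\<exists>K>0. \<forall>D. P D \<longrightarrow> (\<forall>n\<ge>2. ereal (K / g n) \<le> f n D)"
proof -
  obtain a where a: "\<And>n. n \<ge> 2 \<Longrightarrow> a n > 0" "\<And>n D. n \<ge> 2 \<Longrightarrow> P D \<Longrightarrow> ereal (a n) \<le> f n D"
    using small by metis
  define S where "S = insert c ((\<lambda>n. a n * g n) ` {2..<n0})"
  have S: "finite S" "S \<noteq> {}" "\<forall>x\<in>S. x > 0"
    using a g large(1) by (auto simp: S_def)
  have "ereal (Min S / g n) \<le> f n D" if "P D" "n \<ge> 2" for n D
  proof (cases "n \<ge> n0")
    case True
    have "Min S \<le> c" using S by (auto simp: S_def)
    then have "Min S / g n \<le> c / g n" using g[OF that(2)] by (intro divide_right_mono) auto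
    then show ?thesis using large(2)[OF that(2) True that(1)] by (meson ereal_less_eq(3) order_trans)
  next
    case False
    then have "Min S \<le> a n * g n" using S that by (intro Min_le) (auto simp: S_def)
    then have "Min S / g n \<le> a n" using g[OF that(2)] by (simp add: divide_le_eq)
    then show ?thesis using a(2)[OF that(2,1)] by (meson ereal_less_eq(3) order_trans)
  qed
  moreover have "Min S > 0" using S by simp
  ultimately show ?thesis by blast
qed

text \<open>Stated for any family of weights dominated by one \<open>c\<close> independent of
  \<open>n\<close>, so that the smooth and the square-free case are two instances.\<close>

lemma two_sided_bounds:
  fixes w :: "nat \<Rightarrow> nat \<Rightarrow> real" and \<nu> :: "nat \<Rightarrow> real measure"
  assumes theta: "\<theta> > 0"
    and weight: "\<And>n. panjer_weight (w n) (nth_prime n) \<theta> \<kappa>"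
    and c: "\<And>n N. w n N \<le> c N" "\<And>N. 0 \<le> c N"
    and \<nu>: "\<And>n. \<nu> n = panjer_law.lawX (w n) (nth_prime n)"
  shows "(\<exists>K1>0. \<forall>D. gen_dickman \<theta> D \<longrightarrow> (\<forall>n\<ge>2. K1 / ln (real n) powr min 1 \<theta> \<le> dist_K (\<nu> n) D))"
    and "(\<exists>K2. \<forall>D. gen_dickman \<theta> D \<longrightarrow> (\<forall>n\<ge>2. dist_K (\<nu> n) D \<le> K2 / ln (real n) powr min 1 \<theta>))"
    and "(\<exists>K3>0. \<forall>D. gen_dickman \<theta> D \<longrightarrow> (\<forall>n\<ge>2. ereal (K3 / ln (real n)) \<le> dist_11 (\<nu> n) D))"
    and "(\<exists>K4. \<forall>D. gen_dickman \<theta> D \<longrightarrow> (\<forall>n\<ge>2. dist_11 (\<nu> n) D \<le> ereal (K4 / ln (real n))))"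
proof -
  obtain M where M: "M \<ge> 0" "\<And>x. x \<ge> 1 \<Longrightarrow> \<bar>(\<Sum>p | prime p \<and> real p \<le> x. ln (real p) / real p) - ln x\<bar> \<le> M"
    using mertens_primes by blast
  obtain B where B: "\<And>n. (\<Sum>p | prime p \<and> p \<le> n. ln (real p) / (real p * (real p - 1))) \<le> B"
    using prime_log_sums_bounded by blast
  have B0: "B \<ge> 0" using B[of 0] by simp
  obtain C where C: "C \<ge> 0" "\<And>n z. z \<ge> 1 \<Longrightarrow> (\<Sum>d\<in>{1..n}. mangoldt d / real d * (max 0 (ln (z / real d)))\<^sup>2)
     \<le> ln z ^ 3 / 3 - (1 - ln 2) * ln z ^ 2 + C * ln z"
    using sum_mangoldt_ln_square_le by blast
  obtain A where A: "A > 0" "\<And>n. n \<ge> 2 \<Longrightarrow> ln (real n) \<le> ln (real (nth_prime n))"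
    "\<And>n. n \<ge> 2 \<Longrightarrow> ln (real (nth_prime n)) \<le> A * ln (real n)"
    using ln_nth_prime_bounds by blast
  define r where "r = min 1 \<theta>"
  have r: "0 < r" "r \<le> 1" using theta by (auto simp: r_def)
  have law: "panjer_law (w n) (nth_prime n) \<theta> \<kappa> M B C" for n
    by (intro panjer_law.intro weight panjer_law_axioms.intro M B B0 C)
  have lvd: "law_vs_dickman (w n) (nth_prime n) \<theta> \<kappa> M B C D" if "gen_dickman \<theta> D" for n D
    by (intro law_vs_dickman.intro law dickman_law.intro theta that)
  define L where "L n = ln (real (nth_prime n))" for n
  have L_eq: "panjer_weight.L (nth_prime n) = L n" for n
    using panjer_weight.L_def[OF weight[of n]] by (simp add: L_def)
  have ln_pos: "ln (real n) > 0" if "n \<ge> 2" for n using that by simp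
  have Lb: "0 < L n" "ln (real n) \<le> L n" "L n \<le> A * ln (real n)" if "n \<ge> 2" for n
    using A(2,3)[OF that] ln_pos[OF that] by (auto simp: L_def)
  \<comment> \<open>Outside their locales these constants take only \<open>\<theta>\<close>,
    \<open>M\<close> and \<open>B\<close> as arguments, hence are the same for all \<open>n\<close>
    and \<open>D\<close>.\<close>
  define ce mm cs where "ce = panjer_law.c_eps \<theta> M B" and "mm = panjer_law.m0 \<theta> M B"
    and "cs = law_vs_dickman.c_stop \<theta> M B"
  define dk where "dk = dk_const \<theta>"
  have dk: "dk \<ge> 2" unfolding dk_def by (rule dk_const_bounds(1)[OF theta])

  show "\<exists>K2. \<forall>D. gen_dickman \<theta> D \<longrightarrow> (\<forall>n\<ge>2. dist_K (\<nu> n) D \<le> K2 / ln (real n) powr min 1 \<theta>)"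
  proof (intro exI[of _ "dk * ce powr r"] allI impI)
    fix D n assume D: "gen_dickman \<theta> D" and n: "(2::nat) \<le> n"
    interpret law_vs_dickman "w n" "nth_prime n" \<theta> \<kappa> M B C D by (rule lvd[OF D])
    have "dist_K (\<nu> n) D \<le> dk * ce powr r / L n powr r"
      using dist_K_upper by (simp add: \<nu> dk_def ce_def r_def L_eq)
    also have "\<dots> \<le> dk * ce powr r / ln (real n) powr r"
      using dk Lb[OF n] ln_pos[OF n] r by (intro divide_left_mono powr_mono2 mult_nonneg_nonneg) auto
    finally show "dist_K (\<nu> n) D \<le> dk * ce powr r / ln (real n) powr min 1 \<theta>" by (simp add: r_def)
  qed

  show "\<exists>K4. \<forall>D. gen_dickman \<theta> D \<longrightarrow> (\<forall>n\<ge>2. dist_11 (\<nu> n) D \<le> ereal (K4 / ln (real n)))"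
  proof (intro exI[of _ "(2 + dk / \<theta> + dk) * ce"] allI impI)
    fix D n assume D: "gen_dickman \<theta> D" and n: "(2::nat) \<le> n"
    interpret law_vs_dickman "w n" "nth_prime n" \<theta> \<kappa> M B C D by (rule lvd[OF D])
    have ce: "ce > 0" using c_eps_pos by (simp add: ce_def)
    have "dist_11 (\<nu> n) D \<le> ereal ((2 + dk / \<theta> + dk) * ce / L n)"
      using dist_11_upper by (simp add: \<nu> dk_def ce_def L_eq)
    also have "(2 + dk / \<theta> + dk) * ce / L n \<le> (2 + dk / \<theta> + dk) * ce / ln (real n)"
      using dk ce theta Lb[OF n] ln_pos[OF n]
      by (intro divide_left_mono mult_nonneg_nonneg add_nonneg_nonneg) auto
    finally show "dist_11 (\<nu> n) D \<le> ereal ((2 + dk / \<theta> + dk) * ce / ln (real n))" by simp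
  qed

  \<comment> \<open>For each single \<open>n\<close> the atom at 0 keeps both distances positive,
    uniformly in \<open>D\<close>; this serves the \<open>n\<close> below \<open>n0\<close>.\<close>
  have small: "\<exists>a>0. \<forall>D. gen_dickman \<theta> D \<longrightarrow> a \<le> dist_K (\<nu> n) D \<and> ereal a \<le> dist_11 (\<nu> n) D" for n
  proof -
    interpret pl: panjer_law "w n" "nth_prime n" \<theta> \<kappa> M B C by (rule law)
    define a where "a = pl.E (\<lambda>N. of_bool (pl.X N \<le> 0))"
    define s where "s = min 1 ((a / (2 * (2 * (1 + \<theta>) * (3/2) powr (1 + \<theta>)))) powr (1 / \<theta>))"
    have a: "a > 0" using pl.atom_pos by (simp add: a_def)
    have s: "s > 0" using a theta by (simp add: s_def)
    have "min a (s ^ 2 * a / 4) \<le> dist_K (\<nu> n) D \<and> ereal (min a (s ^ 2 * a / 4)) \<le> dist_11 (\<nu> n) D"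
      if D: "gen_dickman \<theta> D" for D
    proof -
      interpret law_vs_dickman "w n" "nth_prime n" \<theta> \<kappa> M B C D by (rule lvd[OF D])
      have "a \<le> dist_K (\<nu> n) D" using dist_K_ge_atom by (simp add: a_def \<nu>)
      moreover have "ereal (s ^ 2 * a / 4) \<le> dist_11 (\<nu> n) D"
        using dist_11_ge_atom[OF a] by (simp add: a_def s_def \<nu>)
      ultimately show ?thesis by (auto simp: min_le_iff_disj intro: order_trans[rotated])
    qed
    moreover have "min a (s ^ 2 * a / 4) > 0" using a s by simp
    ultimately show ?thesis by blast
  qed

  define c11 where "c11 = \<theta> * (1 - ln 2) * cs ^ 2 / 2 / (8 + 2 * \<theta>)"
  \<comment> \<open>Threshold for \<open>L\<close> that collects both conditions of
    \<open>dist_11_lower\<close>.\<close>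
  define \<Lambda> where "\<Lambda> = max (2 * ce) (2 * C / ((1 - ln 2) * cs ^ 2))"
  define n0 where "n0 = nat \<lceil>exp \<Lambda>\<rceil>"
  have L_large: "\<Lambda> \<le> L n" if "n \<ge> 2" "n \<ge> n0" for n
  proof -
    have "exp \<Lambda> \<le> real n" using that(2) unfolding n0_def by linarith
    then have "\<Lambda> \<le> ln (real n)" using that(1) by (subst ln_ge_iff) auto
    then show ?thesis using Lb(2)[OF that(1)] by simp
  qed
  have large11: "ereal (c11 / L n) \<le> dist_11 (\<nu> n) D"
    if n: "n \<ge> 2" "n \<ge> n0" and D: "gen_dickman \<theta> D" for n D
  proof -
    interpret law_vs_dickman "w n" "nth_prime n" \<theta> \<kappa> M B C D by (rule lvd[OF D])
    have "ereal (\<theta> * (1 - ln 2) * cs ^ 2 / 2 / L n / (8 + 2 * \<theta>)) \<le> dist_11 (\<nu> n) D"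
      using dist_11_lower L_large[OF n] by (simp add: \<nu> L_eq cs_def ce_def \<Lambda>_def)
    then show ?thesis by (simp add: c11_def mult_ac)
  qed
  have mm: "mm > 0" using panjer_law.m0_pos[OF law[of 0]] by (simp add: mm_def)
  have cs: "cs > 0" if "gen_dickman \<theta> D" for D
    using mm law_vs_dickman.c_stop_def[OF lvd[OF that, of 0]] by (simp add: cs_def mm_def)
  have c11: "c11 > 0" if "gen_dickman \<theta> D" for D
    using theta cs[OF that] ln_2_less_1 by (simp add: c11_def)
  have ce_pos: "ce > 0" if "gen_dickman \<theta> D" for D
    using law_vs_dickman.c_eps_pos[OF lvd[OF that, of 0]] by (simp add: ce_def)

  show "\<exists>K3>0. \<forall>D. gen_dickman \<theta> D \<longrightarrow> (\<forall>n\<ge>2. ereal (K3 / ln (real n)) \<le> dist_11 (\<nu> n) D)"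
  \<comment> \<open>Positivity of \<open>c11\<close> is obtained in a locale that fixes some
    \<open>D\<close>; if there is none, the claim is vacuous and 1 serves as constant.\<close>
  proof (cases "\<exists>D. gen_dickman \<theta> D")
    case True
    then have c11: "c11 > 0" using c11 by blast
    show ?thesis
    proof (rule uniform_lower_bound[where c = "c11 / A"])
      show "\<exists>a>0. \<forall>D. gen_dickman \<theta> D \<longrightarrow> ereal a \<le> dist_11 (\<nu> n) D" for n using small[of n] by blast
      show "0 < c11 / A" using c11 A by simp
      fix n D assume n: "n \<ge> 2" "n0 \<le> n" and D: "gen_dickman \<theta> D"
      have "c11 / (A * ln (real n)) \<le> c11 / L n"
        using c11 Lb[OF n(1)] by (intro divide_left_mono) auto
      then show "ereal (c11 / A / ln (real n)) \<le> dist_11 (\<nu> n) D"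
        using large11[OF n D] by (simp add: order_trans[rotated])
    qed (rule ln_pos)
  qed (auto intro: exI[of _ 1])

  show "\<exists>K1>0. \<forall>D. gen_dickman \<theta> D \<longrightarrow> (\<forall>n\<ge>2. K1 / ln (real n) powr min 1 \<theta> \<le> dist_K (\<nu> n) D)"
  proof (cases "\<exists>D. gen_dickman \<theta> D")
    case True
    then have c11: "c11 > 0" and ce: "ce > 0" using c11 ce_pos by blast+
    have "\<exists>cK>0. \<forall>n\<ge>2. n \<ge> n0 \<longrightarrow> (\<forall>D. gen_dickman \<theta> D \<longrightarrow> cK / L n powr r \<le> dist_K (\<nu> n) D)"
    proof (cases "\<theta> \<le> 1")
      case True
      define cK where "cK = (ce / (mm + 1)) powr (1 + \<theta>) / (2 * ce) / (1 + (\<Sum>N\<in>{1..nat \<lceil>exp (2 * ce)\<rceil>}. c N))"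
      have "1 + (\<Sum>N\<in>{1..nat \<lceil>exp (2 * ce)\<rceil>}. c N) > 0" by (intro add_pos_nonneg sum_nonneg c) auto
      then have "cK > 0" using ce mm by (simp add: cK_def)
      moreover have "cK / L n powr r \<le> dist_K (\<nu> n) D"
        if n: "n \<ge> 2" "n \<ge> n0" and D: "gen_dickman \<theta> D" for n D
      proof -
        interpret law_vs_dickman "w n" "nth_prime n" \<theta> \<kappa> M B C D by (rule lvd[OF D])
        show ?thesis
          using dist_K_ge_power[of c] c L_large[OF n] True
          by (simp add: \<nu> L_eq cK_def ce_def mm_def \<Lambda>_def r_def)
      qed
      ultimately show ?thesis by blast
    next
      case False
      \<comment> \<open>Makes the tail term \<open>dk * ce / L n / R\<close> at most half of
        \<open>c11 / L n\<close>.\<close>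
      define R where "R = max 1 (2 * dk * ce / c11)"
      have R: "R \<ge> 1" "2 * dk * ce \<le> c11 * R"
      proof -
        show "R \<ge> 1" by (simp add: R_def)
        have "2 * dk * ce / c11 \<le> R" by (simp add: R_def)
        then show "2 * dk * ce \<le> c11 * R" using c11 by (simp add: pos_divide_le_eq mult.commute)
      qed
      have "c11 / (2 * R) / L n powr r \<le> dist_K (\<nu> n) D"
        if n: "n \<ge> 2" "n \<ge> n0" and D: "gen_dickman \<theta> D" for n D
      proof -
        interpret law_vs_dickman "w n" "nth_prime n" \<theta> \<kappa> M B C D by (rule lvd[OF D])
        have "ereal (c11 / L n) \<le> ereal (R * dist_K (\<nu> n) D + dk * ce / L n / R)"
          by (rule order_trans[OF large11[OF n D]])
             (use dist_11_le_dist_K[OF R(1)] in \<open>simp add: \<nu> L_eq dk_def ce_def\<close>)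
        then have "c11 / L n \<le> R * dist_K (\<nu> n) D + dk * ce / L n / R" by simp
        moreover have "dk * ce / L n / R \<le> c11 / L n / 2"
          using R Lb(1)[OF n(1)] by (simp add: field_simps)
        ultimately have "c11 / L n / 2 \<le> R * dist_K (\<nu> n) D" by linarith
        moreover have "R > 0" using R(1) by simp
        ultimately have "c11 / L n / 2 / R \<le> dist_K (\<nu> n) D"
          by (simp only: pos_divide_le_eq mult.commute[of _ R])
        then show ?thesis using False Lb(1)[OF n(1)] by (simp add: r_def mult_ac)
      qed
      moreover have "c11 / (2 * R) > 0" using c11 R(1) by simp
      ultimately show ?thesis by blast
    qed
    then obtain cK where cK: "cK > 0"
      "\<And>n D. n \<ge> 2 \<Longrightarrow> n \<ge> n0 \<Longrightarrow> gen_dickman \<theta> D \<Longrightarrow> cK / L n powr r \<le> dist_K (\<nu> n) D" by blast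
    have "\<exists>K1>0. \<forall>D. gen_dickman \<theta> D \<longrightarrow> (\<forall>n\<ge>2. ereal (K1 / ln (real n) powr min 1 \<theta>) \<le> ereal (dist_K (\<nu> n) D))"
    proof (rule uniform_lower_bound[where c = "cK / A powr r"])
      show "\<exists>a>0. \<forall>D. gen_dickman \<theta> D \<longrightarrow> ereal a \<le> ereal (dist_K (\<nu> n) D)" for n
        using small[of n] by auto
      show "0 < cK / A powr r" using cK A by simp
      show "ln (real n) powr min 1 \<theta> > 0" if "n \<ge> 2" for n using ln_pos[OF that] by simp
      fix n D assume n: "n \<ge> 2" "n0 \<le> n" and D: "gen_dickman \<theta> D"
      have "cK / (A * ln (real n)) powr r \<le> cK / L n powr r"
        using cK Lb[OF n(1)] r A(1) ln_pos[OF n(1)] by (intro divide_left_mono powr_mono2) auto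
      also have "\<dots> \<le> dist_K (\<nu> n) D" by (rule cK(2)[OF n D])
      finally show "ereal (cK / A powr r / ln (real n) powr min 1 \<theta>) \<le> ereal (dist_K (\<nu> n) D)"
        using A(1) ln_pos[OF n(1)] by (simp add: powr_mult r_def)
    qed
    then show ?thesis by simp
  qed (auto intro: exI[of _ 1])
qed

lemma scaled_log_law_eq:
  assumes theta: "\<theta> > 0"
  shows "scaled_log_law \<theta> n = panjer_law.lawX (\<lambda>N. if N \<in> smooth n then tau \<theta> N / real N else 0) (nth_prime n)"
    and "scaled_log_law_sq \<theta> n = panjer_law.lawX (\<lambda>N. if N \<in> smooth_sq n then tau \<theta> N / real N else 0) (nth_prime n)"
proof -
  obtain M where M: "M \<ge> 0" "\<And>x. x \<ge> 1 \<Longrightarrow> \<bar>(\<Sum>p | prime p \<and> real p \<le> x. ln (real p) / real p) - ln x\<bar> \<le> M"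
    using mertens_primes by blast
  obtain B where B: "\<And>n. (\<Sum>p | prime p \<and> p \<le> n. ln (real p) / (real p * (real p - 1))) \<le> B"
    using prime_log_sums_bounded by blast
  have B0: "B \<ge> 0" using B[of 0] by simp
  obtain C where C: "C \<ge> 0" "\<And>n z. z \<ge> 1 \<Longrightarrow> (\<Sum>d\<in>{1..n}. mangoldt d / real d * (max 0 (ln (z / real d)))\<^sup>2)
     \<le> ln z ^ 3 / 3 - (1 - ln 2) * ln z ^ 2 + C * ln z"
    using sum_mangoldt_ln_square_le by blast
  interpret S: panjer_law "\<lambda>N. if N \<in> smooth n then tau \<theta> N / real N else 0" "nth_prime n" \<theta> 1 M B C
    by (intro panjer_law.intro panjer_weight_smooth theta panjer_law_axioms.intro M B B0 C)
  interpret Q: panjer_law "\<lambda>N. if N \<in> smooth_sq n then tau \<theta> N / real N else 0" "nth_prime n" \<theta> "- \<theta>" M B C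
    by (intro panjer_law.intro panjer_weight_smooth_sq theta panjer_law_axioms.intro M B B0 C)
  have X: "S.X = (\<lambda>N. ln (real N) / ln (real (nth_prime n)))"
    by (simp add: fun_eq_iff S.X_def S.L_def)
  show "scaled_log_law \<theta> n = S.lawX"
    using S.distr_point_measure_eq[OF refl]
    by (simp add: scaled_log_law_def weighted_law_def Zconst_def X)
  show "scaled_log_law_sq \<theta> n = Q.lawX"
    using Q.distr_point_measure_eq[OF refl]
    by (simp add: scaled_log_law_sq_def weighted_law_def Zconst_def X)
qed

theorem theorem2p1:
  fixes \<theta> :: real
  assumes "\<theta> > 0"
  shows "(\<exists>K1 K2 :: real. 0 < K1 \<and> K1 \<le> K2 \<and>
            (\<forall>D. gen_dickman \<theta> D \<longrightarrow> (\<forall>n::nat. n \<ge> 2 \<longrightarrow>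
               K1 / ln (real n) powr min 1 \<theta> \<le> dist_K (scaled_log_law \<theta> n) D \<and>
               dist_K (scaled_log_law \<theta> n) D \<le> K2 / ln (real n) powr min 1 \<theta> \<and>
               K1 / ln (real n) powr min 1 \<theta> \<le> dist_K (scaled_log_law_sq \<theta> n) D \<and>
               dist_K (scaled_log_law_sq \<theta> n) D \<le> K2 / ln (real n) powr min 1 \<theta>)))
       \<and> (\<exists>K3 K4 :: real. 0 < K3 \<and> K3 \<le> K4 \<and>
            (\<forall>D. gen_dickman \<theta> D \<longrightarrow> (\<forall>n::nat. n \<ge> 2 \<longrightarrow>
               ereal (K3 / ln (real n)) \<le> dist_11 (scaled_log_law \<theta> n) D \<and>
               dist_11 (scaled_log_law \<theta> n) D \<le> ereal (K4 / ln (real n)) \<and>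
               ereal (K3 / ln (real n)) \<le> dist_11 (scaled_log_law_sq \<theta> n) D \<and>
               dist_11 (scaled_log_law_sq \<theta> n) D \<le> ereal (K4 / ln (real n)))))"
proof -
  \<comment> \<open>Without the restriction to smooth integers, \<open>c\<close> dominates both
    weights and does not involve \<open>n\<close>.\<close>
  define c where "c N = tau \<theta> N / real N" for N
  have c: "0 \<le> c N" for N using tau_nonneg[OF assms] by (simp add: c_def)
  note S = two_sided_bounds[OF assms panjer_weight_smooth[OF assms], of c, OF _ c scaled_log_law_eq(1)[OF assms]]
  note Q = two_sided_bounds[OF assms panjer_weight_smooth_sq[OF assms], of c, OF _ c scaled_log_law_eq(2)[OF assms]]
  have bS: "(if N \<in> smooth n then tau \<theta> N / real N else 0) \<le> c N" for n N using c[of N] by (simp add: c_def)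
  have bQ: "(if N \<in> smooth_sq n then tau \<theta> N / real N else 0) \<le> c N" for n N using c[of N] by (simp add: c_def)
  obtain a1 where a1: "a1 > 0" "\<And>D n. gen_dickman \<theta> D \<Longrightarrow> n \<ge> 2 \<Longrightarrow>
      a1 / ln (real n) powr min 1 \<theta> \<le> dist_K (scaled_log_law \<theta> n) D" using S(1)[OF bS] by blast
  obtain a2 where a2: "\<And>D n. gen_dickman \<theta> D \<Longrightarrow> n \<ge> 2 \<Longrightarrow>
      dist_K (scaled_log_law \<theta> n) D \<le> a2 / ln (real n) powr min 1 \<theta>" using S(2)[OF bS] by blast
  obtain a3 where a3: "a3 > 0" "\<And>D n. gen_dickman \<theta> D \<Longrightarrow> n \<ge> 2 \<Longrightarrow>
      ereal (a3 / ln (real n)) \<le> dist_11 (scaled_log_law \<theta> n) D" using S(3)[OF bS] by blast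
  obtain a4 where a4: "\<And>D n. gen_dickman \<theta> D \<Longrightarrow> n \<ge> 2 \<Longrightarrow>
      dist_11 (scaled_log_law \<theta> n) D \<le> ereal (a4 / ln (real n))" using S(4)[OF bS] by blast
  obtain b1 where b1: "b1 > 0" "\<And>D n. gen_dickman \<theta> D \<Longrightarrow> n \<ge> 2 \<Longrightarrow>
      b1 / ln (real n) powr min 1 \<theta> \<le> dist_K (scaled_log_law_sq \<theta> n) D" using Q(1)[OF bQ] by blast
  obtain b2 where b2: "\<And>D n. gen_dickman \<theta> D \<Longrightarrow> n \<ge> 2 \<Longrightarrow>
      dist_K (scaled_log_law_sq \<theta> n) D \<le> b2 / ln (real n) powr min 1 \<theta>" using Q(2)[OF bQ] by blast
  obtain b3 where b3: "b3 > 0" "\<And>D n. gen_dickman \<theta> D \<Longrightarrow> n \<ge> 2 \<Longrightarrow>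
      ereal (b3 / ln (real n)) \<le> dist_11 (scaled_log_law_sq \<theta> n) D" using Q(3)[OF bQ] by blast
  obtain b4 where b4: "\<And>D n. gen_dickman \<theta> D \<Longrightarrow> n \<ge> 2 \<Longrightarrow>
      dist_11 (scaled_log_law_sq \<theta> n) D \<le> ereal (b4 / ln (real n))" using Q(4)[OF bQ] by blast
  \<comment> \<open>Including \<open>k1\<close> and \<open>k3\<close> in the maxima makes the
    required order of the constants hold by construction.\<close>
  define k1 k2 k3 k4 where "k1 = min a1 b1" and "k2 = max k1 (max a2 b2)"
    and "k3 = min a3 b3" and "k4 = max k3 (max a4 b4)"
  have k: "0 < k1" "k1 \<le> k2" "0 < k3" "k3 \<le> k4" "k1 \<le> a1" "k1 \<le> b1" "a2 \<le> k2" "b2 \<le> k2"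
    "k3 \<le> a3" "k3 \<le> b3" "a4 \<le> k4" "b4 \<le> k4"
    using a1(1) a3(1) b1(1) b3(1) by (auto simp: k1_def k2_def k3_def k4_def)
  have mono: "x / ln (real n) powr min 1 \<theta> \<le> x' / ln (real n) powr min 1 \<theta>"
      "ereal (x / ln (real n)) \<le> ereal (x' / ln (real n))" if "x \<le> x'" "n \<ge> 2" for x x' :: real and n
    using that by (auto intro!: divide_right_mono)
  show ?thesis
  proof (rule conjI)
    show "\<exists>K1 K2 :: real. 0 < K1 \<and> K1 \<le> K2 \<and>
            (\<forall>D. gen_dickman \<theta> D \<longrightarrow> (\<forall>n::nat. n \<ge> 2 \<longrightarrow>
               K1 / ln (real n) powr min 1 \<theta> \<le> dist_K (scaled_log_law \<theta> n) D \<and>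
               dist_K (scaled_log_law \<theta> n) D \<le> K2 / ln (real n) powr min 1 \<theta> \<and>
               K1 / ln (real n) powr min 1 \<theta> \<le> dist_K (scaled_log_law_sq \<theta> n) D \<and>
               dist_K (scaled_log_law_sq \<theta> n) D \<le> K2 / ln (real n) powr min 1 \<theta>))"
      by (rule exI[of _ k1], rule exI[of _ k2])
         (intro conjI allI impI k order_trans[OF mono(1) a1(2)] order_trans[OF mono(1) b1(2)]
           order_trans[OF a2 mono(1)] order_trans[OF b2 mono(1)])
    show "\<exists>K3 K4 :: real. 0 < K3 \<and> K3 \<le> K4 \<and>
            (\<forall>D. gen_dickman \<theta> D \<longrightarrow> (\<forall>n::nat. n \<ge> 2 \<longrightarrow>
               ereal (K3 / ln (real n)) \<le> dist_11 (scaled_log_law \<theta> n) D \<and>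
               dist_11 (scaled_log_law \<theta> n) D \<le> ereal (K4 / ln (real n)) \<and>
               ereal (K3 / ln (real n)) \<le> dist_11 (scaled_log_law_sq \<theta> n) D \<and>
               dist_11 (scaled_log_law_sq \<theta> n) D \<le> ereal (K4 / ln (real n))))"
      by (rule exI[of _ k3], rule exI[of _ k4])
         (intro conjI allI impI k order_trans[OF mono(2) a3(2)] order_trans[OF mono(2) b3(2)]
           order_trans[OF a4 mono(2)] order_trans[OF b4 mono(2)])
  qed
qed

end
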